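(* Let $M$ be a connected complete Riemannian manifold of dimension $d$. Fix $x_0\in M$ and define $r(x)=d(x,x_0)$. Assume there is a constant $C>0$ such that $|b(x,i)|\le C(1+r(x))$ for all $x\in M$ and $i\in S$. Then there exists a nonnegative smooth function $f\in C^\infty(M)$ satisfying $|f-r|\le1$ and $|\mathrm{d}f|\le2$ on $M$ such that $$\Upsilon(x)=\tfrac12\log\big(1+f^2(x)\big)$$ is a good containment function for $\mathcal{H}$.
   Context: $S=\{1,\dots,N\}$, $N<\infty$; for each $i\in S$, $b(\cdot,i)$ is a $C^1$ vector field on $M$; for each $x\in M$, $(q_{ij}(x))_{i,j\in S}$ is a conservative, irreducible transition rate matrix. For $x\in M$, $p\in T_x^*M$: $$\mathcal{H}(x,p)=\sup_{\pi\in\mathcal{P}(S)}\Big\{\int_S B_{x,p}(z)\pi(\mathrm{d}z)-\mathcal{I}(x,\pi)\Big\},\quad B_{x,p}(z)=p\,b(x,z)+\tfrac12|p|^2,$$ $$\mathcal{I}(x,\pi)=-\inf_{g:S\to(0,\infty)}\int_S\frac{R_xg(z)}{g(z)}\pi(\mathrm{d}z),\quad R_xg(z)=\sum_{j\in S}q_{zj}(x)(g(j)-g(z)).$$ A function $\Upsilon:M\to\mathbb{R}$ is a good containment function for $\mathcal{H}$ if: (a) $\Upsilon\ge0$ and there is a point at which $\Upsilon$ equals $0$; (b) $\Upsilon$ is twice continuously differentiable; (c) for every $c\ge0$ the set $\{x\in M:\Upsilon(x)\le c\}$ is compact; (d) $\sup_x\mathcal{H}(x,\mathrm{d}\Upsilon(x))<\infty$.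 *)

theory Defs
  imports "HOL-Analysis.Analysis" "HOL-Probability.Probability_Mass_Function"
begin

section \<open>Differentiability classes on open sets of a Euclidean space\<close>

text \<open>Only meaningful for open sets \<open>S\<close>, because two-sided derivatives are used. All directional
  derivatives of a differentiable map being of class \<open>C\<^sup>k\<close> is the same as its differential
  being of class \<open>C\<^sup>k\<close>, the domain being finite-dimensional.\<close>

primrec Ck_on :: "nat \<Rightarrow> 'e::euclidean_space set \<Rightarrow> ('e \<Rightarrow> 'b::real_normed_vector) \<Rightarrow> bool" where
  "Ck_on 0 S f \<longleftrightarrow> continuous_on S f"
| "Ck_on (Suc k) S f \<longleftrightarrow>
     (\<forall>x\<in>S. f differentiable (at x)) \<and>
     (\<forall>v. Ck_on k S (\<lambda>x. frechet_derivative f (at x) v))"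

definition smooth_on :: "'e::euclidean_space set \<Rightarrow> ('e \<Rightarrow> 'b::real_normed_vector) \<Rightarrow> bool" where
  "smooth_on S f \<longleftrightarrow> (\<forall>k. Ck_on k S f)"


section \<open>Smooth manifolds\<close>

text \<open>The manifold is the whole type \<open>'m\<close>, a second countable Hausdorff space, together with a
  smooth atlas (not necessarily maximal) of charts with values in the model space \<open>'e\<close>; the
  dimension is \<open>DIM('e)\<close>. The coordinate map of a chart matters only on its domain.\<close>

datatype ('m, 'e) chart = Chart (chart_dom: "'m set") (chart_map: "'m \<Rightarrow> 'e")

definition chart_im :: "('m, 'e) chart \<Rightarrow> 'e set" where
  "chart_im c = chart_map c ` chart_dom c"

definition chart_inv :: "('m, 'e) chart \<Rightarrow> 'e \<Rightarrow> 'm" where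
  "chart_inv c = inv_into (chart_dom c) (chart_map c)"

definition smooth_atlas ::
  "('m::{t2_space,second_countable_topology}, 'e::euclidean_space) chart set \<Rightarrow> bool" where
  "smooth_atlas A \<longleftrightarrow>
     (\<forall>c\<in>A. open (chart_dom c) \<and> open (chart_im c) \<and>
        homeomorphism (chart_dom c) (chart_im c) (chart_map c) (chart_inv c)) \<and>
     (\<Union>c\<in>A. chart_dom c) = UNIV \<and>
     (\<forall>c\<in>A. \<forall>c'\<in>A. smooth_on (chart_map c ` (chart_dom c \<inter> chart_dom c'))
        (chart_map c' \<circ> chart_inv c))"

definition Ck_fun :: "('m, 'e::euclidean_space) chart set \<Rightarrow> nat \<Rightarrow> ('m \<Rightarrow> real) \<Rightarrow> bool" where
  "Ck_fun A k f \<longleftrightarrow> (\<forall>c\<in>A. Ck_on k (chart_im c) (f \<circ> chart_inv c))"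

definition smooth_fun :: "('m, 'e::euclidean_space) chart set \<Rightarrow> ('m \<Rightarrow> real) \<Rightarrow> bool" where
  "smooth_fun A f \<longleftrightarrow> (\<forall>c\<in>A. smooth_on (chart_im c) (f \<circ> chart_inv c))"


section \<open>Tangent vectors, differentials and vector fields\<close>

text \<open>A tangent vector at \<open>x\<close> assigns to each chart around \<open>x\<close> a coordinate vector, in such a way
  that the coordinate vectors transform by the differentials of the transition maps. Charts that
  do not contain \<open>x\<close> get the value \<open>0\<close>, so that a tangent vector is determined by its coordinates
  in one chart around \<open>x\<close>. The vector space operations are pointwise.\<close>

type_synonym ('m, 'e) tangent = "('m, 'e) chart \<Rightarrow> 'e"

definition transition_deriv ::
  "('m, 'e::euclidean_space) chart \<Rightarrow> ('m, 'e) chart \<Rightarrow> 'm \<Rightarrow> 'e \<Rightarrow> 'e" where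
  "transition_deriv c c' x =
     frechet_derivative (chart_map c' \<circ> chart_inv c) (at (chart_map c x))"

definition tangent_space ::
  "('m, 'e::euclidean_space) chart set \<Rightarrow> 'm \<Rightarrow> ('m, 'e) tangent set" where
  "tangent_space A x =
     {v. (\<forall>c\<in>A. \<forall>c'\<in>A. x \<in> chart_dom c \<longrightarrow> x \<in> chart_dom c' \<longrightarrow>
            v c' = transition_deriv c c' x (v c)) \<and>
         (\<forall>c. c \<notin> A \<or> x \<notin> chart_dom c \<longrightarrow> v c = 0)}"

text \<open>The tangent vector at \<open>x\<close> whose coordinate vector in the chart \<open>c\<close> is \<open>e\<close>.\<close>

definition tangent_of_coord ::
  "('m, 'e::euclidean_space) chart set \<Rightarrow> ('m, 'e) chart \<Rightarrow> 'm \<Rightarrow> 'e \<Rightarrow> ('m, 'e) tangent" where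
  "tangent_of_coord A c x e =
     (\<lambda>c'. if c' \<in> A \<and> x \<in> chart_dom c' then transition_deriv c c' x e else 0)"

text \<open>By the chain rule the value of the differential on a tangent vector does not depend on the
  chosen chart.\<close>

definition differential ::
  "('m, 'e::euclidean_space) chart set \<Rightarrow> ('m \<Rightarrow> real) \<Rightarrow> 'm \<Rightarrow> ('m, 'e) tangent \<Rightarrow> real" where
  "differential A f x v =
     (let c = (SOME c. c \<in> A \<and> x \<in> chart_dom c)
      in frechet_derivative (f \<circ> chart_inv c) (at (chart_map c x)) (v c))"

definition C1_vector_field ::
  "('m, 'e::euclidean_space) chart set \<Rightarrow> ('m \<Rightarrow> ('m, 'e) tangent) \<Rightarrow> bool" where
  "C1_vector_field A V \<longleftrightarrow>
     (\<forall>x. V x \<in> tangent_space A x) \<and>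
     (\<forall>c\<in>A. Ck_on 1 (chart_im c) (\<lambda>y. V (chart_inv c y) c))"


section \<open>Riemannian metrics\<close>

type_synonym ('m, 'e) metric = "'m \<Rightarrow> ('m, 'e) tangent \<Rightarrow> ('m, 'e) tangent \<Rightarrow> real"

definition riemannian_metric ::
  "('m, 'e::euclidean_space) chart set \<Rightarrow> ('m, 'e) metric \<Rightarrow> bool" where
  "riemannian_metric A g \<longleftrightarrow>
     (\<forall>x. \<forall>u\<in>tangent_space A x. \<forall>v\<in>tangent_space A x. g x u v = g x v u) \<and>
     (\<forall>x. \<forall>u\<in>tangent_space A x. \<forall>v\<in>tangent_space A x. \<forall>w\<in>tangent_space A x.
        g x (\<lambda>c. u c + v c) w = g x u w + g x v w) \<and>
     (\<forall>x. \<forall>u\<in>tangent_space A x. \<forall>w\<in>tangent_space A x. \<forall>a.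
        g x (\<lambda>c. a *\<^sub>R u c) w = a * g x u w) \<and>
     (\<forall>x. \<forall>v\<in>tangent_space A x. v \<noteq> (\<lambda>c. 0) \<longrightarrow> g x v v > 0) \<and>
     (\<forall>c\<in>A. \<forall>e e'. smooth_on (chart_im c)
        (\<lambda>y. g (chart_inv c y) (tangent_of_coord A c (chart_inv c y) e)
                               (tangent_of_coord A c (chart_inv c y) e')))"

definition riemannian_manifold ::
  "('m::{t2_space,second_countable_topology}, 'e::euclidean_space) chart set \<Rightarrow>
   ('m, 'e) metric \<Rightarrow> bool" where
  "riemannian_manifold A g \<longleftrightarrow> smooth_atlas A \<and> riemannian_metric A g"

definition tangent_norm :: "('m, 'e) metric \<Rightarrow> 'm \<Rightarrow> ('m, 'e) tangent \<Rightarrow> real" where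
  "tangent_norm g x v = sqrt (g x v v)"

text \<open>The dual norm on covectors, i.e. linear functionals on the tangent space. For these the
  supremum is finite.\<close>

definition cotangent_norm ::
  "('m, 'e::euclidean_space) chart set \<Rightarrow> ('m, 'e) metric \<Rightarrow> 'm \<Rightarrow>
   (('m, 'e) tangent \<Rightarrow> real) \<Rightarrow> real" where
  "cotangent_norm A g x p = (SUP v\<in>{v \<in> tangent_space A x. tangent_norm g x v \<le> 1}. \<bar>p v\<bar>)"

definition C1_curve_on ::
  "('m::topological_space, 'e::euclidean_space) chart set \<Rightarrow> real \<Rightarrow> real \<Rightarrow> (real \<Rightarrow> 'm) \<Rightarrow> bool" where
  "C1_curve_on A a b \<gamma> \<longleftrightarrow>
     continuous_on {a..b} \<gamma> \<and>
     (\<forall>c\<in>A. (\<forall>t\<in>{a..b}. \<gamma> t \<in> chart_dom c \<longrightarrow>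
                (chart_map c \<circ> \<gamma>) differentiable (at t within {a..b})) \<and>
            continuous_on {t\<in>{a..b}. \<gamma> t \<in> chart_dom c}
              (\<lambda>t. vector_derivative (chart_map c \<circ> \<gamma>) (at t within {a..b})))"

definition piecewise_C1_curve ::
  "('m::topological_space, 'e::euclidean_space) chart set \<Rightarrow> (real \<Rightarrow> 'm) \<Rightarrow> bool" where
  "piecewise_C1_curve A \<gamma> \<longleftrightarrow>
     (\<exists>n (t :: nat \<Rightarrow> real). t 0 = 0 \<and> t n = 1 \<and>
        (\<forall>i<n. t i < t (Suc i) \<and> C1_curve_on A (t i) (t (Suc i)) \<gamma>))"

definition velocity ::
  "('m, 'e::euclidean_space) chart set \<Rightarrow> (real \<Rightarrow> 'm) \<Rightarrow> real \<Rightarrow> ('m, 'e) tangent" where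
  "velocity A \<gamma> t =
     (\<lambda>c. if c \<in> A \<and> \<gamma> t \<in> chart_dom c
          then vector_derivative (chart_map c \<circ> \<gamma>) (at t within {0..1}) else 0)"

text \<open>At the finitely many break points of a piecewise \<open>C\<^sup>1\<close> curve the value of \<open>velocity\<close> is
  irrelevant for the integral.\<close>

definition curve_length ::
  "('m, 'e::euclidean_space) chart set \<Rightarrow> ('m, 'e) metric \<Rightarrow> (real \<Rightarrow> 'm) \<Rightarrow> real" where
  "curve_length A g \<gamma> = integral {0..1} (\<lambda>t. tangent_norm g (\<gamma> t) (velocity A \<gamma> t))"

definition riemannian_dist ::
  "('m::topological_space, 'e::euclidean_space) chart set \<Rightarrow> ('m, 'e) metric \<Rightarrow> 'm \<Rightarrow> 'm \<Rightarrow> real" where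
  "riemannian_dist A g x y =
     Inf {curve_length A g \<gamma> |\<gamma>. piecewise_C1_curve A \<gamma> \<and> \<gamma> 0 = x \<and> \<gamma> 1 = y}"

definition complete_riemannian ::
  "('m::topological_space, 'e::euclidean_space) chart set \<Rightarrow> ('m, 'e) metric \<Rightarrow> bool" where
  "complete_riemannian A g \<longleftrightarrow> Metric_space.mcomplete UNIV (riemannian_dist A g)"


section \<open>The Hamiltonian\<close>

text \<open>The finite state space is \<open>S = {1..N}\<close>; rate matrices are only looked at on \<open>S \<times> S\<close>.\<close>

definition conservative_rate_matrix :: "nat set \<Rightarrow> (nat \<Rightarrow> nat \<Rightarrow> real) \<Rightarrow> bool" where
  "conservative_rate_matrix S Q \<longleftrightarrow>
     (\<forall>i\<in>S. \<forall>j\<in>S. i \<noteq> j \<longrightarrow> Q i j \<ge> 0) \<and> (\<forall>i\<in>S. (\<Sum>j\<in>S. Q i j) = 0)"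

definition irreducible_rate_matrix :: "nat set \<Rightarrow> (nat \<Rightarrow> nat \<Rightarrow> real) \<Rightarrow> bool" where
  "irreducible_rate_matrix S Q \<longleftrightarrow>
     (\<forall>i\<in>S. \<forall>j\<in>S. (i, j) \<in> {(k, l). k \<in> S \<and> l \<in> S \<and> k \<noteq> l \<and> Q k l > 0}\<^sup>*)"

definition rate_generator :: "nat set \<Rightarrow> (nat \<Rightarrow> nat \<Rightarrow> real) \<Rightarrow> (nat \<Rightarrow> real) \<Rightarrow> nat \<Rightarrow> real" where
  "rate_generator S Q h z = (\<Sum>j\<in>S. Q z j * (h j - h z))"

text \<open>Probability measures on \<open>S\<close> are probability mass functions supported in \<open>S\<close>.\<close>

definition prob_on :: "nat set \<Rightarrow> nat pmf set" where
  "prob_on S = {\<pi>. set_pmf \<pi> \<subseteq> S}"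

definition donsker_varadhan :: "nat set \<Rightarrow> (nat \<Rightarrow> nat \<Rightarrow> real) \<Rightarrow> nat pmf \<Rightarrow> ereal" where
  "donsker_varadhan S Q \<pi> =
     - (INF h\<in>{h. \<forall>i\<in>S. h i > 0}.
          ereal (measure_pmf.expectation \<pi> (\<lambda>z. rate_generator S Q h z / h z)))"

definition internal_hamiltonian ::
  "('m, 'e::euclidean_space) chart set \<Rightarrow> ('m, 'e) metric \<Rightarrow> ('m \<Rightarrow> nat \<Rightarrow> ('m, 'e) tangent) \<Rightarrow>
   'm \<Rightarrow> (('m, 'e) tangent \<Rightarrow> real) \<Rightarrow> nat \<Rightarrow> real" where
  "internal_hamiltonian A g b x p z = p (b x z) + 1/2 * (cotangent_norm A g x p)\<^sup>2"

definition hamiltonian ::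
  "('m, 'e::euclidean_space) chart set \<Rightarrow> ('m, 'e) metric \<Rightarrow> nat \<Rightarrow>
   ('m \<Rightarrow> nat \<Rightarrow> ('m, 'e) tangent) \<Rightarrow> ('m \<Rightarrow> nat \<Rightarrow> nat \<Rightarrow> real) \<Rightarrow>
   'm \<Rightarrow> (('m, 'e) tangent \<Rightarrow> real) \<Rightarrow> ereal" where
  "hamiltonian A g N b q x p =
     (SUP \<pi>\<in>prob_on {1..N}.
        ereal (measure_pmf.expectation \<pi> (internal_hamiltonian A g b x p))
          - donsker_varadhan {1..N} (q x) \<pi>)"

definition good_containment_function ::
  "('m::topological_space, 'e::euclidean_space) chart set \<Rightarrow>
   ('m \<Rightarrow> (('m, 'e) tangent \<Rightarrow> real) \<Rightarrow> ereal) \<Rightarrow> ('m \<Rightarrow> real) \<Rightarrow> bool" where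
  "good_containment_function A H \<Upsilon> \<longleftrightarrow>
     (\<forall>x. \<Upsilon> x \<ge> 0) \<and> (\<exists>x. \<Upsilon> x = 0) \<and>
     Ck_fun A 2 \<Upsilon> \<and>
     (\<forall>c\<ge>0. compact {x. \<Upsilon> x \<le> c}) \<and>
     (SUP x. H x (differential A \<Upsilon> x)) < \<infinity>"

end

theory Submission
  imports Defs
begin

text \<open>Let \<open>r\<close> be the distance to \<open>x0\<close>. By Hopf-Rinow the balls of \<open>r\<close> are compact. In a small chart ball the
  metric is almost constant, so that \<open>r\<close> is Lipschitz there for a multiple, close to one, of a fixed
  inner product norm; it has smooth approximations with the same Lipschitz constant. Glueing
  them by a locally finite partition of unity \<open>\<psi> i\<close>, with errors small compared to the sizes of the
  differentials of the \<open>\<psi> i\<close>, gives a smooth \<open>f\<close> close to \<open>r\<close> whose differential is at most \<open>2\<close>; subtracting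
  the minimum makes it nonnegative with a zero. Since the Donsker-Varadhan functional is nonnegative,
  the Hamiltonian at a covector \<open>p\<close> is at most \<open>\<bar>p\<bar> \<bar>b\<bar> + \<bar>p\<bar>\<^sup>2 / 2\<close>, and for \<open>\<Upsilon> = ln (1 + f\<^sup>2) / 2\<close> the factor
  \<open>f / (1 + f\<^sup>2)\<close> in the differential compensates the linear growth of \<open>b\<close>.\<close>


section \<open>Calculus of \<open>C\<^sup>k\<close> maps\<close>

text \<open>The obstacle in the glueing is the product rule: the differential of
  \<open>\<psi> i * F i\<close> contains the differential of \<open>\<psi> i\<close> times
  \<open>F i\<close>, and \<open>F i\<close> is as large as \<open>r\<close>. As the
  \<open>\<psi> i\<close> add up to 1, their differentials add up to 0. At a fixed point the number
  \<open>r x\<close> can therefore be subtracted from every \<open>F i\<close>, so only the errors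
  \<open>F i - r\<close> meet the differentials of the \<open>\<psi> i\<close>; \<open>r\<close>
  itself is never differentiated. The errors must be chosen after the \<open>\<psi> i\<close>, hence
  local approximability is stated for one fixed compact set and all errors at once. Compactness of
  balls enters three times: in the locally finite family of bumps, in the existence of the minimum,
  and in the sublevel sets of \<Upsilon>. It is obtained by enlarging totally bounded balls along
  nearly shortest curves. The bound 1 on \<open>f - r\<close> is split into 1/2 for the
  approximation and 1/2 for the subtracted minimum; the bound 2 on the differential into 3/2 from
  the local pieces and 1/2 from the partition functions.\<close>

lemma Ck_on_cong_imp:
  assumes "open S" "\<And>x. x \<in> S \<Longrightarrow> f x = g x" "Ck_on k S f"
  shows "Ck_on k S g"
  using assms(2,3)
proof (induction k arbitrary: f g)
  case 0
  then show ?case by (simp cong: continuous_on_cong)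
next
  case (Suc k)
  have d: "f differentiable (at x)" if "x \<in> S" for x using Suc.prems(2) that by simp
  have fr: "frechet_derivative f (at x) = frechet_derivative g (at x)" if "x \<in> S" for x
    by (rule frechet_derivative_transform_within_open[OF d \<open>open S\<close>]) (use that Suc.prems in auto)
  have "g differentiable (at x)" if "x \<in> S" for x
    using d[OF that] Suc.prems(1) assms(1) that
    by (meson differentiable_def has_derivative_transform_within_open)
  moreover have "Ck_on k S (\<lambda>x. frechet_derivative g (at x) v)" for v
    by (rule Suc.IH[of "\<lambda>x. frechet_derivative f (at x) v"]) (use fr Suc.prems in auto)
  ultimately show ?case by simp
qed

lemma Ck_on_cong:
  assumes "open S" "\<And>x. x \<in> S \<Longrightarrow> f x = g x"
  shows "Ck_on k S f \<longleftrightarrow> Ck_on k S g"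
  using Ck_on_cong_imp[OF assms(1), of f g] Ck_on_cong_imp[OF assms(1), of g f] assms(2) by auto

lemma Ck_on_subset:
  assumes "Ck_on k T f" "S \<subseteq> T"
  shows "Ck_on k S f"
  using assms(1)
proof (induction k arbitrary: f)
  case 0
  then show ?case using assms(2) continuous_on_subset by auto
qed (use assms(2) in auto)

lemma Ck_on_local:
  assumes "\<And>x. x \<in> S \<Longrightarrow> \<exists>T. open T \<and> x \<in> T \<and> Ck_on k T f"
  shows "Ck_on k S f"
  using assms
proof (induction k arbitrary: f)
  case 0
  have "isCont f x" if "x \<in> S" for x
    using 0[OF that] continuous_on_eq_continuous_at by auto
  then show ?case by (simp add: continuous_at_imp_continuous_on)
next
  case (Suc k)
  have "f differentiable (at x)" if "x \<in> S" for x
    using Suc.prems[OF that] by auto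
  moreover have "Ck_on k S (\<lambda>x. frechet_derivative f (at x) v)" for v
  proof (rule Suc.IH)
    fix x assume "x \<in> S"
    then obtain T where "open T" "x \<in> T" "Ck_on (Suc k) T f" using Suc.prems by blast
    then show "\<exists>T. open T \<and> x \<in> T \<and> Ck_on k T (\<lambda>x. frechet_derivative f (at x) v)" by auto
  qed
  ultimately show ?case by simp
qed

lemma Ck_on_SucD: "Ck_on (Suc k) S f \<Longrightarrow> Ck_on k S f"
proof (induction k arbitrary: f)
  case 0
  then show ?case
    by (auto intro!: continuous_at_imp_continuous_on differentiable_imp_continuous_within)
qed simp

text \<open>\<open>Ck_on\<close> refers to \<open>frechet_derivative\<close>, which is a choice; on
  an open set any explicit formula for the derivative may take its place. The closure properties
  below are inductions through this rule.\<close>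

lemma Ck_on_SucI:
  assumes "open S"
    and "\<And>x. x \<in> S \<Longrightarrow> (f has_derivative f' x) (at x)"
    and "\<And>v. Ck_on k S (\<lambda>x. f' x v)"
  shows "Ck_on (Suc k) S f"
proof -
  have "frechet_derivative f (at x) = f' x" if "x \<in> S" for x
    using frechet_derivative_at[OF assms(2)[OF that]] by simp
  then have "Ck_on k S (\<lambda>x. frechet_derivative f (at x) v)" for v
    using Ck_on_cong[OF assms(1), of "\<lambda>x. frechet_derivative f (at x) v" "\<lambda>x. f' x v"] assms(3)
    by auto
  with assms(2) show ?thesis by (auto simp: differentiable_def)
qed

lemma Ck_on_derivD:
  assumes "Ck_on (Suc k) S f" "x \<in> S"
  shows "(f has_derivative frechet_derivative f (at x)) (at x)"
  using assms frechet_derivative_works by auto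

lemma Ck_on_const: "Ck_on k S (\<lambda>x. a)"
proof (induction k arbitrary: a)
  case (Suc k)
  have "frechet_derivative (\<lambda>x::'a. a) (at x) = (\<lambda>_. 0)" for x
    using frechet_derivative_at[OF has_derivative_const[of a "at x"]] by simp
  with Suc show ?case by simp
qed simp

lemma Ck_on_linear_comp:
  assumes "open S" "bounded_linear L" "Ck_on k S f"
  shows "Ck_on k S (\<lambda>x. L (f x))"
  using assms(3)
proof (induction k arbitrary: f)
  case 0
  then show ?case using assms(2) by (simp add: bounded_linear.continuous_on)
next
  case (Suc k)
  show ?case
  proof (rule Ck_on_SucI[OF assms(1)])
    show "((\<lambda>x. L (f x)) has_derivative (\<lambda>v. L (frechet_derivative f (at x) v))) (at x)" if "x \<in> S" for x
      by (rule bounded_linear.has_derivative[OF assms(2) Ck_on_derivD[OF Suc.prems that]])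
  qed (use Suc in simp)
qed

lemma Ck_on_linear:
  assumes "open S" "bounded_linear L"
  shows "Ck_on k S L"
proof (cases k)
  case 0
  then show ?thesis using assms(2) by (simp add: linear_continuous_on)
next
  case (Suc j)
  show ?thesis unfolding Suc
    by (rule Ck_on_SucI[OF assms(1), where f' = "\<lambda>x. L"])
      (use assms(2) in \<open>auto intro: bounded_linear_imp_has_derivative Ck_on_const\<close>)
qed

lemma Ck_on_add:
  assumes "open S" "Ck_on k S f" "Ck_on k S g"
  shows "Ck_on k S (\<lambda>x. f x + g x)"
  using assms(2,3)
proof (induction k arbitrary: f g)
  case 0
  then show ?case by (simp add: continuous_on_add)
next
  case (Suc k)
  show ?case
  proof (rule Ck_on_SucI[OF assms(1) has_derivative_add])
    fix x assume x: "x \<in> S"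
    show "(f has_derivative frechet_derivative f (at x)) (at x)"
      "(g has_derivative frechet_derivative g (at x)) (at x)"
      by (rule Ck_on_derivD[OF Suc.prems(1) x], rule Ck_on_derivD[OF Suc.prems(2) x])
  qed (use Suc in simp)
qed

lemma Ck_on_sum:
  assumes "open S" "\<And>i. i \<in> I \<Longrightarrow> Ck_on k S (f i)"
  shows "Ck_on k S (\<lambda>x. \<Sum>i\<in>I. f i x)"
  using assms(2)
  by (induction I rule: infinite_finite_induct) (auto intro: Ck_on_const Ck_on_add[OF assms(1)])

lemma Ck_on_scaleR:
  assumes "open S" "Ck_on k S f" "Ck_on k S g"
  shows "Ck_on k S (\<lambda>x. f x *\<^sub>R g x)"
  using assms(2,3)
proof (induction k arbitrary: f g)
  case 0
  then show ?case by (simp add: continuous_on_scaleR)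
next
  case (Suc k)
  show ?case
  proof (rule Ck_on_SucI[OF assms(1) has_derivative_scaleR])
    show "Ck_on k S (\<lambda>x. f x *\<^sub>R frechet_derivative g (at x) v
        + frechet_derivative f (at x) v *\<^sub>R g x)" for v
    proof (rule Ck_on_add[OF assms(1)])
      show "Ck_on k S (\<lambda>x. f x *\<^sub>R frechet_derivative g (at x) v)"
        by (rule Suc.IH) (use Suc.prems in \<open>simp_all add: Ck_on_SucD del: Ck_on.simps(2), simp\<close>)
      show "Ck_on k S (\<lambda>x. frechet_derivative f (at x) v *\<^sub>R g x)"
        by (rule Suc.IH) (use Suc.prems in \<open>simp_all add: Ck_on_SucD del: Ck_on.simps(2), simp\<close>)
    qed
    fix x assume x: "x \<in> S"
    show "(f has_derivative frechet_derivative f (at x)) (at x)"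
      "(g has_derivative frechet_derivative g (at x)) (at x)"
      by (rule Ck_on_derivD[OF Suc.prems(1) x], rule Ck_on_derivD[OF Suc.prems(2) x])
  qed
qed

lemma Ck_on_mult:
  fixes f g :: "_ \<Rightarrow> real"
  assumes "open S" "Ck_on k S f" "Ck_on k S g"
  shows "Ck_on k S (\<lambda>x. f x * g x)"
  using Ck_on_scaleR[OF assms] by simp

text \<open>The chain rule applies the differential of \<open>f\<close> to the moving vector
  \<open>frechet_derivative h (at x) v\<close>, whereas \<open>Ck_on\<close> controls differentials
  only along fixed vectors. Expanding the moving vector in the basis leaves products of scalar
  functions, and the induction hypothesis applies to each partial derivative of
  \<open>f\<close>.\<close>

lemma Ck_on_compose:
  fixes f :: "'b::euclidean_space \<Rightarrow> real" and h :: "'a::euclidean_space \<Rightarrow> 'b"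
  assumes "open S" "h ` S \<subseteq> T" "Ck_on k T f" "Ck_on k S h"
  shows "Ck_on k S (\<lambda>x. f (h x))"
  using assms(3,4)
proof (induction k arbitrary: f)
  case 0
  then show ?case using assms(2) continuous_on_compose2 by auto
next
  case (Suc k)
  let ?d = "\<lambda>x v. \<Sum>b\<in>Basis. (frechet_derivative h (at x) v \<bullet> b) * frechet_derivative f (at (h x)) b"
  show ?case
  proof (rule Ck_on_SucI[OF assms(1), where f' = ?d])
    fix x assume x: "x \<in> S"
    then have fd: "(f has_derivative frechet_derivative f (at (h x))) (at (h x))"
      using assms(2) Suc.prems(1) by (intro Ck_on_derivD) auto
    have hd: "(h has_derivative frechet_derivative h (at x)) (at x)"
      using Suc.prems(2) x by (rule Ck_on_derivD)
    have "frechet_derivative f (at (h x)) (frechet_derivative h (at x) v) = ?d x v" for v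
    proof -
      have l: "linear (frechet_derivative f (at (h x)))"
        using fd has_derivative_linear by blast
      have "frechet_derivative f (at (h x)) (frechet_derivative h (at x) v)
        = frechet_derivative f (at (h x)) (\<Sum>b\<in>Basis. (frechet_derivative h (at x) v \<bullet> b) *\<^sub>R b)"
        by (simp add: euclidean_representation)
      then show ?thesis by (simp add: linear_sum[OF l] linear_cmul[OF l])
    qed
    then show "((\<lambda>x. f (h x)) has_derivative ?d x) (at x)"
      using has_derivative_compose[OF hd fd] by (simp add: o_def)
  next
    fix v
    show "Ck_on k S (\<lambda>x. ?d x v)"
    proof (intro Ck_on_sum[OF assms(1)] Ck_on_mult[OF assms(1)])
      show "Ck_on k S (\<lambda>x. frechet_derivative h (at x) v \<bullet> b)" for b
        by (rule Ck_on_linear_comp[OF assms(1) bounded_linear_inner_left]) (use Suc.prems(2) in simp)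
      show "Ck_on k S (\<lambda>x. frechet_derivative f (at (h x)) b)" for b
        by (rule Suc.IH[OF _ Ck_on_SucD[OF Suc.prems(2)]]) (use Suc.prems(1) in simp)
    qed
  qed
qed

lemma smooth_on_cong:
  "open S \<Longrightarrow> (\<And>x. x \<in> S \<Longrightarrow> f x = g x) \<Longrightarrow> smooth_on S f \<longleftrightarrow> smooth_on S g"
  by (simp add: smooth_on_def cong: Ck_on_cong)

lemma smooth_on_subset: "smooth_on T f \<Longrightarrow> S \<subseteq> T \<Longrightarrow> smooth_on S f"
  by (auto simp: smooth_on_def intro: Ck_on_subset)

lemma smooth_on_local:
  assumes "\<And>x. x \<in> S \<Longrightarrow> \<exists>T. open T \<and> x \<in> T \<and> smooth_on T f"
  shows "smooth_on S f"
  unfolding smooth_on_def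
proof
  fix k show "Ck_on k S f"
    by (rule Ck_on_local) (use assms in \<open>auto simp: smooth_on_def\<close>)
qed

lemma smooth_on_const: "smooth_on S (\<lambda>x. a)"
  by (simp add: smooth_on_def Ck_on_const)

lemma smooth_on_linear: "open S \<Longrightarrow> bounded_linear L \<Longrightarrow> smooth_on S L"
  by (simp add: smooth_on_def Ck_on_linear)

lemma smooth_on_add:
  "open S \<Longrightarrow> smooth_on S f \<Longrightarrow> smooth_on S g \<Longrightarrow> smooth_on S (\<lambda>x. f x + g x)"
  by (simp add: smooth_on_def Ck_on_add)

lemma smooth_on_sum:
  "open S \<Longrightarrow> (\<And>i. i \<in> I \<Longrightarrow> smooth_on S (f i)) \<Longrightarrow> smooth_on S (\<lambda>x. \<Sum>i\<in>I. f i x)"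
  by (simp add: smooth_on_def Ck_on_sum)

lemma smooth_on_mult:
  fixes f g :: "_ \<Rightarrow> real"
  shows "open S \<Longrightarrow> smooth_on S f \<Longrightarrow> smooth_on S g \<Longrightarrow> smooth_on S (\<lambda>x. f x * g x)"
  by (simp add: smooth_on_def Ck_on_mult)

lemma smooth_on_compose:
  fixes f :: "'b::euclidean_space \<Rightarrow> real" and h :: "'a::euclidean_space \<Rightarrow> 'b"
  assumes "open S" "h ` S \<subseteq> T" "smooth_on T f" "smooth_on S h"
  shows "smooth_on S (\<lambda>x. f (h x))"
  unfolding smooth_on_def
proof
  fix k show "Ck_on k S (\<lambda>x. f (h x))"
    by (rule Ck_on_compose[OF assms(1,2)]) (use assms(3,4) in \<open>auto simp: smooth_on_def\<close>)
qed

lemma smooth_on_has_derivative: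
  "smooth_on S f \<Longrightarrow> x \<in> S \<Longrightarrow> (f has_derivative frechet_derivative f (at x)) (at x)"
  unfolding smooth_on_def by (rule Ck_on_derivD[of 0]) blast+

lemma smooth_on_imp_continuous_on: "smooth_on S f \<Longrightarrow> continuous_on S f"
  unfolding smooth_on_def by (metis Ck_on.simps(1))

lemma smooth_on_continuous_deriv:
  "smooth_on S f \<Longrightarrow> continuous_on S (\<lambda>x. frechet_derivative f (at x) v)"
  unfolding smooth_on_def by (metis Ck_on.simps)

section \<open>Smooth functions of one real variable\<close>

lemma Ck_on_Suc_real:
  fixes f :: "real \<Rightarrow> real"
  assumes "open S" "\<And>x. x \<in> S \<Longrightarrow> (f has_real_derivative f' x) (at x)" "Ck_on k S f'"
  shows "Ck_on (Suc k) S f"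
  using assms(1)
proof (rule Ck_on_SucI)
  show "(f has_derivative (\<lambda>v. f' x * v)) (at x)" if "x \<in> S" for x
    using assms(2)[OF that] by (simp add: has_field_derivative_def)
  show "Ck_on k S (\<lambda>x. f' x * v)" for v
    by (intro Ck_on_mult assms Ck_on_const)
qed

text \<open>The derivative is a polynomial in \<open>inverse\<close> itself, so each order of
  differentiability yields the next.\<close>

lemma smooth_on_inverse: "smooth_on (- {0}) (inverse :: real \<Rightarrow> real)"
proof -
  have "Ck_on k (- {0}) (inverse :: real \<Rightarrow> real)" for k
  proof (induction k)
    case 0
    then show ?case by (auto intro!: continuous_intros)
  next
    case (Suc k)
    show ?case
    proof (rule Ck_on_Suc_real)
      show "(inverse has_real_derivative (-1) * (inverse x * inverse x)) (at x)" if "x \<in> - {0}" for x :: real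
        using DERIV_inverse[of x UNIV] that by (simp add: power2_eq_square)
      show "Ck_on k (- {0::real}) (\<lambda>x. (-1) * (inverse x * inverse x))"
        by (intro Ck_on_mult Suc Ck_on_const) auto
    qed auto
  qed
  then show ?thesis by (simp add: smooth_on_def)
qed

lemma smooth_on_exp: "smooth_on UNIV (exp :: real \<Rightarrow> real)"
proof -
  have "Ck_on k UNIV (exp :: real \<Rightarrow> real)" for k
  proof (induction k)
    case (Suc k)
    show ?case by (rule Ck_on_Suc_real[OF _ _ Suc]) (auto intro: DERIV_exp)
  qed (auto intro!: continuous_intros)
  then show ?thesis by (simp add: smooth_on_def)
qed

lemma smooth_on_ln: "smooth_on {0<..} (ln :: real \<Rightarrow> real)"
proof -
  have "Ck_on k {0<..} (ln :: real \<Rightarrow> real)" for k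
  proof (cases k)
    case (Suc j)
    have "Ck_on j {0<..} (inverse :: real \<Rightarrow> real)"
      using smooth_on_subset[OF smooth_on_inverse, of "{0<..}"] by (auto simp: smooth_on_def)
    then show ?thesis unfolding Suc
      by (intro Ck_on_Suc_real) (auto intro!: derivative_eq_intros simp: field_simps)
  qed (auto intro!: continuous_intros)
  then show ?thesis by (simp add: smooth_on_def)
qed

lemma smooth_on_sqrt: "smooth_on {0<..} (sqrt :: real \<Rightarrow> real)"
proof -
  have "smooth_on {0<..} (\<lambda>x::real. 1/2 * ln x)"
    by (rule smooth_on_mult[OF _ smooth_on_const smooth_on_ln]) auto
  then have "smooth_on {0<..} (\<lambda>x::real. exp (1/2 * ln x))"
    by (rule smooth_on_compose[OF _ _ smooth_on_exp, rotated -1]) auto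
  moreover have "exp (1/2 * ln x) = sqrt x" if "x \<in> {0<..}" for x :: real
    using that by (simp add: powr_def powr_half_sqrt[symmetric])
  ultimately show ?thesis using smooth_on_cong[of "{0<..}"] by (metis open_greaterThan)
qed

text \<open>The standard function that is flat to infinite order at 0. Composed with
  \<open>s\<^sup>2\<close> minus a squared distance it gives a bump supported in a closed
  ball.\<close>

definition flat_exp :: "real \<Rightarrow> real" where
  "flat_exp t = (if t > 0 then exp (- inverse t) else 0)"

lemma smooth_on_flat_exp: "smooth_on UNIV flat_exp"
proof -
  \<comment> \<open>The derivatives of the \<open>e n\<close> are linear combinations of the \<open>e n\<close>, so one induction treats them all.\<close>
  define e where "e n t = (if t > 0 then inverse t ^ n * exp (- inverse t) else 0)" for n and t :: real
  \<comment> \<open>The substitution of \<open>inverse t\<close> turns the limit at 0 from the right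
    into that of \<open>t ^ n / exp t\<close> at infinity; from the left the function
    vanishes.\<close>
  have lim: "(e n \<longlongrightarrow> 0) (at 0)" for n
  proof -
    have "((\<lambda>t. t ^ n / exp t) \<longlongrightarrow> 0) (at_top :: real filter)"
      by (rule tendsto_power_div_exp_0)
    then have "((\<lambda>t. inverse t ^ n / exp (inverse t)) \<longlongrightarrow> (0::real)) (at_right 0)"
      by (rule filterlim_compose) (rule filterlim_inverse_at_top_right)
    then have "(e n \<longlongrightarrow> 0) (at_right 0)"
      by (rule Lim_transform_eventually)
        (auto simp: e_def exp_minus divide_inverse eventually_at_filter)
    moreover have "(e n \<longlongrightarrow> 0) (at_left 0)"
      by (rule tendsto_eventually) (auto simp: e_def eventually_at_filter)
    ultimately show ?thesis by (simp add: filterlim_split_at)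
  qed
  have deriv: "(e n has_real_derivative (- real n) * e (Suc n) t + e (Suc (Suc n)) t) (at t)" for n t
  proof (cases t "0::real" rule: linorder_cases)
    case less
    have "((\<lambda>t. 0) has_real_derivative 0) (at t)" by simp
    then have "(e n has_real_derivative 0) (at t)"
      by (rule has_field_derivative_transform_within_open[where S = "{..<0}"]) (use less in \<open>auto simp: e_def\<close>)
    then show ?thesis using less by (simp add: e_def)
  next
    case greater
    have i: "(inverse has_real_derivative - (inverse t * inverse t)) (at t)"
      using DERIV_inverse[of t UNIV] greater by (simp add: power2_eq_square)
    have "((\<lambda>t. inverse t ^ n) has_real_derivative (- real n) * inverse t ^ Suc n) (at t)"
      using DERIV_power[OF i, of n] by (cases n) (simp_all add: algebra_simps)
    moreover have "((\<lambda>t. exp (- inverse t)) has_real_derivative exp (- inverse t) * (inverse t * inverse t)) (at t)"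
      using DERIV_fun_exp[OF DERIV_minus[OF i]] by simp
    ultimately have "((\<lambda>t. inverse t ^ n * exp (- inverse t)) has_real_derivative
        (- real n) * (inverse t ^ Suc n * exp (- inverse t)) + inverse t ^ Suc (Suc n) * exp (- inverse t)) (at t)"
      by (rule DERIV_cong[OF DERIV_mult]) (simp add: algebra_simps)
    then have "(e n has_real_derivative
        (- real n) * (inverse t ^ Suc n * exp (- inverse t)) + inverse t ^ Suc (Suc n) * exp (- inverse t)) (at t)"
      by (rule has_field_derivative_transform_within_open[where S = "{0<..}"]) (use greater in \<open>auto simp: e_def\<close>)
    then show ?thesis using greater by (simp add: e_def)
  next
    case equal
    \<comment> \<open>At 0 the difference quotient of \<open>e n\<close> is
      \<open>e (Suc n)\<close>, which tends to 0 by \<open>lim\<close>.\<close>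
    have "((\<lambda>y. e n y / y) \<longlongrightarrow> 0) (at 0)"
      by (rule Lim_transform_eventually[OF lim[of "Suc n"]])
        (auto simp: e_def eventually_at_filter divide_inverse)
    then have "(e n has_real_derivative 0) (at 0)"
      by (simp add: has_field_derivative_iff e_def)
    then show ?thesis using equal by (simp add: e_def)
  qed
  have "Ck_on k UNIV (e n)" for k n
  proof (induction k arbitrary: n)
    case 0
    then show ?case using deriv by (auto intro!: DERIV_continuous_on)
  next
    case (Suc k)
    show ?case
      by (rule Ck_on_Suc_real[OF open_UNIV deriv])
        (intro Ck_on_add[OF open_UNIV] Ck_on_mult[OF open_UNIV] Suc Ck_on_const)
  qed
  moreover have "e 0 = flat_exp" by (auto simp: e_def flat_exp_def)
  ultimately show ?thesis by (metis smooth_on_def)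
qed

lemma flat_exp_pos: "flat_exp t > 0 \<longleftrightarrow> t > 0"
  by (simp add: flat_exp_def)

lemma flat_exp_nonneg: "flat_exp t \<ge> 0"
  by (simp add: flat_exp_def)


section \<open>Charts, tangent vectors and smooth functions\<close>

locale riem_mfd =
  fixes A :: "('m::{t2_space,second_countable_topology}, 'e::euclidean_space) chart set"
    and g :: "('m, 'e) metric"
  assumes rm: "riemannian_manifold A g"
begin

lemma atlas: "smooth_atlas A"
  using rm by (simp add: riemannian_manifold_def)

lemma metric: "riemannian_metric A g"
  using rm by (simp add: riemannian_manifold_def)

lemma chart_homeo:
  "c \<in> A \<Longrightarrow> homeomorphism (chart_dom c) (chart_im c) (chart_map c) (chart_inv c)"
  using atlas by (simp add: smooth_atlas_def)

lemma open_dom: "c \<in> A \<Longrightarrow> open (chart_dom c)"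
  using atlas by (simp add: smooth_atlas_def)

lemma open_im: "c \<in> A \<Longrightarrow> open (chart_im c)"
  using atlas by (simp add: smooth_atlas_def)

lemma inv_map: "c \<in> A \<Longrightarrow> x \<in> chart_dom c \<Longrightarrow> chart_inv c (chart_map c x) = x"
  using chart_homeo homeomorphism_apply1 by blast

lemma map_inv: "c \<in> A \<Longrightarrow> y \<in> chart_im c \<Longrightarrow> chart_map c (chart_inv c y) = y"
  using chart_homeo homeomorphism_apply2 by blast

lemma inv_in_dom: "c \<in> A \<Longrightarrow> y \<in> chart_im c \<Longrightarrow> chart_inv c y \<in> chart_dom c"
  using chart_homeo homeomorphism_image2 by blast

lemma map_in_im: "x \<in> chart_dom c \<Longrightarrow> chart_map c x \<in> chart_im c"
  by (simp add: chart_im_def)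

lemma cont_map: "c \<in> A \<Longrightarrow> continuous_on (chart_dom c) (chart_map c)"
  using chart_homeo homeomorphism_cont1 by blast

lemma cont_inv: "c \<in> A \<Longrightarrow> continuous_on (chart_im c) (chart_inv c)"
  using chart_homeo homeomorphism_cont2 by blast

lemma ex_chart: obtains c where "c \<in> A" "x \<in> chart_dom c"
proof -
  have "x \<in> (\<Union>c\<in>A. chart_dom c)" using atlas by (simp add: smooth_atlas_def)
  then show ?thesis using that by blast
qed

lemma map_image_eq:
  "c \<in> A \<Longrightarrow> chart_map c ` (U \<inter> chart_dom c) = chart_im c \<inter> chart_inv c -` U"
  by (force simp: map_inv inv_in_dom inv_map map_in_im image_iff)

lemma inv_image_eq:
  "c \<in> A \<Longrightarrow> chart_inv c ` (V \<inter> chart_im c) = chart_dom c \<inter> chart_map c -` V"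
  by (force simp: map_inv inv_in_dom inv_map map_in_im image_iff)

lemma open_map_image: "c \<in> A \<Longrightarrow> open U \<Longrightarrow> open (chart_map c ` (U \<inter> chart_dom c))"
  by (simp add: map_image_eq continuous_open_preimage cont_inv open_im)

lemma open_inv_image: "c \<in> A \<Longrightarrow> open V \<Longrightarrow> open (chart_inv c ` (V \<inter> chart_im c))"
  by (simp add: inv_image_eq continuous_open_preimage cont_map open_dom)

section \<open>Transition maps and coordinates of tangent vectors\<close>

lemma trans_smooth:
  "c \<in> A \<Longrightarrow> c' \<in> A \<Longrightarrow>
    smooth_on (chart_map c ` (chart_dom c' \<inter> chart_dom c)) (chart_map c' \<circ> chart_inv c)"
  using atlas by (simp add: smooth_atlas_def Int_commute)

lemma trans_has_derivative:
  assumes "c \<in> A" "c' \<in> A" "x \<in> chart_dom c" "x \<in> chart_dom c'"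
  shows "((chart_map c' \<circ> chart_inv c) has_derivative transition_deriv c c' x) (at (chart_map c x))"
  unfolding transition_deriv_def
  by (rule smooth_on_has_derivative[OF trans_smooth]) (use assms in auto)

lemma trans_self:
  assumes "c \<in> A" "x \<in> chart_dom c"
  shows "transition_deriv c c x = (\<lambda>v. v)"
proof -
  have "((chart_map c \<circ> chart_inv c) has_derivative (\<lambda>v. v)) (at (chart_map c x))"
    by (rule has_derivative_transform_within_open[OF has_derivative_ident open_im[OF assms(1)]])
      (use assms map_in_im map_inv in auto)
  then show ?thesis
    using trans_has_derivative[OF assms(1,1,2,2)] has_derivative_unique by blast
qed

text \<open>Chain rule through the transition map; continuity of \<open>\<gamma>\<close> keeps
  nearby points inside the first chart. The set \<open>S\<close> and the parameter space are left
  general: intervals give one-sided derivatives of curves, and \<open>S = UNIV\<close> with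
  \<open>\<gamma> = chart_inv c\<close> gives the cocycle rule below.\<close>

lemma change_chart_within:
  assumes "c \<in> A" "c' \<in> A" "\<gamma> t \<in> chart_dom c" "\<gamma> t \<in> chart_dom c'"
    and "continuous (at t within S) \<gamma>" "t \<in> S"
    and "((chart_map c \<circ> \<gamma>) has_derivative D) (at t within S)"
  shows "((chart_map c' \<circ> \<gamma>) has_derivative (\<lambda>s. transition_deriv c c' (\<gamma> t) (D s))) (at t within S)"
proof -
  have d: "((chart_map c' \<circ> chart_inv c) \<circ> (chart_map c \<circ> \<gamma>) has_derivative
      transition_deriv c c' (\<gamma> t) \<circ> D) (at t within S)"
    by (rule diff_chain_within[OF assms(7) has_derivative_at_withinI])
      (use trans_has_derivative[OF assms(1-4)] in \<open>simp add: comp_def\<close>)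
  have "\<forall>\<^sub>F s in at t within S. \<gamma> s \<in> chart_dom c"
    using assms(5) open_dom[OF assms(1)] assms(3)
    by (simp add: continuous_within topological_tendstoD)
  then have ev: "\<forall>\<^sub>F s in at t within S. ((chart_map c' \<circ> chart_inv c) \<circ> (chart_map c \<circ> \<gamma>)) s = (chart_map c' \<circ> \<gamma>) s"
    by (rule eventually_mono) (simp add: inv_map[OF assms(1)])
  have "((chart_map c' \<circ> \<gamma>) has_derivative transition_deriv c c' (\<gamma> t) \<circ> D) (at t within S)"
    by (rule has_derivative_transform_eventually[OF d ev])
      (use assms(1,3,6) in \<open>auto simp: inv_map\<close>)
  then show ?thesis by (simp add: o_def)
qed

text \<open>Cocycle rule: \<open>chart_inv c\<close> is treated as a parametrised map into the
  manifold whose coordinate expression changes from \<open>c'\<close> to \<open>c''\<close>, and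
  derivatives at a point are unique.\<close>

lemma trans_comp:
  assumes "c \<in> A" "c' \<in> A" "c'' \<in> A" "x \<in> chart_dom c" "x \<in> chart_dom c'" "x \<in> chart_dom c''"
  shows "transition_deriv c' c'' x (transition_deriv c c' x e) = transition_deriv c c'' x e"
proof -
  have x: "chart_inv c (chart_map c x) = x" using assms by (simp add: inv_map)
  have "isCont (chart_inv c) (chart_map c x)"
    using cont_inv[OF assms(1)] map_in_im[OF assms(4)] by (simp add: continuous_on_eq_continuous_at open_im[OF assms(1)])
  then have "((chart_map c'' \<circ> chart_inv c) has_derivative
      (\<lambda>s. transition_deriv c' c'' x (transition_deriv c c' x s))) (at (chart_map c x))"
    using change_chart_within[OF assms(2,3), of "chart_inv c" "chart_map c x" UNIV] assms
      trans_has_derivative[of c c' x] x by simp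
  with trans_has_derivative[OF assms(1,3,4,6)] show ?thesis
    using has_derivative_unique by metis
qed

abbreviation toc :: "('m, 'e) chart \<Rightarrow> 'm \<Rightarrow> 'e \<Rightarrow> ('m, 'e) tangent" where
  "toc \<equiv> tangent_of_coord A"

lemma trans_linear:
  "c \<in> A \<Longrightarrow> c' \<in> A \<Longrightarrow> x \<in> chart_dom c \<Longrightarrow> x \<in> chart_dom c' \<Longrightarrow> linear (transition_deriv c c' x)"
  using trans_has_derivative has_derivative_linear by blast

lemma toc_tangent:
  assumes "c \<in> A" "x \<in> chart_dom c"
  shows "toc c x e \<in> tangent_space A x"
  using assms by (auto simp: tangent_space_def tangent_of_coord_def trans_comp)

lemma toc_self: "c \<in> A \<Longrightarrow> x \<in> chart_dom c \<Longrightarrow> toc c x e c = e"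
  by (simp add: tangent_of_coord_def trans_self)

lemma tangent_eq_toc:
  assumes "c \<in> A" "x \<in> chart_dom c" "v \<in> tangent_space A x"
  shows "v = toc c x (v c)"
proof
  fix c'
  have "v c' = transition_deriv c c' x (v c)" if "c' \<in> A" "x \<in> chart_dom c'"
    using assms that unfolding tangent_space_def by blast
  moreover have "v c' = 0" if "c' \<notin> A \<or> x \<notin> chart_dom c'"
    using assms(3) that unfolding tangent_space_def by blast
  ultimately show "v c' = toc c x (v c) c'" by (simp add: tangent_of_coord_def)
qed

lemma zero_tangent: "(\<lambda>c. 0) \<in> tangent_space A x"
  by (simp add: tangent_space_def linear_0[OF trans_linear])

lemma toc_add:
  assumes "c \<in> A" "x \<in> chart_dom c"
  shows "toc c x (u + v) = (\<lambda>c'. toc c x u c' + toc c x v c')"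
  by (rule ext) (simp add: tangent_of_coord_def linear_add[OF trans_linear] assms)

lemma toc_scaleR:
  assumes "c \<in> A" "x \<in> chart_dom c"
  shows "toc c x (a *\<^sub>R u) = (\<lambda>c'. a *\<^sub>R toc c x u c')"
  by (rule ext) (simp add: tangent_of_coord_def linear_cmul[OF trans_linear] assms)

section \<open>The metric in chart coordinates\<close>

definition coord_form :: "('m, 'e) chart \<Rightarrow> 'm \<Rightarrow> 'e \<Rightarrow> 'e \<Rightarrow> real" where
  "coord_form c x u v = g x (toc c x u) (toc c x v)"

definition coord_norm :: "('m, 'e) chart \<Rightarrow> 'm \<Rightarrow> 'e \<Rightarrow> real" where
  "coord_norm c x u = sqrt (coord_form c x u u)"

lemma tangent_norm_eq_coord_norm:
  "c \<in> A \<Longrightarrow> x \<in> chart_dom c \<Longrightarrow> v \<in> tangent_space A x \<Longrightarrow> tangent_norm g x v = coord_norm c x (v c)"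
  using tangent_eq_toc by (metis tangent_norm_def coord_norm_def coord_form_def)

context
  fixes c x
  assumes c: "c \<in> A" and x: "x \<in> chart_dom c"
begin

lemma coord_form_sym: "coord_form c x u v = coord_form c x v u"
  using metric toc_tangent[OF c x] by (simp add: riemannian_metric_def coord_form_def)

lemma coord_form_linear: "linear (\<lambda>u. coord_form c x u v)"
proof
  show "coord_form c x (u + w) v = coord_form c x u v + coord_form c x w v" for u w
    unfolding coord_form_def toc_add[OF c x]
    using metric toc_tangent[OF c x] by (simp add: riemannian_metric_def)
  show "coord_form c x (r *\<^sub>R u) v = r *\<^sub>R coord_form c x u v" for r u
    unfolding coord_form_def toc_scaleR[OF c x] real_scaleR_def
    using metric toc_tangent[OF c x] unfolding riemannian_metric_def by blast
qed

lemma coord_form_linear2: "linear (\<lambda>v. coord_form c x u v)"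
  using coord_form_linear[of u] coord_form_sym[of u] by simp

lemmas coord_form_simps =
  linear_add[OF coord_form_linear] linear_diff[OF coord_form_linear] linear_cmul[OF coord_form_linear] linear_0[OF coord_form_linear]
  linear_add[OF coord_form_linear2] linear_diff[OF coord_form_linear2] linear_cmul[OF coord_form_linear2] linear_0[OF coord_form_linear2]

lemma coord_form_pos: "u \<noteq> 0 \<Longrightarrow> coord_form c x u u > 0"
proof -
  assume "u \<noteq> 0"
  then have "toc c x u \<noteq> (\<lambda>c. 0)"
    using toc_self[OF c x, of u] by metis
  then show ?thesis
    using metric toc_tangent[OF c x] unfolding riemannian_metric_def coord_form_def by blast
qed

lemma coord_form_nonneg: "coord_form c x u u \<ge> 0"
  using coord_form_pos[of u] by (cases "u = 0") (auto simp: coord_form_simps)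

lemma coord_norm_nonneg: "coord_norm c x u \<ge> 0"
  by (simp add: coord_norm_def coord_form_nonneg)

lemma coord_norm_sq: "(coord_norm c x u)\<^sup>2 = coord_form c x u u"
  by (simp add: coord_norm_def coord_form_nonneg)

text \<open>Cauchy-Schwarz: the form is nonnegative at \<open>u\<close> minus its projection
  \<open>t *\<^sub>R v\<close> onto \<open>v\<close>.\<close>

lemma coord_form_le_coord_norm: "coord_form c x u v \<le> coord_norm c x u * coord_norm c x v"
proof (cases "v = 0")
  case False
  then have vp: "coord_form c x v v > 0" by (rule coord_form_pos)
  define t where "t = coord_form c x u v / coord_form c x v v"
  have "0 \<le> coord_form c x (u - t *\<^sub>R v) (u - t *\<^sub>R v)" by (rule coord_form_nonneg)
  also have "\<dots> = coord_form c x u u - (coord_form c x u v)\<^sup>2 / coord_form c x v v"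
    using vp coord_form_sym[of v u] by (simp add: coord_form_simps t_def field_simps power2_eq_square)
  finally have "(coord_form c x u v)\<^sup>2 \<le> coord_form c x u u * coord_form c x v v"
    using vp by (simp add: field_simps)
  then have "(coord_form c x u v)\<^sup>2 \<le> (coord_norm c x u * coord_norm c x v)\<^sup>2"
    by (simp add: power_mult_distrib coord_norm_sq)
  then show ?thesis
    by (rule power2_le_imp_le) (simp add: coord_norm_nonneg)
qed (simp add: coord_form_simps coord_norm_def)

lemma coord_norm_triangle: "coord_norm c x (u + v) \<le> coord_norm c x u + coord_norm c x v"
proof (rule power2_le_imp_le)
  have "(coord_norm c x (u + v))\<^sup>2 = coord_form c x u u + 2 * coord_form c x u v + coord_form c x v v"
    using coord_form_sym[of v u] by (simp add: coord_norm_sq coord_form_simps)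
  also have "\<dots> \<le> (coord_norm c x u + coord_norm c x v)\<^sup>2"
    using coord_form_le_coord_norm[of u v] by (simp add: power2_sum coord_norm_sq)
  finally show "(coord_norm c x (u + v))\<^sup>2 \<le> (coord_norm c x u + coord_norm c x v)\<^sup>2" .
qed (simp add: coord_norm_nonneg)

lemma coord_norm_scaleR: "coord_norm c x (a *\<^sub>R u) = \<bar>a\<bar> * coord_norm c x u"
proof -
  have "coord_form c x (a *\<^sub>R u) (a *\<^sub>R u) = a\<^sup>2 * coord_form c x u u" by (simp add: coord_form_simps power2_eq_square)
  then show ?thesis by (simp add: coord_norm_def real_sqrt_mult)
qed

lemma coord_norm_minus: "coord_norm c x (- u) = coord_norm c x u"
  using coord_norm_scaleR[of "-1" u] by simp

text \<open>Reduces the dependence on the vectors to the finitely many Gram entries at basis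
  vectors. These are continuous in the base point, and for a fixed point the squared norm becomes a
  polynomial, hence smooth.\<close>

lemma coord_form_expand: "coord_form c x u v = (\<Sum>b\<in>Basis. \<Sum>b'\<in>Basis. (u \<bullet> b) * (v \<bullet> b') * coord_form c x b b')"
proof -
  have l: "coord_form c x u w = (\<Sum>b\<in>Basis. (u \<bullet> b) * coord_form c x b w)" for u w
    using linear_sum[OF coord_form_linear, of "\<lambda>b. (u \<bullet> b) *\<^sub>R b" Basis w]
    by (simp add: euclidean_representation coord_form_simps)
  have "coord_form c x b v = (\<Sum>b'\<in>Basis. (v \<bullet> b') * coord_form c x b b')" for b
    using l[of v b] by (simp add: coord_form_sym[of _ b])
  then show ?thesis
    by (subst l) (simp add: sum_distrib_left mult.assoc)
qed

lemma continuous_on_coord_form_diag: "continuous_on S (\<lambda>u. coord_form c x u u)"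
  by (subst coord_form_expand) (intro continuous_intros)

text \<open>The quadratic form attains a positive minimum on the compact unit sphere; homogeneity
  carries the bound to all vectors.\<close>

lemma coord_norm_lower: obtains \<mu> where "\<mu> > 0" "\<And>u. \<mu> * norm u \<le> coord_norm c x u"
proof -
  have "\<exists>u\<in>sphere 0 1. \<forall>v\<in>sphere 0 1. coord_form c x u u \<le> coord_form c x v v"
    by (rule continuous_attains_inf) (auto intro: continuous_on_coord_form_diag)
  then obtain u where u: "norm u = 1" "\<And>v. norm v = 1 \<Longrightarrow> coord_form c x u u \<le> coord_form c x v v"
    by auto
  have up: "coord_norm c x u > 0" using u coord_form_pos[of u] by (fastforce simp: coord_norm_def)
  have "coord_norm c x u * norm v \<le> coord_norm c x v" for v
  proof (cases "v = 0")
    case False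
    have "coord_norm c x u \<le> coord_norm c x (v /\<^sub>R norm v)"
      using u(2)[of "v /\<^sub>R norm v"] False by (simp add: coord_norm_def)
    then show ?thesis using False by (simp add: coord_norm_scaleR field_simps)
  qed (simp add: coord_norm_nonneg)
  then show ?thesis using that up by blast
qed

lemma coord_norm_upper: obtains \<Lambda> where "\<Lambda> > 0" "\<And>u. coord_norm c x u \<le> \<Lambda> * norm u"
proof -
  have "\<exists>u\<in>sphere 0 1. \<forall>v\<in>sphere 0 1. coord_form c x v v \<le> coord_form c x u u"
    by (rule continuous_attains_sup) (auto intro: continuous_on_coord_form_diag)
  then obtain u where u: "norm u = 1" "\<And>v. norm v = 1 \<Longrightarrow> coord_form c x v v \<le> coord_form c x u u"
    by auto
  have up: "coord_norm c x u > 0" using u coord_form_pos[of u] by (fastforce simp: coord_norm_def)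
  have "coord_norm c x v \<le> coord_norm c x u * norm v" for v
  proof (cases "v = 0")
    case False
    have "coord_norm c x (v /\<^sub>R norm v) \<le> coord_norm c x u"
      using u(2)[of "v /\<^sub>R norm v"] False by (simp add: coord_norm_def)
    then show ?thesis using False by (simp add: coord_norm_scaleR field_simps)
  qed (simp add: coord_norm_def coord_form_simps)
  then show ?thesis using that up by blast
qed

end

lemma continuous_on_coord_form_inv:
  assumes "c \<in> A"
  shows "continuous_on (chart_im c) (\<lambda>y. coord_form c (chart_inv c y) u v)"
proof -
  have "smooth_on (chart_im c) (\<lambda>y. coord_form c (chart_inv c y) u v)"
    using metric assms by (simp add: riemannian_metric_def coord_form_def)
  then show ?thesis by (rule smooth_on_imp_continuous_on)
qed

lemma continuous_on_coord_form:
  assumes "c \<in> A"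
  shows "continuous_on (chart_dom c) (\<lambda>x. coord_form c x u v)"
proof -
  have "continuous_on (chart_dom c) (\<lambda>x. coord_form c (chart_inv c (chart_map c x)) u v)"
    by (rule continuous_on_compose2[OF continuous_on_coord_form_inv[OF assms] cont_map[OF assms]])
      (auto simp: map_in_im)
  then show ?thesis by (simp add: inv_map[OF assms] cong: continuous_on_cong)
qed

text \<open>Quantitative form of the metric being almost constant near \<open>x\<close>. The Gram
  entries move little, and since the form at \<open>x\<close> dominates a multiple of the squared
  Euclidean norm, a small absolute change is a small relative change, uniformly in the
  vector.\<close>

lemma coord_norm_local:
  assumes c: "c \<in> A" and x: "x \<in> chart_dom c" and \<kappa>: "\<kappa> > 1"
  obtains \<rho> where "\<rho> > 0" "ball (chart_map c x) \<rho> \<subseteq> chart_im c"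
    "\<And>y u. y \<in> ball (chart_map c x) \<rho> \<Longrightarrow> coord_norm c (chart_inv c y) u \<le> \<kappa> * coord_norm c x u"
    "\<And>y u. y \<in> ball (chart_map c x) \<rho> \<Longrightarrow> coord_norm c x u \<le> \<kappa> * coord_norm c (chart_inv c y) u"
proof -
  obtain \<mu> where \<mu>: "\<mu> > 0" "\<And>u. \<mu> * norm u \<le> coord_norm c x u"
    using coord_norm_lower[OF c x] by blast
  define D where "D y = (\<Sum>b\<in>Basis. \<Sum>b'\<in>Basis. \<bar>coord_form c (chart_inv c y) b b' - coord_form c x b b'\<bar>)" for y
  \<comment> \<open>With this \<eta> the lower factor \<open>1 - \<eta>\<close> equals
    \<open>1 / \<kappa>\<^sup>2\<close> exactly; the upper factor needs
    \<open>1 + \<eta> \<le> \<kappa>\<^sup>2\<close>, which is shown below from a square being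
    nonnegative.\<close>
  define \<eta> where "\<eta> = 1 - 1 / \<kappa>\<^sup>2"
  have k2: "\<kappa>\<^sup>2 > 1" using \<kappa> by (simp add: one_less_power)
  have \<eta>: "\<eta> > 0" unfolding \<eta>_def using k2 by (simp add: divide_less_eq_1)
  have im: "chart_map c x \<in> chart_im c" using x by (rule map_in_im)
  have "continuous_on (chart_im c) D"
    unfolding D_def by (intro continuous_intros continuous_on_coord_form_inv[OF c])
  then have "isCont D (chart_map c x)"
    using im by (simp add: continuous_on_eq_continuous_at open_im[OF c])
  then have "(D \<longlongrightarrow> D (chart_map c x)) (nhds (chart_map c x))"
    by (simp add: isCont_def tendsto_at_iff_tendsto_nhds)
  moreover have "D (chart_map c x) < \<eta> * \<mu>\<^sup>2" using \<eta> \<mu>(1) by (simp add: D_def inv_map[OF c x])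
  ultimately have "\<forall>\<^sub>F y in nhds (chart_map c x). D y < \<eta> * \<mu>\<^sup>2"
    by (rule order_tendstoD(2))
  moreover have "\<forall>\<^sub>F y in nhds (chart_map c x). y \<in> chart_im c"
    using im open_im[OF c] by (rule eventually_nhds_in_open[rotated])
  ultimately have "\<forall>\<^sub>F y in nhds (chart_map c x). D y < \<eta> * \<mu>\<^sup>2 \<and> y \<in> chart_im c"
    by (rule eventually_conj)
  then obtain \<rho> where \<rho>: "\<rho> > 0" "\<And>y. dist y (chart_map c x) < \<rho> \<Longrightarrow> D y < \<eta> * \<mu>\<^sup>2 \<and> y \<in> chart_im c"
    unfolding eventually_nhds_metric by blast
  have main: "\<bar>coord_form c (chart_inv c y) u u - coord_form c x u u\<bar> \<le> \<eta> * coord_form c x u u"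
    if "y \<in> ball (chart_map c x) \<rho>" for y u
  proof -
    have y: "D y < \<eta> * \<mu>\<^sup>2" "y \<in> chart_im c" using \<rho>(2)[of y] that by (auto simp: dist_commute)
    have bb: "\<bar>u \<bullet> b\<bar> * \<bar>u \<bullet> b'\<bar> \<le> (norm u)\<^sup>2" if "b \<in> Basis" "b' \<in> Basis" for b b'
      unfolding power2_eq_square by (intro mult_mono) (use that Basis_le_norm in auto)
    have "coord_form c (chart_inv c y) u u - coord_form c x u u
      = (\<Sum>b\<in>Basis. \<Sum>b'\<in>Basis. (u \<bullet> b) * (u \<bullet> b') * (coord_form c (chart_inv c y) b b' - coord_form c x b b'))"
      by (subst (1 2) coord_form_expand) (use c x y inv_in_dom in \<open>auto simp: algebra_simps sum_subtractf\<close>)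
    also have "\<bar>\<dots>\<bar> \<le> (\<Sum>b\<in>Basis. \<Sum>b'\<in>Basis. (norm u)\<^sup>2 * \<bar>coord_form c (chart_inv c y) b b' - coord_form c x b b'\<bar>)"
      by (intro order_trans[OF sum_abs] sum_mono) (auto simp: abs_mult intro!: mult_right_mono bb)
    also have "\<dots> = (norm u)\<^sup>2 * D y" by (simp add: D_def sum_distrib_left)
    also have "\<dots> \<le> (norm u)\<^sup>2 * (\<eta> * \<mu>\<^sup>2)" using y(1) by (intro mult_left_mono) auto
    also have "\<dots> = \<eta> * (\<mu> * norm u)\<^sup>2" by (simp add: power_mult_distrib)
    also have "\<dots> \<le> \<eta> * (coord_norm c x u)\<^sup>2"
      using \<mu> \<eta> by (intro mult_left_mono power_mono) auto
    finally show ?thesis by (simp add: coord_norm_sq[OF c x])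
  qed
  show ?thesis
  proof (rule that[OF \<rho>(1)])
    show "ball (chart_map c x) \<rho> \<subseteq> chart_im c" using \<rho>(2) by (auto simp: dist_commute)
  next
    fix y u assume y: "y \<in> ball (chart_map c x) \<rho>"
    have "1 + \<eta> \<le> \<kappa>\<^sup>2"
    proof -
      have *: "(t - 1)\<^sup>2 / t = t - (1 + (1 - 1 / t))" if "t > 0" for t :: real
        using that by (simp add: field_simps power2_eq_square)
      have "0 \<le> (\<kappa>\<^sup>2 - 1)\<^sup>2 / \<kappa>\<^sup>2" by simp
      also have "\<dots> = \<kappa>\<^sup>2 - (1 + \<eta>)" unfolding \<eta>_def using \<kappa> by (intro *) simp
      finally show ?thesis by simp
    qed
    then have "(1 + \<eta>) * coord_form c x u u \<le> \<kappa>\<^sup>2 * coord_form c x u u"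
      using coord_form_nonneg[OF c x] by (intro mult_right_mono) auto
    then have "coord_form c (chart_inv c y) u u \<le> \<kappa>\<^sup>2 * coord_form c x u u"
      using main[OF y, of u] by (simp add: algebra_simps)
    then have "sqrt (coord_form c (chart_inv c y) u u) \<le> sqrt (\<kappa>\<^sup>2 * coord_form c x u u)" by simp
    then show "coord_norm c (chart_inv c y) u \<le> \<kappa> * coord_norm c x u"
      using \<kappa> by (simp add: coord_norm_def real_sqrt_mult)
    have "coord_form c x u u * (1 - \<eta>) \<le> coord_form c (chart_inv c y) u u"
      using main[OF y, of u] by (simp add: algebra_simps)
    then have "coord_form c x u u \<le> \<kappa>\<^sup>2 * coord_form c (chart_inv c y) u u"
      using \<kappa> by (simp add: \<eta>_def pos_divide_le_eq mult.commute)
    then have "sqrt (coord_form c x u u) \<le> sqrt (\<kappa>\<^sup>2 * coord_form c (chart_inv c y) u u)" by simp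
    then show "coord_norm c x u \<le> \<kappa> * coord_norm c (chart_inv c y) u"
      using \<kappa> by (simp add: coord_norm_def real_sqrt_mult)
  qed
qed


section \<open>Smooth functions on open subsets and their differentials\<close>

definition smooth_fun_on :: "'m set \<Rightarrow> ('m \<Rightarrow> real) \<Rightarrow> bool" where
  "smooth_fun_on U f \<longleftrightarrow> (\<forall>c\<in>A. smooth_on (chart_map c ` (U \<inter> chart_dom c)) (f \<circ> chart_inv c))"

lemma smooth_fun_on_UNIV: "smooth_fun_on UNIV f \<longleftrightarrow> smooth_fun A f"
  by (simp add: smooth_fun_on_def smooth_fun_def chart_im_def)

lemma smooth_fun_on_subset: "smooth_fun_on U f \<Longrightarrow> V \<subseteq> U \<Longrightarrow> smooth_fun_on V f"
  unfolding smooth_fun_on_def by (meson smooth_on_subset image_mono Int_mono order_refl)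

text \<open>The glueing principle: a function with one formula inside a chart and another outside a
  compact set becomes smooth by checking each point separately.\<close>

lemma smooth_fun_on_local:
  assumes "\<And>x. x \<in> U \<Longrightarrow> \<exists>V. open V \<and> x \<in> V \<and> smooth_fun_on V f"
  shows "smooth_fun_on U f"
  unfolding smooth_fun_on_def
proof
  fix c assume c: "c \<in> A"
  show "smooth_on (chart_map c ` (U \<inter> chart_dom c)) (f \<circ> chart_inv c)"
  proof (rule smooth_on_local)
    fix y assume "y \<in> chart_map c ` (U \<inter> chart_dom c)"
    then obtain x where x: "x \<in> U" "x \<in> chart_dom c" "y = chart_map c x" by auto
    obtain V where V: "open V" "x \<in> V" "smooth_fun_on V f" using assms[OF x(1)] by auto
    show "\<exists>T. open T \<and> y \<in> T \<and> smooth_on T (f \<circ> chart_inv c)"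
      by (rule exI[of _ "chart_map c ` (V \<inter> chart_dom c)"])
        (use V x c open_map_image in \<open>auto simp: smooth_fun_on_def\<close>)
  qed
qed

lemma smooth_fun_on_cong:
  assumes "open U" "\<And>x. x \<in> U \<Longrightarrow> f x = h x" "smooth_fun_on U f"
  shows "smooth_fun_on U h"
  unfolding smooth_fun_on_def
proof
  fix c assume c: "c \<in> A"
  have "smooth_on (chart_map c ` (U \<inter> chart_dom c)) (f \<circ> chart_inv c)"
    using assms(3) c by (simp add: smooth_fun_on_def)
  then show "smooth_on (chart_map c ` (U \<inter> chart_dom c)) (h \<circ> chart_inv c)"
    by (subst smooth_on_cong[of _ _ "f \<circ> chart_inv c"])
      (use c assms(1,2) open_map_image in \<open>auto simp: inv_map\<close>)
qed

lemma smooth_fun_on_const: "smooth_fun_on U (\<lambda>x. a)"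
  by (simp add: smooth_fun_on_def comp_def smooth_on_const)

lemma smooth_fun_on_add: "open U \<Longrightarrow> smooth_fun_on U f \<Longrightarrow> smooth_fun_on U h \<Longrightarrow> smooth_fun_on U (\<lambda>x. f x + h x)"
  by (simp add: smooth_fun_on_def comp_def smooth_on_add open_map_image)

lemma smooth_fun_on_sum: "open U \<Longrightarrow> (\<And>i. i \<in> I \<Longrightarrow> smooth_fun_on U (f i)) \<Longrightarrow> smooth_fun_on U (\<lambda>x. \<Sum>i\<in>I. f i x)"
  by (simp add: smooth_fun_on_def comp_def smooth_on_sum open_map_image)

lemma smooth_fun_on_mult: "open U \<Longrightarrow> smooth_fun_on U f \<Longrightarrow> smooth_fun_on U h \<Longrightarrow> smooth_fun_on U (\<lambda>x. f x * h x)"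
  by (simp add: smooth_fun_on_def comp_def smooth_on_mult open_map_image)

lemma smooth_fun_on_compose:
  assumes "open U" "smooth_on T F" "f ` U \<subseteq> T" "smooth_fun_on U f"
  shows "smooth_fun_on U (\<lambda>x. F (f x))"
  unfolding smooth_fun_on_def comp_def
proof
  fix c assume c: "c \<in> A"
  show "smooth_on (chart_map c ` (U \<inter> chart_dom c)) (\<lambda>y. F (f (chart_inv c y)))"
    by (rule smooth_on_compose[OF open_map_image[OF c assms(1)] _ assms(2)])
      (use assms c in \<open>auto simp: smooth_fun_on_def comp_def inv_map\<close>)
qed

lemma smooth_fun_on_divide:
  assumes "open U" "smooth_fun_on U f" "smooth_fun_on U h" "\<And>x. x \<in> U \<Longrightarrow> h x \<noteq> 0"
  shows "smooth_fun_on U (\<lambda>x. f x / h x)"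
  unfolding divide_inverse
  by (intro smooth_fun_on_mult assms smooth_fun_on_compose[OF _ smooth_on_inverse]) (use assms in auto)

lemma smooth_fun_on_chart:
  fixes F :: "'e \<Rightarrow> real"
  assumes c: "c \<in> A" and F: "smooth_on UNIV F"
  shows "smooth_fun_on (chart_dom c) (\<lambda>x. F (chart_map c x))"
  unfolding smooth_fun_on_def comp_def
proof
  fix c' assume c': "c' \<in> A"
  show "smooth_on (chart_map c' ` (chart_dom c \<inter> chart_dom c')) (\<lambda>y. F (chart_map c (chart_inv c' y)))"
    by (rule smooth_on_compose[OF open_map_image[OF c' open_dom[OF c]] _ F])
      (use trans_smooth[OF c' c] in \<open>auto simp: comp_def\<close>)
qed

lemma smooth_fun_on_has_derivative:
  assumes "smooth_fun_on U f" "c \<in> A" "x \<in> U" "x \<in> chart_dom c"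
  shows "((f \<circ> chart_inv c) has_derivative frechet_derivative (f \<circ> chart_inv c) (at (chart_map c x)))
    (at (chart_map c x))"
  by (rule smooth_on_has_derivative[of "chart_map c ` (U \<inter> chart_dom c)"])
    (use assms in \<open>auto simp: smooth_fun_on_def\<close>)

lemma smooth_fun_on_continuous_on:
  assumes "open U" "smooth_fun_on U f"
  shows "continuous_on U f"
proof -
  have "isCont f x" if x: "x \<in> U" for x
  proof -
    obtain c where c: "c \<in> A" "x \<in> chart_dom c" by (rule ex_chart)
    let ?V = "U \<inter> chart_dom c"
    have "continuous_on (chart_map c ` ?V) (f \<circ> chart_inv c)"
      using assms(2) c by (intro smooth_on_imp_continuous_on) (auto simp: smooth_fun_on_def)
    then have "continuous_on ?V (\<lambda>x. (f \<circ> chart_inv c) (chart_map c x))"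
      by (rule continuous_on_compose2) (auto intro: continuous_on_subset[OF cont_map[OF c(1)]])
    then have "continuous_on ?V f"
      by (rule continuous_on_eq) (simp add: inv_map[OF c(1)])
    then show ?thesis
      using x c open_dom[OF c(1)] assms(1) by (simp add: continuous_on_eq_continuous_at open_Int)
  qed
  then show ?thesis by (simp add: continuous_at_imp_continuous_on)
qed

text \<open>\<open>differential\<close> computes in one chart picked by \<open>SOME\<close>. The
  transition law of tangent vectors cancels the transition differential in the chain rule, so any
  chart at the point may be used.\<close>

lemma differential_eq:
  assumes c: "c \<in> A" "x \<in> chart_dom c" and v: "v \<in> tangent_space A x"
    and D: "((f \<circ> chart_inv c) has_derivative D) (at (chart_map c x))"
  shows "differential A f x v = D (v c)"
proof -
  define c0 where "c0 = (SOME c. c \<in> A \<and> x \<in> chart_dom c)"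
  have "c0 \<in> A \<and> x \<in> chart_dom c0" unfolding c0_def by (rule someI[of _ c]) (use c in simp)
  then have c0: "c0 \<in> A" "x \<in> chart_dom c0" by auto
  let ?p = "chart_map c0 x"
  have t: "((chart_map c \<circ> chart_inv c0) has_derivative transition_deriv c0 c x) (at ?p)"
    by (rule trans_has_derivative) (use c c0 in auto)
  have "((f \<circ> chart_inv c) \<circ> (chart_map c \<circ> chart_inv c0) has_derivative D \<circ> transition_deriv c0 c x) (at ?p)"
    by (rule diff_chain_at[OF t]) (use D c0 in \<open>simp add: inv_map\<close>)
  moreover have "open (chart_map c0 ` (chart_dom c \<inter> chart_dom c0))"
    by (rule open_map_image[OF c0(1) open_dom[OF c(1)]])
  ultimately have "((f \<circ> chart_inv c0) has_derivative D \<circ> transition_deriv c0 c x) (at ?p)"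
    by (rule has_derivative_transform_within_open)
      (use c c0 in \<open>auto simp: inv_map\<close>)
  then have "frechet_derivative (f \<circ> chart_inv c0) (at ?p) = D \<circ> transition_deriv c0 c x"
    by (rule frechet_derivative_at[symmetric])
  moreover have "v c = transition_deriv c0 c x (v c0)"
    using v c c0 unfolding tangent_space_def by blast
  ultimately show ?thesis
    by (simp add: differential_def Let_def flip: c0_def)
qed

lemma differential_smooth_fun_on:
  assumes "smooth_fun_on U f" "c \<in> A" "x \<in> U" "x \<in> chart_dom c" "v \<in> tangent_space A x"
  shows "differential A f x v = frechet_derivative (f \<circ> chart_inv c) (at (chart_map c x)) (v c)"
  by (rule differential_eq[OF assms(2,4,5) smooth_fun_on_has_derivative[OF assms(1-4)]])

lemma differential_cong:
  assumes "open U" "x \<in> U" "\<And>y. y \<in> U \<Longrightarrow> f y = h y" "smooth_fun_on U f" "v \<in> tangent_space A x"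
  shows "differential A h x v = differential A f x v"
proof -
  obtain c where c: "c \<in> A" "x \<in> chart_dom c" by (rule ex_chart)
  have "((h \<circ> chart_inv c) has_derivative frechet_derivative (f \<circ> chart_inv c) (at (chart_map c x)))
    (at (chart_map c x))"
    by (rule has_derivative_transform_within_open[OF smooth_fun_on_has_derivative[OF assms(4) c(1) assms(2) c(2)]
          open_map_image[OF c(1) assms(1)]])
      (use c assms in \<open>auto simp: inv_map\<close>)
  then show ?thesis
    using differential_eq[OF c assms(5)] differential_smooth_fun_on[OF assms(4) c(1) assms(2) c(2) assms(5)] by simp
qed

lemma differential_const: "v \<in> tangent_space A x \<Longrightarrow> differential A (\<lambda>x. a) x v = 0"
  using ex_chart[of x] differential_eq[of _ x v "\<lambda>x. a" "\<lambda>_. 0"] by (auto simp: comp_def)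

lemma differential_add:
  assumes "smooth_fun_on U f" "smooth_fun_on U h" "x \<in> U" "v \<in> tangent_space A x"
  shows "differential A (\<lambda>x. f x + h x) x v = differential A f x v + differential A h x v"
proof -
  obtain c where c: "c \<in> A" "x \<in> chart_dom c" by (rule ex_chart)
  note d = smooth_fun_on_has_derivative[OF assms(1) c(1) assms(3) c(2)] smooth_fun_on_has_derivative[OF assms(2) c(1) assms(3) c(2)]
  have "((\<lambda>x. f x + h x) \<circ> chart_inv c has_derivative
      (\<lambda>w. frechet_derivative (f \<circ> chart_inv c) (at (chart_map c x)) w
        + frechet_derivative (h \<circ> chart_inv c) (at (chart_map c x)) w)) (at (chart_map c x))"
    using has_derivative_add[OF d] by (simp add: comp_def)
  from differential_eq[OF c assms(4) this] show ?thesis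
    by (simp add: differential_smooth_fun_on[OF assms(1) c(1) assms(3) c(2) assms(4)]
        differential_smooth_fun_on[OF assms(2) c(1) assms(3) c(2) assms(4)])
qed

lemma differential_sum:
  assumes "open U" "\<And>i. i \<in> I \<Longrightarrow> smooth_fun_on U (f i)" "x \<in> U" "v \<in> tangent_space A x"
  shows "differential A (\<lambda>x. \<Sum>i\<in>I. f i x) x v = (\<Sum>i\<in>I. differential A (f i) x v)"
  using assms(2)
proof (induction I rule: infinite_finite_induct)
  case (insert i I)
  have "smooth_fun_on U (\<lambda>x. \<Sum>i\<in>I. f i x)" using insert by (intro smooth_fun_on_sum assms(1)) auto
  with insert show ?case using differential_add[of U "f i" "\<lambda>x. \<Sum>i\<in>I. f i x"] assms by simp
qed (use differential_const assms in auto)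

lemma differential_mult:
  assumes "smooth_fun_on U f" "smooth_fun_on U h" "x \<in> U" "v \<in> tangent_space A x"
  shows "differential A (\<lambda>x. f x * h x) x v = f x * differential A h x v + differential A f x v * h x"
proof -
  obtain c where c: "c \<in> A" "x \<in> chart_dom c" by (rule ex_chart)
  note d = smooth_fun_on_has_derivative[OF assms(1) c(1) assms(3) c(2)] smooth_fun_on_has_derivative[OF assms(2) c(1) assms(3) c(2)]
  have "((\<lambda>x. f x * h x) \<circ> chart_inv c has_derivative
      (\<lambda>w. f x * frechet_derivative (h \<circ> chart_inv c) (at (chart_map c x)) w
        + frechet_derivative (f \<circ> chart_inv c) (at (chart_map c x)) w * h x)) (at (chart_map c x))"
    using has_derivative_mult[OF d] by (simp add: comp_def inv_map[OF c])
  from differential_eq[OF c assms(4) this] show ?thesis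
    by (simp add: differential_smooth_fun_on[OF assms(1) c(1) assms(3) c(2) assms(4)]
        differential_smooth_fun_on[OF assms(2) c(1) assms(3) c(2) assms(4)])
qed

lemma differential_compose:
  assumes "smooth_fun_on U f" "x \<in> U" "v \<in> tangent_space A x" "(F has_real_derivative F') (at (f x))"
  shows "differential A (\<lambda>x. F (f x)) x v = F' * differential A f x v"
proof -
  obtain c where c: "c \<in> A" "x \<in> chart_dom c" by (rule ex_chart)
  have F: "(F has_derivative (\<lambda>t. F' * t)) (at ((f \<circ> chart_inv c) (chart_map c x)))"
    using assms(4) by (simp add: has_field_derivative_def inv_map[OF c])
  have "((\<lambda>x. F (f x)) \<circ> chart_inv c has_derivative
      (\<lambda>w. F' * frechet_derivative (f \<circ> chart_inv c) (at (chart_map c x)) w)) (at (chart_map c x))"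
    using has_derivative_compose[OF smooth_fun_on_has_derivative[OF assms(1) c(1) assms(2) c(2)] F]
    by (simp add: comp_def)
  from differential_eq[OF c assms(3) this] show ?thesis
    by (simp add: differential_smooth_fun_on[OF assms(1) c(1) assms(2) c(2) assms(3)])
qed

text \<open>In a chart the partial derivatives are continuous, hence their absolute sum stays below
  its value at \<open>x\<close> plus 1 nearby. The factor \<open>2 / \<mu>\<close> converts the
  Euclidean norm of the coordinates into the norm at the moving point.\<close>

lemma differential_bounded_local:
  assumes "open U" "smooth_fun_on U f" "x \<in> U"
  obtains V B where "open V" "x \<in> V" "V \<subseteq> U" "B \<ge> 0"
    "\<And>y v. y \<in> V \<Longrightarrow> v \<in> tangent_space A y \<Longrightarrow> \<bar>differential A f y v\<bar> \<le> B * tangent_norm g y v"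
proof -
  obtain c where c: "c \<in> A" "x \<in> chart_dom c" by (rule ex_chart)
  let ?p = "chart_map c x"
  obtain \<mu> where \<mu>: "\<mu> > 0" "\<And>u. \<mu> * norm u \<le> coord_norm c x u"
    using coord_norm_lower[OF c] by blast
  obtain \<rho> where \<rho>: "\<rho> > 0" "ball ?p \<rho> \<subseteq> chart_im c"
    "\<And>y u. y \<in> ball ?p \<rho> \<Longrightarrow> coord_norm c x u \<le> 2 * coord_norm c (chart_inv c y) u"
    using coord_norm_local[OF c, of 2] by (metis one_less_numeral_iff semiring_norm(76))
  define W where "W = chart_map c ` (U \<inter> chart_dom c)"
  have W: "open W" "?p \<in> W" using c assms by (auto simp: W_def open_map_image)
  define d where "d y = (\<Sum>b\<in>Basis. \<bar>frechet_derivative (f \<circ> chart_inv c) (at y) b\<bar>)" for y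
  have "smooth_on W (f \<circ> chart_inv c)" using assms(2) c by (simp add: smooth_fun_on_def W_def)
  then have "continuous_on W d"
    unfolding d_def by (intro continuous_intros smooth_on_continuous_deriv)
  then have o: "open (W \<inter> ball ?p \<rho> \<inter> d -` {..<d ?p + 1})"
    using W by (intro continuous_open_preimage) (auto intro: continuous_on_subset)
  define V where "V = chart_inv c ` ((W \<inter> ball ?p \<rho> \<inter> d -` {..<d ?p + 1}) \<inter> chart_im c)"
  show ?thesis
  proof (rule that[of V "(d ?p + 1) * 2 / \<mu>"])
    show "open V" unfolding V_def by (rule open_inv_image[OF c(1) o])
    show "x \<in> V" using W \<rho>(1) c map_in_im[OF c(2)]
      unfolding V_def by (intro image_eqI[of _ _ ?p]) (auto simp: inv_map)
    show "V \<subseteq> U" using c by (auto simp: V_def W_def inv_map)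
    have d0: "d ?p \<ge> 0" by (auto simp: d_def intro: sum_nonneg)
    then show "(d ?p + 1) * 2 / \<mu> \<ge> 0" using \<mu> by auto
    fix y v assume "y \<in> V" and v: "v \<in> tangent_space A y"
    then obtain z where z: "z \<in> W" "z \<in> ball ?p \<rho>" "d z < d ?p + 1" "y = chart_inv c z" "z \<in> chart_im c"
      by (auto simp: V_def)
    have y: "y \<in> U" "y \<in> chart_dom c" "chart_map c y = z"
      using z c by (auto simp: W_def inv_map)
    let ?D = "frechet_derivative (f \<circ> chart_inv c) (at z)" and ?u = "v c"
    have hd: "((f \<circ> chart_inv c) has_derivative ?D) (at z)"
      using smooth_fun_on_has_derivative[OF assms(2) c(1) y(1,2)] y(3) by simp
    then have l: "linear ?D" by (rule has_derivative_linear)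
    have "?D ?u = ?D (\<Sum>b\<in>Basis. (?u \<bullet> b) *\<^sub>R b)" by (simp add: euclidean_representation)
    also have "\<dots> = (\<Sum>b\<in>Basis. (?u \<bullet> b) * ?D b)" by (simp add: linear_sum[OF l] linear_cmul[OF l])
    also have "\<bar>\<dots>\<bar> \<le> (\<Sum>b\<in>Basis. norm ?u * \<bar>?D b\<bar>)"
      by (intro order_trans[OF sum_abs] sum_mono) (auto simp: abs_mult Basis_le_norm intro!: mult_right_mono)
    also have "\<dots> = norm ?u * d z" by (simp add: d_def sum_distrib_left)
    also have "\<dots> \<le> norm ?u * (d ?p + 1)" using z by (intro mult_left_mono) auto
    also have "\<dots> \<le> (2 * coord_norm c y ?u / \<mu>) * (d ?p + 1)"
    proof (intro mult_right_mono)
      have "\<mu> * norm ?u \<le> 2 * coord_norm c y ?u" using \<mu>(2)[of ?u] \<rho>(3)[OF z(2), of ?u] z(4) by simp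
      then show "norm ?u \<le> 2 * coord_norm c y ?u / \<mu>" using \<mu>(1) by (simp add: field_simps)
    qed (use d0 in auto)
    also have "\<dots> = (d ?p + 1) * 2 / \<mu> * tangent_norm g y v"
      by (simp add: tangent_norm_eq_coord_norm[OF c(1) y(2) v])
    finally show "\<bar>differential A f y v\<bar> \<le> (d ?p + 1) * 2 / \<mu> * tangent_norm g y v"
      using differential_smooth_fun_on[OF assms(2) c(1) y(1,2) v] y(3) by simp
  qed
qed

lemma tangent_norm_nonneg: "v \<in> tangent_space A x \<Longrightarrow> tangent_norm g x v \<ge> 0"
  by (metis ex_chart coord_norm_nonneg tangent_norm_eq_coord_norm)

text \<open>Finitely many of the local bounds suffice on \<open>K\<close>; off \<open>K\<close> the
  function vanishes on an open set, so its differential is 0. Applied to a partition function it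
  supplies the constant that determines the admissible local error.\<close>

lemma differential_bounded_compact:
  assumes "smooth_fun_on UNIV f" "compact K" "\<And>x. x \<notin> K \<Longrightarrow> f x = 0"
  obtains B where "B \<ge> 0"
    "\<And>x v. v \<in> tangent_space A x \<Longrightarrow> \<bar>differential A f x v\<bar> \<le> B * tangent_norm g x v"
proof -
  define P where "P V B \<longleftrightarrow> (\<forall>y\<in>V. \<forall>v\<in>tangent_space A y. \<bar>differential A f y v\<bar> \<le> B * tangent_norm g y v)" for V B
  have "\<exists>V B. open V \<and> x \<in> V \<and> B \<ge> 0 \<and> P V B" for x
    using differential_bounded_local[OF open_UNIV assms(1), of x] by (metis P_def UNIV_I)
  then obtain V B where VB: "\<And>x. open (V x)" "\<And>x. x \<in> V x" "\<And>x. B x \<ge> (0::real)" "\<And>x. P (V x) (B x)"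
    by metis
  have "K \<subseteq> (\<Union>x\<in>K. V x)" using VB by auto
  then obtain F where F: "F \<subseteq> K" "finite F" "K \<subseteq> (\<Union>x\<in>F. V x)"
    by (rule compactE_image[OF assms(2) VB(1)])
  show ?thesis
  proof (rule that[of "\<Sum>x\<in>F. B x"])
    show "(\<Sum>x\<in>F. B x) \<ge> 0" by (simp add: VB sum_nonneg)
    fix x v assume v: "v \<in> tangent_space A x"
    note n = tangent_norm_nonneg[OF v]
    show "\<bar>differential A f x v\<bar> \<le> (\<Sum>x\<in>F. B x) * tangent_norm g x v"
    proof (cases "x \<in> K")
      case True
      then obtain z where z: "z \<in> F" "x \<in> V z" using F by auto
      then have "\<bar>differential A f x v\<bar> \<le> B z * tangent_norm g x v" using VB(4) v by (auto simp: P_def)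
      also have "\<dots> \<le> (\<Sum>x\<in>F. B x) * tangent_norm g x v"
        using n z F VB by (intro mult_right_mono member_le_sum) auto
      finally show ?thesis .
    next
      case False
      have "differential A f x v = differential A (\<lambda>x. 0) x v"
        by (rule differential_cong[of "- K"])
          (use False assms compact_imp_closed v smooth_fun_on_const in auto)
      then show ?thesis using n VB by (simp add: differential_const[OF v] sum_nonneg)
    qed
  qed
qed

end


section \<open>Curves and the Riemannian distance\<close>

context riem_mfd
begin

text \<open>\<open>velocity\<close> differentiates within \<open>{0..1}\<close>. The parameter
  \<open>S\<close> allows one-sided derivatives on a piece \<open>{a..b}\<close> and, with
  \<open>S = UNIV\<close>, a velocity independent of the parameter interval.\<close>

definition vel :: "real set \<Rightarrow> (real \<Rightarrow> 'm) \<Rightarrow> real \<Rightarrow> ('m, 'e) tangent" where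
  "vel S \<gamma> t = (\<lambda>c. if c \<in> A \<and> \<gamma> t \<in> chart_dom c
     then vector_derivative (chart_map c \<circ> \<gamma>) (at t within S) else 0)"

text \<open>The two-sided derivative may be meaningless at break points, where \<open>vel\<close>
  need not be a tangent vector and the square root may be negative. The absolute value makes lengths
  nonnegative without any hypothesis on the curve.\<close>

definition speed :: "(real \<Rightarrow> 'm) \<Rightarrow> real \<Rightarrow> real" where
  "speed \<gamma> t = \<bar>tangent_norm g (\<gamma> t) (vel UNIV \<gamma> t)\<bar>"

definition arc_length :: "(real \<Rightarrow> 'm) \<Rightarrow> real \<Rightarrow> real \<Rightarrow> real" where
  "arc_length \<gamma> a b = integral {a..b} (speed \<gamma>)"

lemma C1_curve_derivative:
  assumes "C1_curve_on A a b \<gamma>" "t \<in> {a..b}" "c \<in> A" "\<gamma> t \<in> chart_dom c"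
  shows "((chart_map c \<circ> \<gamma>) has_vector_derivative
      vector_derivative (chart_map c \<circ> \<gamma>) (at t within {a..b})) (at t within {a..b})"
proof -
  have "(chart_map c \<circ> \<gamma>) differentiable (at t within {a..b})"
    using assms unfolding C1_curve_on_def by blast
  then show ?thesis by (simp add: vector_derivative_works)
qed

lemma C1_curveI:
  assumes "a < b" "continuous_on {a..b} \<gamma>"
    and w: "\<And>c t. c \<in> A \<Longrightarrow> t \<in> {a..b} \<Longrightarrow> \<gamma> t \<in> chart_dom c \<Longrightarrow>
      ((chart_map c \<circ> \<gamma>) has_vector_derivative w c t) (at t within {a..b})"
    and wc: "\<And>c. c \<in> A \<Longrightarrow> continuous_on {t\<in>{a..b}. \<gamma> t \<in> chart_dom c} (w c)"
  shows "C1_curve_on A a b \<gamma>"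
  unfolding C1_curve_on_def
proof (intro conjI ballI impI assms(2))
  fix c assume c: "c \<in> A"
  show "(chart_map c \<circ> \<gamma>) differentiable (at t within {a..b})"
    if "t \<in> {a..b}" "\<gamma> t \<in> chart_dom c" for t
    using w[OF c that] by (rule differentiableI_vector)
  have "vector_derivative (chart_map c \<circ> \<gamma>) (at t within {a..b}) = w c t"
    if "t \<in> {a..b}" "\<gamma> t \<in> chart_dom c" for t
    by (rule vector_derivative_within_closed_interval)
      (use w[OF c that] assms(1) that in auto)
  then show "continuous_on {t\<in>{a..b}. \<gamma> t \<in> chart_dom c}
      (\<lambda>t. vector_derivative (chart_map c \<circ> \<gamma>) (at t within {a..b}))"
    by (intro continuous_on_eq[OF wc[OF c]]) auto
qed

lemma C1_curve_continuous: "C1_curve_on A a b \<gamma> \<Longrightarrow> continuous_on {a..b} \<gamma>"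
  by (simp add: C1_curve_on_def)

text \<open>The chain rule gives the transition law for one-sided derivatives; these are unique
  because the interval is nondegenerate.\<close>

lemma vel_tangent:
  assumes "C1_curve_on A a b \<gamma>" "a < b" "t \<in> {a..b}"
  shows "vel {a..b} \<gamma> t \<in> tangent_space A (\<gamma> t)"
proof -
  have "vector_derivative (chart_map c' \<circ> \<gamma>) (at t within {a..b})
      = transition_deriv c c' (\<gamma> t) (vector_derivative (chart_map c \<circ> \<gamma>) (at t within {a..b}))"
    if c: "c \<in> A" "c' \<in> A" "\<gamma> t \<in> chart_dom c" "\<gamma> t \<in> chart_dom c'" for c c'
  proof (rule vector_derivative_within_closed_interval)
    have "continuous (at t within {a..b}) \<gamma>"
      using C1_curve_continuous[OF assms(1)] assms(3) by (simp add: continuous_on_eq_continuous_within)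
    then show "((chart_map c' \<circ> \<gamma>) has_vector_derivative
        transition_deriv c c' (\<gamma> t) (vector_derivative (chart_map c \<circ> \<gamma>) (at t within {a..b}))) (at t within {a..b})"
      using change_chart_within[OF c _ assms(3)
          C1_curve_derivative[OF assms(1,3) c(1,3), unfolded has_vector_derivative_def]]
      by (simp add: has_vector_derivative_def linear_cmul[OF trans_linear[OF c]])
  qed (use assms in auto)
  note key = this
  show ?thesis
    unfolding tangent_space_def
  proof (intro CollectI conjI ballI impI allI)
    fix c c' assume c: "c \<in> A" "c' \<in> A" "\<gamma> t \<in> chart_dom c" "\<gamma> t \<in> chart_dom c'"
    show "vel {a..b} \<gamma> t c' = transition_deriv c c' (\<gamma> t) (vel {a..b} \<gamma> t c)"
      using key[OF c] c by (simp only: vel_def if_True simp_thms)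
  qed (auto simp: vel_def)
qed

lemma continuous_on_tangent_norm_vel:
  assumes "C1_curve_on A a b \<gamma>" "a < b"
  shows "continuous_on {a..b} (\<lambda>t. tangent_norm g (\<gamma> t) (vel {a..b} \<gamma> t))"
  unfolding continuous_on_eq_continuous_within
proof
  fix t assume t: "t \<in> {a..b}"
  obtain c where c: "c \<in> A" "\<gamma> t \<in> chart_dom c" by (rule ex_chart)
  define T where "T = {s\<in>{a..b}. \<gamma> s \<in> chart_dom c}"
  define w where "w s = vector_derivative (chart_map c \<circ> \<gamma>) (at s within {a..b})" for s
  have wc: "continuous_on T w"
    using assms(1) c unfolding C1_curve_on_def T_def w_def by blast
  have \<gamma>c: "continuous_on {a..b} \<gamma>" using assms(1) by (rule C1_curve_continuous)
  have Qc: "continuous_on T (\<lambda>s. coord_form c (\<gamma> s) u v)" for u v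
    by (rule continuous_on_compose2[OF continuous_on_coord_form[OF c(1)] continuous_on_subset[OF \<gamma>c]])
      (auto simp: T_def)
  have "continuous_on T (\<lambda>s. sqrt (\<Sum>b\<in>Basis. \<Sum>b'\<in>Basis. (w s \<bullet> b) * (w s \<bullet> b') * coord_form c (\<gamma> s) b b'))"
    by (intro continuous_intros wc Qc)
  moreover have "sqrt (\<Sum>b\<in>Basis. \<Sum>b'\<in>Basis. (w s \<bullet> b) * (w s \<bullet> b') * coord_form c (\<gamma> s) b b')
      = tangent_norm g (\<gamma> s) (vel {a..b} \<gamma> s)" if s: "s \<in> T" for s
  proof -
    have s': "s \<in> {a..b}" "\<gamma> s \<in> chart_dom c" using s by (auto simp: T_def)
    have "tangent_norm g (\<gamma> s) (vel {a..b} \<gamma> s) = coord_norm c (\<gamma> s) (w s)"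
      using tangent_norm_eq_coord_norm[OF c(1) s'(2) vel_tangent[OF assms s'(1)]] c(1) s'
      by (simp add: vel_def w_def)
    then show ?thesis by (simp add: coord_norm_def coord_form_expand[OF c(1) s'(2), of "w s"])
  qed
  ultimately have "continuous_on T (\<lambda>t. tangent_norm g (\<gamma> t) (vel {a..b} \<gamma> t))"
    by (rule continuous_on_eq)
  moreover have tT: "t \<in> T" using t c by (simp add: T_def)
  ultimately have 1: "continuous (at t within T) (\<lambda>t. tangent_norm g (\<gamma> t) (vel {a..b} \<gamma> t))"
    by (simp add: continuous_on_eq_continuous_within)
  \<comment> \<open>\<open>T\<close> is relatively open in \<open>{a..b}\<close>, so continuity
    within \<open>T\<close> is continuity within the whole interval.\<close>
  obtain U where U: "open U" "U \<inter> {a..b} = \<gamma> -` chart_dom c \<inter> {a..b}"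
    using \<gamma>c open_dom[OF c(1)] unfolding continuous_on_open_invariant by blast
  then have "U \<inter> {a..b} = T" unfolding T_def by blast
  then have "t \<in> U" "T \<inter> U - {t} = {a..b} \<inter> U - {t}" using tT by blast+
  then have "at t within T = at t within {a..b}"
    using U(1) by (intro at_within_nhd[of t U])
  with 1 show "continuous (at t within {a..b}) (\<lambda>t. tangent_norm g (\<gamma> t) (vel {a..b} \<gamma> t))"
    by simp
qed

text \<open>At interior times the derivative within the interval is the ordinary one, so
  \<open>speed\<close> agrees with the norm of the one-sided velocity except at the two ends, which
  integrals do not see.\<close>

lemma C1_curve_interior:
  assumes "C1_curve_on A a b \<gamma>" "a < t" "t < b"
  shows "vel UNIV \<gamma> t \<in> tangent_space A (\<gamma> t)"
    and "speed \<gamma> t = tangent_norm g (\<gamma> t) (vel {a..b} \<gamma> t)"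
    and "c \<in> A \<Longrightarrow> \<gamma> t \<in> chart_dom c \<Longrightarrow>
      ((chart_map c \<circ> \<gamma>) has_vector_derivative vel UNIV \<gamma> t c) (at t)"
    and "c \<in> A \<Longrightarrow> \<gamma> t \<in> chart_dom c \<Longrightarrow> speed \<gamma> t = coord_norm c (\<gamma> t) (vel UNIV \<gamma> t c)"
proof -
  have at: "at t within {a..b} = at t" using assms by (simp add: at_within_Icc_at)
  then have v: "vel {a..b} \<gamma> t = vel UNIV \<gamma> t" unfolding vel_def by (rule arg_cong)
  have *: "vel {a..b} \<gamma> t \<in> tangent_space A (\<gamma> t)" by (rule vel_tangent) (use assms in auto)
  then show t: "vel UNIV \<gamma> t \<in> tangent_space A (\<gamma> t)" by (simp add: v)
  have n: "tangent_norm g (\<gamma> t) (vel UNIV \<gamma> t) \<ge> 0"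
    using t by (metis ex_chart coord_norm_nonneg tangent_norm_eq_coord_norm)
  then show "speed \<gamma> t = tangent_norm g (\<gamma> t) (vel {a..b} \<gamma> t)" by (simp add: speed_def v)
  show "((chart_map c \<circ> \<gamma>) has_vector_derivative vel UNIV \<gamma> t c) (at t)"
    if "c \<in> A" "\<gamma> t \<in> chart_dom c"
    using C1_curve_derivative[OF assms(1) _ that] assms at that by (simp add: vel_def)
  show "speed \<gamma> t = coord_norm c (\<gamma> t) (vel UNIV \<gamma> t c)" if "c \<in> A" "\<gamma> t \<in> chart_dom c"
    using tangent_norm_eq_coord_norm[OF that t] n by (simp add: speed_def)
qed

lemma C1_curve_integrable:
  assumes "C1_curve_on A a b \<gamma>" "a < b"
  shows "speed \<gamma> integrable_on {a..b}"
proof (rule integrable_spike_finite[of "{a, b}"])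
  show "(\<lambda>t. tangent_norm g (\<gamma> t) (vel {a..b} \<gamma> t)) integrable_on {a..b}"
    by (intro integrable_continuous_real continuous_on_tangent_norm_vel assms)
qed (use C1_curve_interior(2)[OF assms(1)] in auto)

text \<open>The explicit partition of \<open>piecewise_C1_curve\<close> is replaced by closure under
  joining. Restriction, reparametrisation and concatenation then become rule inductions; the two
  notions are matched on the unit interval later.\<close>

inductive pw_C1 :: "(real \<Rightarrow> 'm) \<Rightarrow> real \<Rightarrow> real \<Rightarrow> bool" for \<gamma> where
  base: "a < b \<Longrightarrow> C1_curve_on A a b \<gamma> \<Longrightarrow> pw_C1 \<gamma> a b"
| join: "pw_C1 \<gamma> a m \<Longrightarrow> pw_C1 \<gamma> m b \<Longrightarrow> pw_C1 \<gamma> a b"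

lemma pw_C1_less: "pw_C1 \<gamma> a b \<Longrightarrow> a < b"
  by (induction rule: pw_C1.induct) auto

lemma pw_C1_continuous: "pw_C1 \<gamma> a b \<Longrightarrow> continuous_on {a..b} \<gamma>"
proof (induction rule: pw_C1.induct)
  case (join a m b)
  then have "{a..b} = {a..m} \<union> {m..b}" using pw_C1_less by fastforce
  with join show ?case by (simp add: continuous_on_closed_Un)
qed (simp add: C1_curve_continuous)

text \<open>Isolates the finite set of exceptional times, for use in comparing integrals of
  speeds.\<close>

lemma pw_C1_regular:
  "pw_C1 \<gamma> a b \<Longrightarrow> \<exists>S. finite S \<and> (\<forall>t\<in>{a..b} - S. \<exists>a' b'. a' < t \<and> t < b' \<and> C1_curve_on A a' b' \<gamma>)"
proof (induction rule: pw_C1.induct)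
  case (base a b)
  have "\<exists>a' b'. a' < t \<and> t < b' \<and> C1_curve_on A a' b' \<gamma>" if "t \<in> {a..b} - {a, b}" for t
    by (rule exI[of _ a], rule exI[of _ b]) (use that base in auto)
  then show ?case by (intro exI[of _ "{a, b}"]) simp
next
  case (join a m b)
  then obtain S T where S: "finite S" "\<forall>t\<in>{a..m} - S. \<exists>a' b'. a' < t \<and> t < b' \<and> C1_curve_on A a' b' \<gamma>"
    and T: "finite T" "\<forall>t\<in>{m..b} - T. \<exists>a' b'. a' < t \<and> t < b' \<and> C1_curve_on A a' b' \<gamma>"
    by blast
  have "{a..b} - (S \<union> T) \<subseteq> ({a..m} - S) \<union> ({m..b} - T)" by auto
  with S T show ?case by (intro exI[of _ "S \<union> T"] conjI) blast+
qed

lemma pw_C1_integrable: "pw_C1 \<gamma> a b \<Longrightarrow> speed \<gamma> integrable_on {a..b}"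
proof (induction rule: pw_C1.induct)
  case (join a m b)
  then show ?case
    by (meson Henstock_Kurzweil_Integration.integrable_combine less_imp_le pw_C1_less)
qed (simp add: C1_curve_integrable)

lemma arc_length_nonneg: "arc_length \<gamma> a b \<ge> 0"
  unfolding arc_length_def by (cases "speed \<gamma> integrable_on {a..b}")
    (auto intro!: integral_nonneg simp: speed_def not_integrable_integral)

lemma arc_length_split: "pw_C1 \<gamma> a b \<Longrightarrow> a \<le> m \<Longrightarrow> m \<le> b \<Longrightarrow> arc_length \<gamma> a b = arc_length \<gamma> a m + arc_length \<gamma> m b"
  unfolding arc_length_def using pw_C1_integrable
  by (metis Henstock_Kurzweil_Integration.integral_combine)

section \<open>Affine changes of parameter\<close>

lemma C1_curve_affine:
  assumes C: "C1_curve_on A a b \<gamma>" and "a' < b'" and sub: "(\<lambda>s. \<alpha> * s + \<beta>) ` {a'..b'} \<subseteq> {a..b}"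
  shows "C1_curve_on A a' b' (\<lambda>s. \<gamma> (\<alpha> * s + \<beta>))"
proof (rule C1_curveI[OF assms(2)])
  have sub': "\<alpha> * s + \<beta> \<in> {a..b}" if "s \<in> {a'..b'}" for s using sub that by blast
  show "continuous_on {a'..b'} (\<lambda>s. \<gamma> (\<alpha> * s + \<beta>))"
    by (rule continuous_on_compose2[OF C1_curve_continuous[OF C] _ sub]) (intro continuous_intros)
  let ?w = "\<lambda>c t. vector_derivative (chart_map c \<circ> \<gamma>) (at t within {a..b})"
  fix c assume c: "c \<in> A"
  show "(chart_map c \<circ> (\<lambda>s. \<gamma> (\<alpha> * s + \<beta>)) has_vector_derivative \<alpha> *\<^sub>R ?w c (\<alpha> * t + \<beta>)) (at t within {a'..b'})"
    if t: "t \<in> {a'..b'}" "\<gamma> (\<alpha> * t + \<beta>) \<in> chart_dom c" for t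
  proof -
    have 1: "((\<lambda>s. \<alpha> * s + \<beta>) has_vector_derivative \<alpha>) (at t within {a'..b'})"
      by (auto intro!: derivative_eq_intros)
    have "\<alpha> * t + \<beta> \<in> {a..b}" using sub' t by blast
    then have 2: "(chart_map c \<circ> \<gamma> has_vector_derivative ?w c (\<alpha> * t + \<beta>))
        (at (\<alpha> * t + \<beta>) within (\<lambda>s. \<alpha> * s + \<beta>) ` {a'..b'})"
      using C1_curve_derivative[OF C _ c t(2)] has_vector_derivative_within_subset[OF _ sub] by blast
    show ?thesis using vector_diff_chain_within[OF 1 2] by (simp add: comp_def)
  qed
  have "continuous_on {t\<in>{a..b}. \<gamma> t \<in> chart_dom c} (?w c)"
    using C c unfolding C1_curve_on_def by blast
  then have "continuous_on {t\<in>{a'..b'}. \<gamma> (\<alpha> * t + \<beta>) \<in> chart_dom c} (\<lambda>t. ?w c (\<alpha> * t + \<beta>))"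
    by (rule continuous_on_compose2) (use sub' in \<open>auto intro!: continuous_intros simp del: atLeastAtMost_iff\<close>)
  then show "continuous_on {t\<in>{a'..b'}. \<gamma> (\<alpha> * t + \<beta>) \<in> chart_dom c} (\<lambda>t. \<alpha> *\<^sub>R ?w c (\<alpha> * t + \<beta>))"
    by (intro continuous_intros)
qed

text \<open>The new interval only has to map into the old one and the slope may be negative.
  Restriction, rescaling to the unit interval, translation and reversal are all instances.\<close>

lemma pw_C1_affine:
  assumes "pw_C1 \<gamma> a b" "\<alpha> \<noteq> 0" "a' < b'" "\<alpha> * a' + \<beta> \<in> {a..b}" "\<alpha> * b' + \<beta> \<in> {a..b}"
  shows "pw_C1 (\<lambda>s. \<gamma> (\<alpha> * s + \<beta>)) a' b'"
  using assms(1,3-5)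
proof (induction arbitrary: a' b' rule: pw_C1.induct)
  case (base a b)
  have "\<alpha> * s + \<beta> \<in> {a..b}" if "s \<in> {a'..b'}" for s
  proof (cases "\<alpha> \<ge> 0")
    case True
    then have "\<alpha> * a' \<le> \<alpha> * s" "\<alpha> * s \<le> \<alpha> * b'" using that by (auto intro: mult_left_mono)
    then show ?thesis using base by auto
  next
    case False
    then have "\<alpha> * b' \<le> \<alpha> * s" "\<alpha> * s \<le> \<alpha> * a'" using that by (auto intro: mult_left_mono_neg)
    then show ?thesis using base by auto
  qed
  then show ?case
    by (intro pw_C1.base C1_curve_affine[OF base(2)]) (use base in auto)
next
  case (join a m b)
  \<comment> \<open>The preimage of the break point. If the image of the new interval lies on one
    side of \<open>m\<close>, one induction hypothesis applies; otherwise the interval is cut at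
    \<open>m'\<close>, and for a negative slope the two pieces change places.\<close>
  define m' where "m' = (m - \<beta>) / \<alpha>"
  have m: "\<alpha> * m' + \<beta> = m" using assms(2) by (simp add: m'_def)
  note l = pw_C1_less[OF join(1)] pw_C1_less[OF join(2)]
  show ?case
  proof (cases "\<alpha> > 0")
    case True
    then have s: "s < t \<longleftrightarrow> \<alpha> * s + \<beta> < \<alpha> * t + \<beta>" for s t by simp
    have "\<alpha> * b' + \<beta> \<le> m \<or> m \<le> \<alpha> * a' + \<beta> \<or> (a' < m' \<and> m' < b')"
      using s[of a' m'] s[of m' b'] m by linarith
    then consider "\<alpha> * b' + \<beta> \<le> m" | "m \<le> \<alpha> * a' + \<beta>" | "a' < m'" "m' < b'"
      by blast
    then show ?thesis
    proof cases
      case 1 then show ?thesis using join s[of a' b'] by (intro join.IH(1)) auto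
    next
      case 2 then show ?thesis using join s[of a' b'] by (intro join.IH(2)) auto
    next
      case 3
      have "pw_C1 (\<lambda>s. \<gamma> (\<alpha> * s + \<beta>)) a' m'"
        by (rule join.IH(1)) (use 3 join.prems l m s[of a' m'] in auto)
      moreover have "pw_C1 (\<lambda>s. \<gamma> (\<alpha> * s + \<beta>)) m' b'"
        by (rule join.IH(2)) (use 3 join.prems l m s[of m' b'] in auto)
      ultimately show ?thesis by (rule pw_C1.join)
    qed
  next
    case False
    then have s: "s < t \<longleftrightarrow> \<alpha> * t + \<beta> < \<alpha> * s + \<beta>" for s t using assms(2) by simp
    have "\<alpha> * a' + \<beta> \<le> m \<or> m \<le> \<alpha> * b' + \<beta> \<or> (a' < m' \<and> m' < b')"
      using s[of a' m'] s[of m' b'] m by linarith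
    then consider "\<alpha> * a' + \<beta> \<le> m" | "m \<le> \<alpha> * b' + \<beta>" | "a' < m'" "m' < b'"
      by blast
    then show ?thesis
    proof cases
      case 1 then show ?thesis using join s[of a' b'] by (intro join.IH(1)) auto
    next
      case 2 then show ?thesis using join s[of a' b'] by (intro join.IH(2)) auto
    next
      case 3
      have "pw_C1 (\<lambda>s. \<gamma> (\<alpha> * s + \<beta>)) a' m'"
        by (rule join.IH(2)) (use 3 join.prems l m s[of a' m'] in auto)
      moreover have "pw_C1 (\<lambda>s. \<gamma> (\<alpha> * s + \<beta>)) m' b'"
        by (rule join.IH(1)) (use 3 join.prems l m s[of m' b'] in auto)
      ultimately show ?thesis by (rule pw_C1.join)
    qed
  qed
qed

lemma pw_C1_restrict: "pw_C1 \<gamma> a b \<Longrightarrow> a \<le> a' \<Longrightarrow> a' < b' \<Longrightarrow> b' \<le> b \<Longrightarrow> pw_C1 \<gamma> a' b'"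
  using pw_C1_affine[of \<gamma> a b 1 a' b' 0] by simp

lemma speed_affine:
  assumes C: "C1_curve_on A a b \<gamma>" and "\<alpha> \<noteq> 0" "a < \<alpha> * s + \<beta>" "\<alpha> * s + \<beta> < b"
  shows "speed (\<lambda>s. \<gamma> (\<alpha> * s + \<beta>)) s = \<bar>\<alpha>\<bar> * speed \<gamma> (\<alpha> * s + \<beta>)"
proof -
  let ?\<gamma> = "\<lambda>s. \<gamma> (\<alpha> * s + \<beta>)" and ?t = "\<alpha> * s + \<beta>"
  obtain c where c: "c \<in> A" "\<gamma> ?t \<in> chart_dom c" by (rule ex_chart)
  note d = C1_curve_interior(3)[OF C assms(3,4) c]
  have "((\<lambda>s. \<alpha> * s + \<beta>) has_vector_derivative \<alpha>) (at s)"
    by (auto intro!: derivative_eq_intros)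
  from vector_diff_chain_at[OF this d]
  have "(chart_map c \<circ> ?\<gamma> has_vector_derivative \<alpha> *\<^sub>R vel UNIV \<gamma> ?t c) (at s)"
    by (simp add: comp_def)
  then have v: "vel UNIV ?\<gamma> s c = \<alpha> *\<^sub>R vel UNIV \<gamma> ?t c"
    using c by (simp add: vel_def vector_derivative_at)
  define \<delta> where "\<delta> = min (?t - a) (b - ?t) / \<bar>\<alpha>\<bar>"
  have \<delta>: "\<delta> > 0" using assms by (simp add: \<delta>_def)
  have "\<bar>\<alpha> * (r - s)\<bar> \<le> min (?t - a) (b - ?t)" if "r \<in> {s - \<delta>..s + \<delta>}" for r
  proof -
    have "\<bar>\<alpha>\<bar> * \<bar>r - s\<bar> \<le> \<bar>\<alpha>\<bar> * \<delta>" using that by (intro mult_left_mono) auto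
    then show ?thesis using assms(2) by (simp add: \<delta>_def abs_mult)
  qed
  then have "(\<lambda>s. \<alpha> * s + \<beta>) ` {s - \<delta>..s + \<delta>} \<subseteq> {a..b}"
    by (force simp: algebra_simps abs_le_iff)
  then have C': "C1_curve_on A (s - \<delta>) (s + \<delta>) ?\<gamma>"
    by (intro C1_curve_affine[OF C]) (use \<delta> in auto)
  have "speed ?\<gamma> s = coord_norm c (\<gamma> ?t) (\<alpha> *\<^sub>R vel UNIV \<gamma> ?t c)"
    using C1_curve_interior(4)[OF C', of s c] \<delta> c v by simp
  also have "\<dots> = \<bar>\<alpha>\<bar> * speed \<gamma> ?t"
    using C1_curve_interior(4)[OF C assms(3,4) c] coord_norm_scaleR[OF c] by simp
  finally show ?thesis .
qed

text \<open>Substitution in the integral, after discarding the finite preimage of the times at which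
  the curve may fail to be differentiable.\<close>

lemma arc_length_affine:
  assumes "pw_C1 \<gamma> a b" "\<alpha> \<noteq> 0" "(\<lambda>s. \<alpha> * s + \<beta>) ` {a'..b'} = {a..b}"
  shows "arc_length (\<lambda>s. \<gamma> (\<alpha> * s + \<beta>)) a' b' = arc_length \<gamma> a b"
proof -
  obtain S where S: "finite S" "\<And>t. t \<in> {a..b} - S \<Longrightarrow> \<exists>a' b'. a' < t \<and> t < b' \<and> C1_curve_on A a' b' \<gamma>"
    using pw_C1_regular[OF assms(1)] by blast
  have im: "(\<lambda>x. (1 / \<alpha>) *\<^sub>R x + - ((1 / \<alpha>) *\<^sub>R \<beta>)) ` cbox a b = {a'..b'}"
    unfolding cbox_interval assms(3)[symmetric] image_image using assms(2) by (simp add: field_simps)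
  have "(speed \<gamma> has_integral arc_length \<gamma> a b) (cbox a b)"
    using pw_C1_integrable[OF assms(1)] by (simp add: arc_length_def integrable_integral)
  from has_integral_affinity[OF this assms(2), of \<beta>]
  have "((\<lambda>s. \<bar>\<alpha>\<bar> *\<^sub>R speed \<gamma> (\<alpha> * s + \<beta>)) has_integral \<bar>\<alpha>\<bar> *\<^sub>R (1 / \<bar>\<alpha>\<bar>) *\<^sub>R arc_length \<gamma> a b) {a'..b'}"
    unfolding im by (intro has_integral_cmul) simp
  then have "((\<lambda>s. \<bar>\<alpha>\<bar> * speed \<gamma> (\<alpha> * s + \<beta>)) has_integral arc_length \<gamma> a b) {a'..b'}"
    using assms(2) by simp
  then have "(speed (\<lambda>s. \<gamma> (\<alpha> * s + \<beta>)) has_integral arc_length \<gamma> a b) {a'..b'}"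
  proof (rule has_integral_spike_finite[rotated 2])
    show "finite ((\<lambda>t. (t - \<beta>) / \<alpha>) ` S)" using S(1) by simp
    fix s assume s: "s \<in> {a'..b'} - (\<lambda>t. (t - \<beta>) / \<alpha>) ` S"
    have "\<alpha> * s + \<beta> \<notin> S"
    proof
      assume "\<alpha> * s + \<beta> \<in> S"
      then have "(\<alpha> * s + \<beta> - \<beta>) / \<alpha> \<in> (\<lambda>t. (t - \<beta>) / \<alpha>) ` S" by (rule imageI)
      then show False using s assms(2) by simp
    qed
    then have "\<alpha> * s + \<beta> \<in> {a..b} - S" using s assms(3) by blast
    then show "speed (\<lambda>s. \<gamma> (\<alpha> * s + \<beta>)) s = \<bar>\<alpha>\<bar> * speed \<gamma> (\<alpha> * s + \<beta>)"
      using S(2) speed_affine assms(2) by blast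
  qed
  then show ?thesis unfolding arc_length_def by (rule integral_unique)
qed

lemma pw_C1_cong:
  assumes "pw_C1 \<gamma> a b" "\<And>t. t \<in> {a..b} \<Longrightarrow> \<gamma>' t = \<gamma> t"
  shows "pw_C1 \<gamma>' a b"
  using assms
proof (induction rule: pw_C1.induct)
  case (base a b)
  have "C1_curve_on A a b \<gamma>'"
  proof (rule C1_curveI[OF base(1)])
    show "continuous_on {a..b} \<gamma>'"
      by (rule continuous_on_eq[OF C1_curve_continuous[OF base(2)]]) (simp add: base(3))
    fix c assume c: "c \<in> A"
    show "(chart_map c \<circ> \<gamma>' has_vector_derivative vector_derivative (chart_map c \<circ> \<gamma>) (at t within {a..b})) (at t within {a..b})"
      if t: "t \<in> {a..b}" "\<gamma>' t \<in> chart_dom c" for t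
      by (rule has_vector_derivative_transform[OF t(1) _ C1_curve_derivative[OF base(2) t(1) c]])
        (use base t in auto)
    have "{t \<in> {a..b}. \<gamma>' t \<in> chart_dom c} = {t \<in> {a..b}. \<gamma> t \<in> chart_dom c}" using base(3) by (auto simp del: atLeastAtMost_iff)
    then show "continuous_on {t \<in> {a..b}. \<gamma>' t \<in> chart_dom c} (\<lambda>t. vector_derivative (chart_map c \<circ> \<gamma>) (at t within {a..b}))"
      using base(2) c unfolding C1_curve_on_def by auto
  qed
  with base(1) show ?case by (rule pw_C1.base)
next
  case (join a m b)
  have "pw_C1 \<gamma>' a m"
    by (rule join.IH(1)) (use join.prems pw_C1_less[OF join(2)] in auto)
  moreover have "pw_C1 \<gamma>' m b"
    by (rule join.IH(2)) (use join.prems pw_C1_less[OF join(1)] in auto)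
  ultimately show ?case by (rule pw_C1.join)
qed

text \<open>The two curves agree in a neighbourhood of each interior time, so their two-sided
  derivatives agree there; at the end points they may differ, which does not affect the
  integral.\<close>

lemma arc_length_cong:
  assumes "\<And>t. t \<in> {a..b} \<Longrightarrow> \<gamma>' t = \<gamma> t"
  shows "arc_length \<gamma>' a b = arc_length \<gamma> a b"
  unfolding arc_length_def
proof (rule integral_spike[of "{a, b}"])
  fix t assume "t \<in> {a..b} - {a, b}"
  then have t: "t \<in> {a<..<b}" by auto
  have "(chart_map c \<circ> \<gamma> has_vector_derivative w) (at t) \<longleftrightarrow> (chart_map c \<circ> \<gamma>' has_vector_derivative w) (at t)"
    for c :: "('m, 'e) chart" and w
    using has_vector_derivative_transform_within_open[of "chart_map c \<circ> \<gamma>" w t "{a<..<b}" "chart_map c \<circ> \<gamma>'"]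
      has_vector_derivative_transform_within_open[of "chart_map c \<circ> \<gamma>'" w t "{a<..<b}" "chart_map c \<circ> \<gamma>"]
      t assms by auto
  then have "vector_derivative (chart_map c \<circ> \<gamma>) (at t) = vector_derivative (chart_map c \<circ> \<gamma>') (at t)"
    for c :: "('m, 'e) chart"
    unfolding vector_derivative_def by presburger
  moreover have eq: "\<gamma>' t = \<gamma> t" using assms t by simp
  ultimately have "vel UNIV \<gamma> t = vel UNIV \<gamma>' t" by (intro ext) (simp add: vel_def)
  then show "speed \<gamma> t = speed \<gamma>' t" by (simp add: speed_def eq)
qed auto


section \<open>Curves on the unit interval and the distance\<close>

lemma pw_C1_seq:
  fixes t :: "nat \<Rightarrow> real"
  assumes "n > 0" "\<forall>i<n. t i < t (Suc i) \<and> C1_curve_on A (t i) (t (Suc i)) \<gamma>"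
  shows "pw_C1 \<gamma> (t 0) (t n)"
  using assms
proof (induction n)
  case (Suc n)
  then have b: "pw_C1 \<gamma> (t n) (t (Suc n))" by (auto intro: pw_C1.base)
  show ?case
  proof (cases "n = 0")
    case False
    with Suc have "pw_C1 \<gamma> (t 0) (t n)" by auto
    then show ?thesis using b by (rule pw_C1.join)
  qed (use b in simp)
qed simp

lemma pw_C1_imp_seq:
  assumes "pw_C1 \<gamma> a b"
  shows "\<exists>n (t :: nat \<Rightarrow> real). t 0 = a \<and> t n = b \<and>
    (\<forall>i<n. t i < t (Suc i) \<and> C1_curve_on A (t i) (t (Suc i)) \<gamma>)"
  using assms
proof (induction rule: pw_C1.induct)
  case (base a b)
  then show ?case by (intro exI[of _ 1] exI[of _ "\<lambda>i. if i = 0 then a else b"]) auto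
next
  case (join a m b)
  obtain n1 t1 where 1: "t1 0 = a" "t1 n1 = m"
    "\<And>i. i < n1 \<Longrightarrow> t1 i < t1 (Suc i) \<and> C1_curve_on A (t1 i) (t1 (Suc i)) \<gamma>"
    using join.IH(1) by blast
  obtain n2 t2 where 2: "t2 0 = m" "t2 n2 = b"
    "\<And>i. i < n2 \<Longrightarrow> t2 i < t2 (Suc i) \<and> C1_curve_on A (t2 i) (t2 (Suc i)) \<gamma>"
    using join.IH(2) by blast
  define t where "t i = (if i < n1 then t1 i else t2 (i - n1))" for i
  have "t 0 = a" using 1 2 by (cases "n1 = 0") (auto simp: t_def)
  moreover have "t (n1 + n2) = b" using 2 by (simp add: t_def)
  moreover have "t i < t (Suc i) \<and> C1_curve_on A (t i) (t (Suc i)) \<gamma>" if i: "i < n1 + n2" for i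
  proof (cases "i < n1")
    case True
    \<comment> \<open>At the seam \<open>Suc i = n1\<close> the value of \<open>t\<close> already
      comes from \<open>t2\<close>; both partitions have the value \<open>m\<close> there.\<close>
    moreover have "t (Suc i) = t1 (Suc i)"
    proof (cases "Suc i = n1")
      case True
      then show ?thesis using 1(2) 2(1) by (auto simp: t_def)
    qed (use True in \<open>simp add: t_def\<close>)
    ultimately have "t i = t1 i" "t (Suc i) = t1 (Suc i)" by (simp_all add: t_def)
    then show ?thesis using 1(3) True by simp
  next
    case False
    then have "t i = t2 (i - n1)" "t (Suc i) = t2 (Suc (i - n1))"
      by (auto simp: t_def Suc_diff_le)
    then show ?thesis using 2(3)[of "i - n1"] False i by simp
  qed
  ultimately show ?case by blast
qed

lemma piecewise_C1_curve_iff: "piecewise_C1_curve A \<gamma> \<longleftrightarrow> pw_C1 \<gamma> 0 1"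
proof
  assume "piecewise_C1_curve A \<gamma>"
  then obtain n t where t: "t 0 = (0::real)" "t n = 1"
    "\<forall>i<n. t i < t (Suc i) \<and> C1_curve_on A (t i) (t (Suc i)) \<gamma>"
    unfolding piecewise_C1_curve_def by blast
  then have "n > 0" by (cases n) auto
  from pw_C1_seq[OF this t(3)] t show "pw_C1 \<gamma> 0 1" by simp
qed (unfold piecewise_C1_curve_def, rule pw_C1_imp_seq)

lemma curve_length_eq_arc_length:
  assumes "pw_C1 \<gamma> 0 1"
  shows "curve_length A g \<gamma> = arc_length \<gamma> 0 1"
proof -
  obtain S where S: "finite S" "\<And>t. t \<in> {0..1} - S \<Longrightarrow> \<exists>a' b'. a' < t \<and> t < b' \<and> C1_curve_on A a' b' \<gamma>"
    using pw_C1_regular[OF assms] by blast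
  show ?thesis
    unfolding curve_length_def arc_length_def
  proof (rule integral_spike[of "S \<union> {0, 1}"])
    show "negligible (S \<union> {0, 1})" using S(1) by (intro negligible_finite) simp
    fix t :: real assume t: "t \<in> {0..1} - (S \<union> {0, 1})"
    then obtain a b where ab: "a < t" "t < b" "C1_curve_on A a b \<gamma>" using S(2)[of t] by auto
    have "at t within {0..1} = at t" using t by (intro at_within_Icc_at) auto
    then have "velocity A \<gamma> t = vel UNIV \<gamma> t" unfolding velocity_def vel_def by (rule arg_cong)
    moreover have "tangent_norm g (\<gamma> t) (vel UNIV \<gamma> t) \<ge> 0"
      using C1_curve_interior(1)[OF ab(3,1,2)] by (metis ex_chart coord_norm_nonneg tangent_norm_eq_coord_norm)
    ultimately show "speed \<gamma> t = tangent_norm g (\<gamma> t) (velocity A \<gamma> t)"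
      by (simp add: speed_def)
  qed
qed

lemma dist_eq_Inf: "riemannian_dist A g x y = Inf {arc_length \<gamma> 0 1 |\<gamma>. pw_C1 \<gamma> 0 1 \<and> \<gamma> 0 = x \<and> \<gamma> 1 = y}"
proof -
  have "{curve_length A g \<gamma> |\<gamma>. piecewise_C1_curve A \<gamma> \<and> \<gamma> 0 = x \<and> \<gamma> 1 = y}
    = {arc_length \<gamma> 0 1 |\<gamma>. pw_C1 \<gamma> 0 1 \<and> \<gamma> 0 = x \<and> \<gamma> 1 = y}"
    by (auto simp: piecewise_C1_curve_iff curve_length_eq_arc_length) (metis curve_length_eq_arc_length)+
  then show ?thesis by (simp add: riemannian_dist_def)
qed

lemma dist_le_arc_length01:
  assumes "pw_C1 \<gamma> 0 1"
  shows "riemannian_dist A g (\<gamma> 0) (\<gamma> 1) \<le> arc_length \<gamma> 0 1"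
  unfolding dist_eq_Inf
  by (rule cInf_lower) (use assms arc_length_nonneg in \<open>auto intro!: bdd_belowI[of _ 0]\<close>)

lemma pw_C1_rescale:
  assumes "pw_C1 \<gamma> a b"
  obtains \<gamma>' where "pw_C1 \<gamma>' 0 1" "\<gamma>' 0 = \<gamma> a" "\<gamma>' 1 = \<gamma> b" "arc_length \<gamma>' 0 1 = arc_length \<gamma> a b"
proof
  have ab: "a < b" using assms by (rule pw_C1_less)
  have im: "(\<lambda>s. (b - a) * s + a) ` {0..1} = {a..b}"
    using ab image_affinity_atLeastAtMost[of "b - a" a 0 1] by (simp add: algebra_simps)
  show "pw_C1 (\<lambda>s. \<gamma> ((b - a) * s + a)) 0 1" by (rule pw_C1_affine[OF assms]) (use ab in auto)
  show "arc_length (\<lambda>s. \<gamma> ((b - a) * s + a)) 0 1 = arc_length \<gamma> a b"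
    by (rule arc_length_affine[OF assms _ im]) (use ab in simp)
qed simp_all

lemma dist_le_arc_length:
  assumes "pw_C1 \<gamma> a b"
  shows "riemannian_dist A g (\<gamma> a) (\<gamma> b) \<le> arc_length \<gamma> a b"
  by (rule pw_C1_rescale[OF assms]) (metis dist_le_arc_length01)

lemma pw_C1_reverse:
  assumes "pw_C1 \<gamma> 0 1"
  obtains \<gamma>' where "pw_C1 \<gamma>' 0 1" "\<gamma>' 0 = \<gamma> 1" "\<gamma>' 1 = \<gamma> 0" "arc_length \<gamma>' 0 1 = arc_length \<gamma> 0 1"
proof
  have im: "(\<lambda>s. (- 1) * s + 1) ` {0..1::real} = {0..1}"
    using image_affinity_atLeastAtMost[of "-1" "1::real" 0 1] by simp
  show "pw_C1 (\<lambda>s. \<gamma> ((- 1) * s + 1)) 0 1" by (rule pw_C1_affine[OF assms]) auto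
  show "arc_length (\<lambda>s. \<gamma> ((- 1) * s + 1)) 0 1 = arc_length \<gamma> 0 1"
    by (rule arc_length_affine[OF assms _ im]) simp
qed simp_all

text \<open>The second curve is translated to \<open>{1..2}\<close>, the curves are joined on
  \<open>{0..2}\<close>, and the result is rescaled to the unit interval.\<close>

lemma pw_C1_concat:
  assumes 1: "pw_C1 \<gamma>\<^sub>1 0 1" and 2: "pw_C1 \<gamma>\<^sub>2 0 1" and eq: "\<gamma>\<^sub>1 1 = \<gamma>\<^sub>2 0"
  obtains \<gamma> where "pw_C1 \<gamma> 0 1" "\<gamma> 0 = \<gamma>\<^sub>1 0" "\<gamma> 1 = \<gamma>\<^sub>2 1" "arc_length \<gamma> 0 1 = arc_length \<gamma>\<^sub>1 0 1 + arc_length \<gamma>\<^sub>2 0 1"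
proof -
  define \<gamma> where "\<gamma> t = (if t \<le> 1 then \<gamma>\<^sub>1 t else \<gamma>\<^sub>2 (t - 1))" for t :: real
  have im: "(\<lambda>s. 1 * s + - 1) ` {1..2} = {0..1::real}"
    using image_affinity_atLeastAtMost[of 1 "-1::real" 1 2] by simp
  have e1: "\<gamma> t = \<gamma>\<^sub>1 t" if "t \<in> {0..1}" for t using that by (simp add: \<gamma>_def)
  have e2: "\<gamma> t = \<gamma>\<^sub>2 (1 * t + - 1)" if "t \<in> {1..2}" for t
    using that eq by (cases "t = 1") (auto simp: \<gamma>_def)
  have p1: "pw_C1 \<gamma> 0 1" by (rule pw_C1_cong[OF 1 e1])
  have p2: "pw_C1 \<gamma> 1 2" by (rule pw_C1_cong[OF pw_C1_affine[OF 2, of 1 1 2 "-1"] e2]) auto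
  have p: "pw_C1 \<gamma> 0 2" using p1 p2 by (rule pw_C1.join)
  have "arc_length \<gamma> 0 2 = arc_length \<gamma> 0 1 + arc_length \<gamma> 1 2" by (rule arc_length_split[OF p]) auto
  also have "arc_length \<gamma> 0 1 = arc_length \<gamma>\<^sub>1 0 1" by (rule arc_length_cong[OF e1])
  also have "arc_length \<gamma> 1 2 = arc_length (\<lambda>t. \<gamma>\<^sub>2 (1 * t + - 1)) 1 2" by (rule arc_length_cong[OF e2])
  also have "\<dots> = arc_length \<gamma>\<^sub>2 0 1" by (rule arc_length_affine[OF 2 _ im]) simp
  finally have l: "arc_length \<gamma> 0 2 = arc_length \<gamma>\<^sub>1 0 1 + arc_length \<gamma>\<^sub>2 0 1" .
  from pw_C1_rescale[OF p] obtain \<gamma>' where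
    "pw_C1 \<gamma>' 0 1" "\<gamma>' 0 = \<gamma> 0" "\<gamma>' 1 = \<gamma> 2" "arc_length \<gamma>' 0 1 = arc_length \<gamma> 0 2" by blast
  then show ?thesis using that[of \<gamma>'] l by (simp add: \<gamma>_def)
qed

section \<open>Length estimates inside a chart\<close>

lemma pw_C1_segment:
  assumes c: "c \<in> A" and sub: "closed_segment y z \<subseteq> chart_im c"
  defines "\<gamma> \<equiv> \<lambda>t. chart_inv c (y + t *\<^sub>R (z - y))"
  shows "pw_C1 \<gamma> 0 1" and "\<And>t. 0 < t \<Longrightarrow> t < 1 \<Longrightarrow> speed \<gamma> t = coord_norm c (\<gamma> t) (z - y)"
proof -
  have im: "y + t *\<^sub>R (z - y) \<in> chart_im c" if "t \<in> {0..1}" for t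
    using sub that unfolding closed_segment_def by (auto simp: algebra_simps intro!: exI[of _ t])
  have dom: "\<gamma> t \<in> chart_dom c" "chart_map c (\<gamma> t) = y + t *\<^sub>R (z - y)" if "t \<in> {0..1}" for t
    using im[OF that] c by (auto simp: \<gamma>_def inv_in_dom map_inv)
  have \<gamma>c: "continuous_on {0..1} \<gamma>" unfolding \<gamma>_def
    by (rule continuous_on_compose2[OF cont_inv[OF c]]) (use im in \<open>auto intro!: continuous_intros\<close>)
  have d0: "((chart_map c \<circ> \<gamma>) has_derivative (\<lambda>s. s *\<^sub>R (z - y))) (at t within {0..1})"
    if t: "t \<in> {0..1}" for t
  proof (rule has_derivative_transform[OF t])
    show "((\<lambda>t. y + t *\<^sub>R (z - y)) has_derivative (\<lambda>s. s *\<^sub>R (z - y))) (at t within {0..1})"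
      by (auto intro!: derivative_eq_intros)
  qed (simp add: dom)
  \<comment> \<open>A C1 curve needs a continuous derivative in every chart. In \<open>c'\<close> it
    is the transition differential applied to the constant coordinate velocity
    \<open>z - y\<close>.\<close>
  let ?w = "\<lambda>c' t. transition_deriv c c' (\<gamma> t) (z - y)"
  have C: "C1_curve_on A 0 1 \<gamma>"
  proof (rule C1_curveI[OF _ \<gamma>c])
    fix c' assume c': "c' \<in> A"
    show "((chart_map c' \<circ> \<gamma>) has_vector_derivative ?w c' t) (at t within {0..1})"
      if t: "t \<in> {0..1}" "\<gamma> t \<in> chart_dom c'" for t
    proof -
      have "continuous (at t within {0..1}) \<gamma>"
        using \<gamma>c t(1) by (simp add: continuous_on_eq_continuous_within)
      from change_chart_within[OF c c' dom(1)[OF t(1)] t(2) this t(1) d0[OF t(1)]]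
      show ?thesis
        by (simp add: has_vector_derivative_def linear_cmul[OF trans_linear[OF c c' dom(1)[OF t(1)] t(2)]])
    qed
    let ?T = "{t \<in> {0..1}. \<gamma> t \<in> chart_dom c'}" and ?W = "chart_map c ` (chart_dom c' \<inter> chart_dom c)"
    have "continuous_on ?T (\<lambda>t. frechet_derivative (chart_map c' \<circ> chart_inv c) (at (y + t *\<^sub>R (z - y))) (z - y))"
    proof (rule continuous_on_compose2[OF smooth_on_continuous_deriv[OF trans_smooth[OF c c']]])
      show "(\<lambda>t. y + t *\<^sub>R (z - y)) ` ?T \<subseteq> ?W"
      proof
        fix p assume "p \<in> (\<lambda>t. y + t *\<^sub>R (z - y)) ` ?T"
        then obtain t where t: "t \<in> {0..1}" "\<gamma> t \<in> chart_dom c'" "p = chart_map c (\<gamma> t)"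
          using dom(2) by auto
        then show "p \<in> ?W" using dom(1)[OF t(1)] by blast
      qed
    qed (intro continuous_intros)
    then show "continuous_on ?T (?w c')"
      by (rule continuous_on_eq) (simp add: transition_deriv_def dom(2))
  qed simp
  then show "pw_C1 \<gamma> 0 1" by (intro pw_C1.base) auto
  show "speed \<gamma> t = coord_norm c (\<gamma> t) (z - y)" if t: "0 < t" "t < 1" for t
  proof -
    have t': "t \<in> {0..1}" "at t within {0..1} = at t" using t by (auto simp: at_within_Icc_at)
    have "((chart_map c \<circ> \<gamma>) has_vector_derivative (z - y)) (at t)"
      using d0[OF t'(1)] t'(2) by (simp add: has_vector_derivative_def)
    then have "vel UNIV \<gamma> t c = z - y"
      using c dom(1)[OF t'(1)] by (simp add: vel_def vector_derivative_at)
    then show ?thesis using C1_curve_interior(4)[OF C t c dom(1)[OF t'(1)]] by simp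
  qed
qed

text \<open>The conclusion is the existence of a curve and not a distance bound, so that the same
  lemma shows that any two points can be joined, before the infimum is known to run over a nonempty
  set.\<close>

lemma dist_segment:
  assumes c: "c \<in> A" and sub: "closed_segment y z \<subseteq> chart_im c"
    and K: "\<And>w. w \<in> closed_segment y z \<Longrightarrow> coord_norm c (chart_inv c w) (z - y) \<le> K"
  shows "\<exists>\<gamma>. pw_C1 \<gamma> 0 1 \<and> \<gamma> 0 = chart_inv c y \<and> \<gamma> 1 = chart_inv c z \<and> arc_length \<gamma> 0 1 \<le> K"
proof -
  define \<gamma> where "\<gamma> = (\<lambda>t. chart_inv c (y + t *\<^sub>R (z - y)))"
  note p = pw_C1_segment[OF c sub, folded \<gamma>_def]
  have seg: "y + t *\<^sub>R (z - y) \<in> closed_segment y z" if "t \<in> {0..1}" for t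
    using that unfolding closed_segment_def by (auto simp: algebra_simps intro!: exI[of _ t])
  let ?s = "\<lambda>t. coord_norm c (\<gamma> t) (z - y)"
  have "?s integrable_on {0..1}"
    by (rule integrable_spike_finite[of "{0, 1}", OF _ _ pw_C1_integrable[OF p(1)]])
      (use p(2) in \<open>auto simp: \<gamma>_def\<close>)
  then have "integral {0..1} ?s \<le> integral {0..1::real} (\<lambda>_. K)"
    by (rule integral_le) (use K seg in \<open>auto simp: \<gamma>_def\<close>)
  moreover have "arc_length \<gamma> 0 1 = integral {0..1} ?s"
    unfolding arc_length_def by (rule integral_spike[of "{0, 1}"])
      (use p(2) in \<open>auto simp: \<gamma>_def\<close>)
  ultimately have "arc_length \<gamma> 0 1 \<le> K" by simp
  then show ?thesis using p(1) by (intro exI[of _ \<gamma>]) (auto simp: \<gamma>_def)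
qed


text \<open>Up to the first exit from the ball the curve stays in the chart, its coordinates move by
  at least \<open>s\<close>, and its speed is at least \<mu> times its coordinate speed. This lower
  bound makes the distance positive and compares the topologies.\<close>

lemma arc_length_exit:
  assumes c: "c \<in> A" "x \<in> chart_dom c" and "\<mu> > 0"
    and \<rho>: "ball (chart_map c x) \<rho> \<subseteq> chart_im c"
    and \<mu>: "\<And>y u. y \<in> ball (chart_map c x) \<rho> \<Longrightarrow> \<mu> * norm u \<le> coord_norm c (chart_inv c y) u"
    and s: "0 < s" "s < \<rho>"
    and p: "pw_C1 \<gamma> 0 1" "\<gamma> 0 = x" "\<gamma> 1 \<notin> chart_inv c ` ball (chart_map c x) s"
  shows "\<mu> * s \<le> arc_length \<gamma> 0 1"
proof -
  let ?p = "chart_map c x"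
  have \<gamma>c: "continuous_on {0..1} \<gamma>" using p(1) by (rule pw_C1_continuous)
  have bi: "ball ?p s \<subseteq> chart_im c" "cball ?p s \<subseteq> chart_im c" "cball ?p s \<subseteq> ball ?p \<rho>" using s \<rho> by auto
  define U where "U = chart_inv c ` ball ?p s"
  have "open U"
    using open_inv_image[OF c(1), of "ball ?p s"] bi(1) by (simp add: U_def Int_absorb2)
  define K where "K = chart_inv c ` cball ?p s"
  have "compact K" unfolding K_def
    by (rule compact_continuous_image[OF continuous_on_subset[OF cont_inv[OF c(1)] bi(2)]]) simp
  then have "closed K" by (rule compact_imp_closed)
  \<comment> \<open>\<open>T\<close> is closed because \<open>U\<close> is open, so its infimum is
    attained and is the first exit time.\<close>
  define T where "T = {0..1} \<inter> \<gamma> -` (- U)"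
  have "closed T" unfolding T_def
    by (rule continuous_closed_preimage[OF \<gamma>c]) (use \<open>open U\<close> in auto)
  moreover have "T \<noteq> {}"
  proof -
    have "1 \<in> T" using p(3) by (simp add: T_def U_def)
    then show ?thesis by blast
  qed
  moreover have bT: "bdd_below T" by (auto simp: T_def intro: bdd_belowI[of _ 0])
  ultimately have \<tau>: "Inf T \<in> T" using closed_contains_Inf by blast
  define \<tau> where "\<tau> = Inf T"
  have t01: "\<tau> \<in> {0..1}" "\<gamma> \<tau> \<notin> U" using \<tau> by (auto simp: \<tau>_def T_def)
  have "x \<in> U" using s c by (auto simp: U_def inv_map intro!: image_eqI[of _ _ ?p])
  then have "\<tau> \<noteq> 0" using t01(2) p(2) by metis
  then have \<tau>0: "0 < \<tau>" "\<tau> \<le> 1" using t01(1) by auto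
  have before: "\<gamma> t \<in> U" if "t \<in> {0..<\<tau>}" for t
  proof (rule ccontr)
    assume "\<gamma> t \<notin> U"
    then have "t \<in> T" using that \<tau>0 by (auto simp: T_def)
    then show False using cInf_lower[OF _ bT] that by (fastforce simp: \<tau>_def)
  qed
  have "U \<subseteq> K" by (auto simp: U_def K_def)
  \<comment> \<open>At the exit time the curve has left the open ball but is still in the image of
    the closed ball, so its coordinates there are available for the displacement.\<close>
  have inK: "\<gamma> t \<in> K" if "t \<in> {0..\<tau>}" for t
  proof -
    have "closure {0..<\<tau>} \<subseteq> {0..\<tau>} \<inter> \<gamma> -` K"
    proof (rule closure_minimal)
      show "{0..<\<tau>} \<subseteq> {0..\<tau>} \<inter> \<gamma> -` K" by (auto intro!: subsetD[OF \<open>U \<subseteq> K\<close>] before)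
      show "closed ({0..\<tau>} \<inter> \<gamma> -` K)"
        by (rule continuous_closed_preimage) (use \<open>closed K\<close> \<tau>0 in \<open>auto intro: continuous_on_subset[OF \<gamma>c]\<close>)
    qed
    then show ?thesis using that \<tau>0 by auto
  qed
  have K: "K \<subseteq> chart_dom c" using bi(2) c by (auto simp: K_def inv_in_dom)
  have Kball: "chart_map c q \<in> cball ?p s \<and> chart_inv c (chart_map c q) = q" if "q \<in> K" for q
    using that bi(2) c by (auto simp: K_def map_inv)
  let ?f = "chart_map c \<circ> \<gamma>"
  have "chart_map c (\<gamma> \<tau>) \<notin> ball ?p s"
    using t01(2) Kball[OF inK[of \<tau>]] \<tau>0 unfolding U_def by (metis atLeastAtMost_iff image_eqI less_imp_le order_refl)
  then have "s \<le> norm (?f \<tau> - ?f 0)" using p(2) by (simp add: dist_norm norm_minus_commute)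
  obtain S where S: "finite S" "\<And>t. t \<in> {0..1} - S \<Longrightarrow> \<exists>a' b'. a' < t \<and> t < b' \<and> C1_curve_on A a' b' \<gamma>"
    using pw_C1_regular[OF p(1)] by blast
  \<comment> \<open>The value 0 at exceptional times and outside the open interval makes the bound
    of \<open>norm (w t)\<close> by \<open>speed \<gamma> t / \<mu>\<close> valid for every
    \<open>t\<close>.\<close>
  define w where "w t = (if t \<in> {0<..<\<tau>} - S then vel UNIV \<gamma> t c else 0)" for t
  have reg: "(?f has_vector_derivative vel UNIV \<gamma> t c) (at t) \<and> \<mu> * norm (vel UNIV \<gamma> t c) \<le> speed \<gamma> t"
    if t: "t \<in> {0<..<\<tau>} - S" for t
  proof -
    obtain a b where ab: "a < t" "t < b" "C1_curve_on A a b \<gamma>" using S(2)[of t] t \<tau>0 by auto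
    have tK: "\<gamma> t \<in> K" using inK t by auto
    then have td: "\<gamma> t \<in> chart_dom c" using K by auto
    have "chart_map c (\<gamma> t) \<in> ball ?p \<rho>" using Kball[OF tK] bi(3) by blast
    from \<mu>[OF this] have "\<mu> * norm (vel UNIV \<gamma> t c) \<le> coord_norm c (\<gamma> t) (vel UNIV \<gamma> t c)"
      using Kball[OF tK] by simp
    then show ?thesis
      using C1_curve_interior(3,4)[OF ab(3,1,2) c(1) td] by simp
  qed
  have "(w has_integral (?f \<tau> - ?f 0)) {0..\<tau>}"
  proof (rule fundamental_theorem_of_calculus_interior_strong[OF S(1)])
    show "(?f has_vector_derivative w t) (at t)" if "t \<in> {0<..<\<tau>} - S" for t
      using reg[OF that] that by (simp add: w_def)
    show "continuous_on {0..\<tau>} ?f"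
      by (rule continuous_on_compose[OF continuous_on_subset[OF \<gamma>c] continuous_on_subset[OF cont_map[OF c(1)]]])
        (use inK K \<tau>0 in auto)
  qed (use \<tau>0 in simp)
  then have iw: "w integrable_on {0..\<tau>}" "integral {0..\<tau>} w = ?f \<tau> - ?f 0" by auto
  have si: "speed \<gamma> integrable_on {0..\<tau>}"
    by (rule pw_C1_integrable[OF pw_C1_restrict[OF p(1)]]) (use \<tau>0 in auto)
  have ms: "(\<lambda>t. speed \<gamma> t / \<mu>) integrable_on {0..\<tau>}"
    using integrable_on_divide[OF si] .
  have "norm (integral {0..\<tau>} w) \<le> integral {0..\<tau>} (\<lambda>t. speed \<gamma> t / \<mu>)"
  proof (rule Henstock_Kurzweil_Integration.integral_norm_bound_integral[OF iw(1) ms])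
    show "norm (w t) \<le> speed \<gamma> t / \<mu>" for t
      using reg[of t] \<open>\<mu> > 0\<close> by (auto simp: w_def field_simps speed_def)
  qed
  also have "\<dots> = arc_length \<gamma> 0 \<tau> / \<mu>" by (simp add: arc_length_def)
  also have "arc_length \<gamma> 0 \<tau> \<le> arc_length \<gamma> 0 1"
    using arc_length_split[OF p(1), of \<tau>] arc_length_nonneg[of \<gamma> \<tau> 1] \<tau>0 by simp
  finally have "s \<le> arc_length \<gamma> 0 1 / \<mu>"
    using \<open>s \<le> norm _\<close> iw(2) \<open>\<mu> > 0\<close> by (simp add: divide_right_mono)
  then show ?thesis using \<open>\<mu> > 0\<close> by (simp add: field_simps)
qed

end

section \<open>The Riemannian distance as a metric for the manifold topology\<close>

locale connected_riem_mfd = riem_mfd +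
  assumes conn: "connected (UNIV :: 'a set)"
begin

abbreviation d :: "'a \<Rightarrow> 'a \<Rightarrow> real" where
  "d \<equiv> riemannian_dist A g"

definition reach :: "'a \<Rightarrow> 'a \<Rightarrow> bool" where
  "reach x y \<longleftrightarrow> (\<exists>\<gamma>. pw_C1 \<gamma> 0 1 \<and> \<gamma> 0 = x \<and> \<gamma> 1 = y)"

lemma local_chart:
  obtains c \<rho> \<mu> \<Lambda> where "c \<in> A" "x \<in> chart_dom c" "\<rho> > 0" "\<mu> > 0" "\<Lambda> > 0"
    "ball (chart_map c x) \<rho> \<subseteq> chart_im c"
    "\<And>y u. y \<in> ball (chart_map c x) \<rho> \<Longrightarrow> \<mu> * norm u \<le> coord_norm c (chart_inv c y) u"
    "\<And>y u. y \<in> ball (chart_map c x) \<rho> \<Longrightarrow> coord_norm c (chart_inv c y) u \<le> \<Lambda> * norm u"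
proof -
  obtain c where c: "c \<in> A" "x \<in> chart_dom c" by (rule ex_chart)
  obtain \<rho> where \<rho>: "\<rho> > 0" "ball (chart_map c x) \<rho> \<subseteq> chart_im c"
    "\<And>y u. y \<in> ball (chart_map c x) \<rho> \<Longrightarrow> coord_norm c (chart_inv c y) u \<le> 2 * coord_norm c x u"
    "\<And>y u. y \<in> ball (chart_map c x) \<rho> \<Longrightarrow> coord_norm c x u \<le> 2 * coord_norm c (chart_inv c y) u"
    using coord_norm_local[OF c, of 2] by (metis one_less_numeral_iff semiring_norm(76))
  obtain \<mu> where \<mu>: "\<mu> > 0" "\<And>u. \<mu> * norm u \<le> coord_norm c x u" using coord_norm_lower[OF c] by blast
  obtain \<Lambda> where \<Lambda>: "\<Lambda> > 0" "\<And>u. coord_norm c x u \<le> \<Lambda> * norm u" using coord_norm_upper[OF c] by blast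
  show ?thesis
  proof (rule that[OF c \<rho>(1) _ _ \<rho>(2)])
    show "\<mu> / 2 > 0" "2 * \<Lambda> > 0" using \<mu> \<Lambda> by auto
    fix y u assume y: "y \<in> ball (chart_map c x) \<rho>"
    show "\<mu> / 2 * norm u \<le> coord_norm c (chart_inv c y) u" using \<rho>(4)[OF y, of u] \<mu>(2)[of u] by simp
    show "coord_norm c (chart_inv c y) u \<le> 2 * \<Lambda> * norm u" using \<rho>(3)[OF y, of u] \<Lambda>(2)[of u] by simp
  qed
qed

lemma chart_ball_open:
  assumes "c \<in> A" "ball p s \<subseteq> chart_im c"
  shows "open (chart_inv c ` ball p s)"
  using open_inv_image[OF assms(1), of "ball p s"] assms(2) by (simp add: Int_absorb2)

lemma short_segment:
  assumes c: "c \<in> A" and b: "ball p \<rho> \<subseteq> chart_im c"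
    and \<Lambda>: "\<And>y u. y \<in> ball p \<rho> \<Longrightarrow> coord_norm c (chart_inv c y) u \<le> N u"
    and y: "y \<in> ball p \<rho>" and z: "z \<in> ball p \<rho>"
  shows "\<exists>\<gamma>. pw_C1 \<gamma> 0 1 \<and> \<gamma> 0 = chart_inv c y \<and> \<gamma> 1 = chart_inv c z \<and> arc_length \<gamma> 0 1 \<le> N (z - y)"
proof (rule dist_segment[OF c])
  have s: "closed_segment y z \<subseteq> ball p \<rho>" by (intro closed_segment_subset y z) simp
  then show "closed_segment y z \<subseteq> chart_im c" using b by auto
  show "coord_norm c (chart_inv c w) (z - y) \<le> N (z - y)" if "w \<in> closed_segment y z" for w
    using \<Lambda> s that by blast
qed

text \<open>Joinability is an equivalence relation whose classes contain chart balls around each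
  point, so connectedness leaves one class. Hence the infimum in the distance runs over a nonempty
  set and can be approached by curves.\<close>

lemma reach_all: "reach x y"
proof (rule connected_equivalence_relation[OF conn])
  fix x y z
  show "reach y x" if "reach x y"
    using that unfolding reach_def by (metis pw_C1_reverse)
  show "reach x z" if "reach x y" "reach y z"
    using that unfolding reach_def by (metis pw_C1_concat)
  obtain c \<rho> \<mu> \<Lambda> where c: "c \<in> A" "x \<in> chart_dom c" "\<rho> > 0" "\<mu> > 0" "\<Lambda> > 0"
    "ball (chart_map c x) \<rho> \<subseteq> chart_im c"
    "\<And>y u. y \<in> ball (chart_map c x) \<rho> \<Longrightarrow> \<mu> * norm u \<le> coord_norm c (chart_inv c y) u"
    "\<And>y u. y \<in> ball (chart_map c x) \<rho> \<Longrightarrow> coord_norm c (chart_inv c y) u \<le> \<Lambda> * norm u"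
    using local_chart[of x] by blast
  let ?U = "chart_inv c ` ball (chart_map c x) \<rho>"
  have "open ?U" using chart_ball_open c by blast
  moreover have "x \<in> ?U" using c by (auto simp: inv_map intro!: image_eqI[of _ _ "chart_map c x"])
  moreover have "reach x z" if z: "z \<in> ?U" for z
  proof -
    obtain w where w: "w \<in> ball (chart_map c x) \<rho>" "z = chart_inv c w" using z by auto
    show ?thesis
      using short_segment[OF c(1,6,8) _ w(1), of "chart_map c x"] c w(2)
      unfolding reach_def by (auto simp: inv_map)
  qed
  ultimately show "\<exists>T. openin (top_of_set UNIV) T \<and> x \<in> T \<and> (\<forall>z\<in>T. reach x z)"
    by (intro exI[of _ ?U]) simp
qed auto

lemma dist_less_curve:
  assumes "d x y < l"
  obtains \<gamma> where "pw_C1 \<gamma> 0 1" "\<gamma> 0 = x" "\<gamma> 1 = y" "arc_length \<gamma> 0 1 < l"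
proof -
  let ?L = "{arc_length \<gamma> 0 1 |\<gamma>. pw_C1 \<gamma> 0 1 \<and> \<gamma> 0 = x \<and> \<gamma> 1 = y}"
  have "?L \<noteq> {}" using reach_all[of x y] unfolding reach_def by blast
  moreover have "Inf ?L < l" using assms by (simp add: dist_eq_Inf)
  ultimately show ?thesis using cInf_lessD[of ?L l] that by blast
qed

lemma dist_geI:
  assumes "\<And>\<gamma>. pw_C1 \<gamma> 0 1 \<Longrightarrow> \<gamma> 0 = x \<Longrightarrow> \<gamma> 1 = y \<Longrightarrow> l \<le> arc_length \<gamma> 0 1"
  shows "l \<le> d x y"
  using assms dist_less_curve[of x y l] by (metis not_le)

lemma dist_nonneg: "d x y \<ge> 0"
  by (rule dist_geI) (rule arc_length_nonneg)

lemma dist_sym: "d x y = d y x"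
proof -
  have "d x y \<le> d y x" for x y
    by (rule dist_geI) (metis pw_C1_reverse dist_le_arc_length)
  then show ?thesis by (metis antisym)
qed

lemma dist_triangle: "d x z \<le> d x y + d y z"
proof (rule field_le_epsilon)
  fix e :: real assume "e > 0"
  obtain \<gamma>\<^sub>1 where 1: "pw_C1 \<gamma>\<^sub>1 0 1" "\<gamma>\<^sub>1 0 = x" "\<gamma>\<^sub>1 1 = y" "arc_length \<gamma>\<^sub>1 0 1 < d x y + e / 2"
    by (rule dist_less_curve[of x y "d x y + e / 2"]) (use \<open>e > 0\<close> in auto)
  obtain \<gamma>\<^sub>2 where 2: "pw_C1 \<gamma>\<^sub>2 0 1" "\<gamma>\<^sub>2 0 = y" "\<gamma>\<^sub>2 1 = z" "arc_length \<gamma>\<^sub>2 0 1 < d y z + e / 2"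
    by (rule dist_less_curve[of y z "d y z + e / 2"]) (use \<open>e > 0\<close> in auto)
  obtain \<gamma> where "pw_C1 \<gamma> 0 1" "\<gamma> 0 = x" "\<gamma> 1 = z" "arc_length \<gamma> 0 1 = arc_length \<gamma>\<^sub>1 0 1 + arc_length \<gamma>\<^sub>2 0 1"
    by (rule pw_C1_concat[OF 1(1) 2(1)]) (use 1 2 in auto)
  then show "d x z \<le> d x y + d y z + e" using dist_le_arc_length[of \<gamma> 0 1] 1 2 by simp
qed

lemma dist_chart_segment:
  assumes "c \<in> A" "ball p \<rho> \<subseteq> chart_im c"
    and "\<And>y u. y \<in> ball p \<rho> \<Longrightarrow> coord_norm c (chart_inv c y) u \<le> N u"
    and "y \<in> ball p \<rho>" "z \<in> ball p \<rho>"
  shows "d (chart_inv c y) (chart_inv c z) \<le> N (z - y)"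
  using short_segment[OF assms] dist_le_arc_length by (metis order_trans)

lemma dist_exit:
  assumes "c \<in> A" "x \<in> chart_dom c" "\<mu> > 0" "ball (chart_map c x) \<rho> \<subseteq> chart_im c"
    and "\<And>y u. y \<in> ball (chart_map c x) \<rho> \<Longrightarrow> \<mu> * norm u \<le> coord_norm c (chart_inv c y) u"
    and "0 < s" "s < \<rho>" "y \<notin> chart_inv c ` ball (chart_map c x) s"
  shows "\<mu> * s \<le> d x y"
  by (rule dist_geI) (use arc_length_exit[OF assms(1-7)] assms(8) in blast)

text \<open>Taken with the complement of a point this separates points; with a general open set it
  gives one comparison of topologies; with the whole space it gives local compactness for
  Hopf-Rinow.\<close>

lemma dist_ball_in_open:
  assumes "open U" "x \<in> U"
  obtains r K where "r > 0" "compact K" "K \<subseteq> U" "\<And>y. d x y < r \<Longrightarrow> y \<in> K"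
proof -
  obtain c \<rho> \<mu> \<Lambda> where c: "c \<in> A" "x \<in> chart_dom c" "\<rho> > 0" "\<mu> > 0" "\<Lambda> > 0"
    "ball (chart_map c x) \<rho> \<subseteq> chart_im c"
    "\<And>y u. y \<in> ball (chart_map c x) \<rho> \<Longrightarrow> \<mu> * norm u \<le> coord_norm c (chart_inv c y) u"
    "\<And>y u. y \<in> ball (chart_map c x) \<rho> \<Longrightarrow> coord_norm c (chart_inv c y) u \<le> \<Lambda> * norm u"
    using local_chart[of x] by blast
  let ?p = "chart_map c x"
  have "open (chart_map c ` (U \<inter> chart_dom c))" "?p \<in> chart_map c ` (U \<inter> chart_dom c)"
    using c assms open_map_image by auto
  then obtain e where e: "e > 0" "ball ?p e \<subseteq> chart_map c ` (U \<inter> chart_dom c)"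
    using open_contains_ball by blast
  define s where "s = min \<rho> e / 2"
  have s: "0 < s" "s < \<rho>" "s < e" using c e by (auto simp: s_def)
  have "cball ?p s \<subseteq> ball ?p \<rho>" using s by auto
  then have sub: "cball ?p s \<subseteq> chart_im c" using c(6) by (rule order_trans)
  show ?thesis
  proof (rule that[of "\<mu> * s" "chart_inv c ` cball ?p s"])
    show "\<mu> * s > 0" using c s by simp
    show "compact (chart_inv c ` cball ?p s)"
      by (rule compact_continuous_image[OF continuous_on_subset[OF cont_inv[OF c(1)] sub]]) simp
    have "cball ?p s \<subseteq> ball ?p e" using s by auto
    then have "cball ?p s \<subseteq> chart_map c ` (U \<inter> chart_dom c)" using e(2) by (rule order_trans)
    then show "chart_inv c ` cball ?p s \<subseteq> U" using c(1) by (auto simp: map_image_eq)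
    show "y \<in> chart_inv c ` cball ?p s" if "d x y < \<mu> * s" for y
    proof -
      have "y \<in> chart_inv c ` ball ?p s"
      proof (rule ccontr)
        assume "y \<notin> chart_inv c ` ball ?p s"
        from dist_exit[OF c(1,2,4,6,7) s(1,2) this] that show False by simp
      qed
      then show ?thesis by auto
    qed
  qed
qed

sublocale MS: Metric_space UNIV d
proof
  have refl: "d x x = 0" for x
  proof -
    obtain c \<rho> \<mu> \<Lambda> where c: "c \<in> A" "x \<in> chart_dom c" "\<rho> > 0" "\<mu> > 0" "\<Lambda> > 0"
    "ball (chart_map c x) \<rho> \<subseteq> chart_im c"
    "\<And>y u. y \<in> ball (chart_map c x) \<rho> \<Longrightarrow> \<mu> * norm u \<le> coord_norm c (chart_inv c y) u"
    "\<And>y u. y \<in> ball (chart_map c x) \<rho> \<Longrightarrow> coord_norm c (chart_inv c y) u \<le> \<Lambda> * norm u"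
    using local_chart[of x] by blast
    have "d x x \<le> 0"
      using dist_chart_segment[OF c(1,6,8), of "chart_map c x" "chart_map c x"] c by (simp add: inv_map)
    then show ?thesis using dist_nonneg[of x x] by simp
  qed
  show "(d x y = 0) = (x = y)" for x y
  proof
    assume 0: "d x y = 0"
    show "x = y"
    proof (rule ccontr)
      assume "x \<noteq> y"
      then obtain r K where "r > 0" "K \<subseteq> - {y}" "\<And>z. d x z < r \<Longrightarrow> z \<in> K"
        using dist_ball_in_open[of "- {y}" x] by (metis ComplI open_Compl closed_singleton singletonD)
      then show False using 0 by auto
    qed
  qed (simp add: refl)
qed (auto simp: dist_nonneg dist_sym dist_triangle)

text \<open>Completeness and Hopf-Rinow speak about the metric topology, the containment function
  about the given one. Exit estimates give one inclusion, coordinate segments the other.\<close>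

lemma mtopology_eq: "MS.mtopology = (euclidean :: 'a topology)"
proof -
  have "openin MS.mtopology U \<longleftrightarrow> open U" for U
  proof
    assume U: "openin MS.mtopology U"
    show "open U"
    proof (subst open_subopen, intro ballI)
      fix x assume "x \<in> U"
      then obtain r where r: "r > 0" "MS.mball x r \<subseteq> U" using U by (auto simp: MS.openin_mtopology)
      obtain c \<rho> \<mu> \<Lambda> where c: "c \<in> A" "x \<in> chart_dom c" "\<rho> > 0" "\<mu> > 0" "\<Lambda> > 0"
    "ball (chart_map c x) \<rho> \<subseteq> chart_im c"
    "\<And>y u. y \<in> ball (chart_map c x) \<rho> \<Longrightarrow> \<mu> * norm u \<le> coord_norm c (chart_inv c y) u"
    "\<And>y u. y \<in> ball (chart_map c x) \<rho> \<Longrightarrow> coord_norm c (chart_inv c y) u \<le> \<Lambda> * norm u"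
    using local_chart[of x] by blast
      let ?p = "chart_map c x"
      \<comment> \<open>A coordinate ball of radius \<open>r / \<Lambda>\<close> lies within
        distance \<open>r\<close>, provided that it fits into the chart ball.\<close>
      define s where "s = min \<rho> (r / \<Lambda>)"
      have s: "s > 0" "ball ?p s \<subseteq> ball ?p \<rho>" using c r by (auto simp: s_def)
      show "\<exists>T. open T \<and> x \<in> T \<and> T \<subseteq> U"
      proof (intro exI conjI)
        show "open (chart_inv c ` ball ?p s)" using chart_ball_open[OF c(1)] s c by blast
        show "x \<in> chart_inv c ` ball ?p s"
          using c s by (auto simp: inv_map intro!: image_eqI[of _ _ ?p])
        show "chart_inv c ` ball ?p s \<subseteq> U"
        proof
          fix y assume "y \<in> chart_inv c ` ball ?p s"
          then obtain z where z: "z \<in> ball ?p s" "y = chart_inv c z" by auto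
          have "d (chart_inv c ?p) (chart_inv c z) \<le> \<Lambda> * norm (z - ?p)"
            by (rule dist_chart_segment[OF c(1,6,8)]) (use z s c in auto)
          also have "\<dots> < r" using z c(5)
            by (simp add: s_def dist_norm norm_minus_commute field_simps)
          finally show "y \<in> U" using r(2) z(2) inv_map[OF c(1,2)] by auto
        qed
      qed
    qed
  next
    assume U: "open U"
    have "\<exists>r>0. MS.mball x r \<subseteq> U" if x: "x \<in> U" for x
    proof -
      obtain r K where "r > 0" "K \<subseteq> U" "\<And>y. d x y < r \<Longrightarrow> y \<in> K"
        using dist_ball_in_open[OF U x] by metis
      then show ?thesis by (intro exI[of _ r]) auto
    qed
    then show "openin MS.mtopology U" by (simp add: MS.openin_mtopology)
  qed
  then show ?thesis by (simp add: topology_eq)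
qed

lemma dist_continuous: "continuous_on UNIV (\<lambda>y. d x y)"
proof (rule continuous_at_imp_continuous_on, intro ballI)
  fix y
  have "\<forall>\<^sub>F z in at y. dist (d x z) (d x y) < e" if "e > 0" for e
  proof -
    have "openin MS.mtopology (MS.mball y e)" by (rule MS.openin_mball)
    then have "open (MS.mball y e)" by (simp add: mtopology_eq)
    moreover have "y \<in> MS.mball y e" using that by simp
    moreover have "dist (d x z) (d x y) < e" if "z \<in> MS.mball y e" for z
      using that dist_triangle[of x z y] dist_triangle[of x y z] dist_sym[of y z]
      by (simp add: dist_real_def abs_less_iff)
    ultimately show ?thesis unfolding eventually_at_topological by blast
  qed
  then show "isCont (\<lambda>z. d x z) y" unfolding isCont_def by (rule tendstoI)
qed

text \<open>The length space property in approximate form: along a curve shorter than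
  \<open>s + e\<close>, a point at distance \<open>s\<close> from \<open>x\<close> has already used
  up length \<open>s\<close>, which leaves less than \<open>e\<close>.\<close>

lemma intermediate_point:
  assumes "d x y < s + e" "0 \<le> s" "e > 0"
  obtains z where "d x z \<le> s" "d z y < e"
proof (cases "d x y \<le> s")
  case True
  then show ?thesis using that[of y] assms(3) by simp
next
  case False
  obtain \<gamma> where \<gamma>: "pw_C1 \<gamma> 0 1" "\<gamma> 0 = x" "\<gamma> 1 = y" "arc_length \<gamma> 0 1 < s + e"
    using dist_less_curve[OF assms(1)] by blast
  have "continuous_on {0..1} (\<lambda>t. d x (\<gamma> t))"
    by (rule continuous_on_compose2[OF dist_continuous pw_C1_continuous[OF \<gamma>(1)]]) simp
  then obtain t where t: "0 \<le> t" "t \<le> 1" "d x (\<gamma> t) = s"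
    using IVT'[of "\<lambda>t. d x (\<gamma> t)" 0 s 1] \<gamma>(2,3) False assms(2) by auto
  have "t < 1" using t False \<gamma>(3) by (cases "t = 1") auto
  have "d x (\<gamma> t) \<le> arc_length \<gamma> 0 t"
  proof (cases "t = 0")
    case False
    then show ?thesis using dist_le_arc_length[OF pw_C1_restrict[OF \<gamma>(1), of 0 t]] t \<gamma>(2) by simp
  qed (use \<gamma>(2) arc_length_nonneg in simp)
  moreover have "d (\<gamma> t) y \<le> arc_length \<gamma> t 1"
    using dist_le_arc_length[OF pw_C1_restrict[OF \<gamma>(1), of t 1]] t \<open>t < 1\<close> \<gamma>(3) by simp
  moreover have "arc_length \<gamma> 0 1 = arc_length \<gamma> 0 t + arc_length \<gamma> t 1" using arc_length_split[OF \<gamma>(1)] t by simp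
  ultimately show ?thesis using that[of "\<gamma> t"] t \<gamma>(4) by simp
qed

end


section \<open>Hopf-Rinow for length metrics\<close>

context Metric_space
begin

text \<open>The definition asks for centres in the set itself; arbitrary centres suffice.\<close>

lemma mtotally_boundedI:
  assumes "S \<subseteq> M"
    and cover: "\<And>\<epsilon>. \<epsilon> > 0 \<Longrightarrow> \<exists>F. finite F \<and> F \<subseteq> M \<and> S \<subseteq> (\<Union>p\<in>F. mball p \<epsilon>)"
  shows "mtotally_bounded S"
  unfolding mtotally_bounded_def
proof (intro allI impI)
  fix \<epsilon> :: real assume "\<epsilon> > 0"
  then obtain F where F: "finite F" "F \<subseteq> M" "S \<subseteq> (\<Union>p\<in>F. mball p (\<epsilon> / 2))"
    using cover[of "\<epsilon> / 2"] by auto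
  define F' where "F' = {p \<in> F. mball p (\<epsilon> / 2) \<inter> S \<noteq> {}}"
  have "\<forall>p\<in>F'. \<exists>q. q \<in> mball p (\<epsilon> / 2) \<inter> S" by (auto simp: F'_def)
  then obtain h where h: "\<And>p. p \<in> F' \<Longrightarrow> h p \<in> mball p (\<epsilon> / 2) \<inter> S" by metis
  have "y \<in> (\<Union>q\<in>h ` F'. mball q \<epsilon>)" if y: "y \<in> S" for y
  proof -
    obtain p where p: "p \<in> F" "y \<in> mball p (\<epsilon> / 2)" using F(3) y by blast
    then have p': "p \<in> F'" using y by (auto simp: F'_def)
    then have "d (h p) y < \<epsilon>"
      using h[OF p'] p(2) triangle[of "h p" p y] commute[of p "h p"] by auto
    then show ?thesis using p' h[OF p'] p(2) by auto
  qed
  moreover have "finite (h ` F')" using F(1) by (simp add: F'_def)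
  moreover have "h ` F' \<subseteq> S" using h by blast
  ultimately show "\<exists>K. finite K \<and> K \<subseteq> S \<and> S \<subseteq> (\<Union>x\<in>K. mball x \<epsilon>)" by blast
qed

text \<open>Hopf-Rinow for complete, locally compact length spaces, by continuation in the radius.
  The radii with totally bounded balls form an interval; if it were bounded, its supremum would
  belong to it and could still be increased. Completeness turns totally bounded closed balls into
  compact ones, and the hypothesis \<open>arc_length\<close> supplies intermediate points.\<close>

lemma compactin_mcball_length_space:
  assumes complete: mcomplete
    and loc: "\<And>p. p \<in> M \<Longrightarrow> \<exists>r>0. \<exists>K. compactin mtopology K \<and> mball p r \<subseteq> K"
    and arc_length: "\<And>y s e. \<lbrakk>y \<in> M; d x y < s + e; 0 \<le> s; e > 0\<rbrakk> \<Longrightarrow> \<exists>z\<in>M. d x z \<le> s \<and> d z y < e"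
    and x: "x \<in> M"
  shows "compactin mtopology (mcball x R)"
proof -
  define T where "T = {R. 0 \<le> R \<and> mtotally_bounded (mcball x R)}"
  have cpt: "compactin mtopology (mcball x R)" if "mtotally_bounded (mcball x R)" for R
    using that mtotally_bounded_eq_compact_closure_of[OF complete, of "mcball x R"]
    by (simp add: closure_of_closedin closedin_mcball)
  have mono: "s \<in> T" if "r \<in> T" "0 \<le> s" "s \<le> r" for r s
    using that mtotally_bounded_subset[OF _ mcball_subset_concentric[of s r x]] by (auto simp: T_def)
  have "mcball x 0 = {x}" using x by (auto simp: in_mcball) (metis antisym nonneg zero)
  then have T0: "0 \<in> T" using x by (simp add: T_def)
  have "R \<in> T" if "R \<ge> 0" for R
  proof (rule ccontr)
    assume R: "R \<notin> T"
    have bdd: "bdd_above T" using mono R \<open>R \<ge> 0\<close> by (intro bdd_aboveI[of _ R]) (metis linear)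
    define R\<^sub>0 where "R\<^sub>0 = Sup T"
    have R0: "R\<^sub>0 \<ge> 0" using cSup_upper[OF T0 bdd] by (simp add: R\<^sub>0_def)
    have "mtotally_bounded (mcball x R\<^sub>0)"
    proof (rule mtotally_boundedI)
      fix \<epsilon> :: real assume \<epsilon>: "\<epsilon> > 0"
      \<comment> \<open>Every point of the ball of radius \<open>R\<^sub>0\<close> is within
        \<open>\<epsilon> / 2\<close> of the ball of radius \<open>s\<close>, so a finite
        \<open>\<epsilon> / 2\<close>-net of the latter is an \<epsilon>-net of the former.\<close>
      have "\<exists>s\<in>T. R\<^sub>0 - \<epsilon> / 2 < s"
        by (rule less_cSupD) (use T0 \<epsilon> in \<open>auto simp: R\<^sub>0_def\<close>)
      then obtain s where s: "s \<in> T" "R\<^sub>0 - \<epsilon> / 2 < s" by blast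
      then have "mtotally_bounded (mcball x s)" "0 \<le> s" by (auto simp: T_def)
      then obtain F where F: "finite F" "F \<subseteq> M" "mcball x s \<subseteq> (\<Union>p\<in>F. mball p (\<epsilon> / 2))"
        using \<epsilon> unfolding mtotally_bounded_def by (metis half_gt_zero mcball_subset_mspace order_trans)
      have "y \<in> (\<Union>p\<in>F. mball p \<epsilon>)" if y: "y \<in> mcball x R\<^sub>0" for y
      proof -
        have yM: "y \<in> M" "d x y < s + \<epsilon> / 2" using y s by auto
        then obtain z where z: "z \<in> M" "d x z \<le> s" "d z y < \<epsilon> / 2"
          using arc_length[of y s "\<epsilon> / 2"] \<epsilon> \<open>0 \<le> s\<close> by auto
        then have "z \<in> mcball x s" using x by simp
        then obtain p where p: "p \<in> F" "z \<in> mball p (\<epsilon> / 2)" using F(3) by blast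
        then have pz: "p \<in> M" "d p z < \<epsilon> / 2" by auto
        have "d p y < \<epsilon>" using triangle[OF pz(1) z(1) yM(1)] pz z by linarith
        then show ?thesis using p(1) pz(1) yM(1) by auto
      qed
      then show "\<exists>F. finite F \<and> F \<subseteq> M \<and> mcball x R\<^sub>0 \<subseteq> (\<Union>p\<in>F. mball p \<epsilon>)"
        using F by blast
    qed auto
    then have K: "compactin mtopology (mcball x R\<^sub>0)" by (rule cpt)
    obtain r where r: "\<And>p. p \<in> M \<Longrightarrow> r p > 0 \<and> (\<exists>K. compactin mtopology K \<and> mball p (r p) \<subseteq> K)"
      using loc by metis
    \<comment> \<open>Halved radii leave room: a point within \<open>r p / 2\<close> of a member of
      \<open>?B p\<close> is still in the full ball around \<open>p\<close>. The minimum \<delta>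
      works for all selected \<open>p\<close> simultaneously.\<close>
    let ?B = "\<lambda>p. mball p (r p / 2)"
    have "y \<in> ?B y" if "y \<in> mcball x R\<^sub>0" for y
      using that r[of y] by simp
    then have "mcball x R\<^sub>0 \<subseteq> \<Union> (?B ` mcball x R\<^sub>0)" by blast
    moreover have "\<forall>U \<in> ?B ` mcball x R\<^sub>0. openin mtopology U" by auto
    ultimately obtain \<F> where \<F>: "finite \<F>" "\<F> \<subseteq> ?B ` mcball x R\<^sub>0" "mcball x R\<^sub>0 \<subseteq> \<Union> \<F>"
      using K unfolding compactin_def by meson
    from finite_subset_image[OF \<F>(1,2)] obtain F where
      "F \<subseteq> mcball x R\<^sub>0" "finite F" "\<F> = ?B ` F" by blast
    with \<F>(3) have F: "F \<subseteq> mcball x R\<^sub>0" "finite F" "mcball x R\<^sub>0 \<subseteq> (\<Union>p\<in>F. ?B p)"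
      by simp_all
    have "x \<in> mcball x R\<^sub>0" using x R0 by simp
    then have "F \<noteq> {}" using F(3) by blast
    have FM: "p \<in> M" if "p \<in> F" for p using F(1) that by auto
    define \<delta> where "\<delta> = Min ((\<lambda>p. r p / 2) ` F)"
    have \<delta>: "\<delta> > 0" using F(2) \<open>F \<noteq> {}\<close> r FM by (simp add: \<delta>_def)
    \<comment> \<open>Only half of \<delta> is added, so that the strict inequality required for an
      intermediate point at radius \<open>R\<^sub>0\<close> holds.\<close>
    have "mcball x (R\<^sub>0 + \<delta> / 2) \<subseteq> (\<Union>p\<in>F. mball p (r p))"
    proof
      fix y assume "y \<in> mcball x (R\<^sub>0 + \<delta> / 2)"
      then have y: "y \<in> M" "d x y < R\<^sub>0 + \<delta>" using \<delta> by auto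
      then obtain z where z: "z \<in> M" "d x z \<le> R\<^sub>0" "d z y < \<delta>" using arc_length[OF y(1,2) R0 \<delta>] by blast
      then have "z \<in> mcball x R\<^sub>0" using x by simp
      then obtain p where p: "p \<in> F" "z \<in> ?B p" using F(3) by blast
      have "\<delta> \<le> r p / 2" unfolding \<delta>_def by (rule Min_le) (use F(2) p(1) in auto)
      moreover have pz: "p \<in> M" "d p z < r p / 2" using p by auto
      ultimately have "d p y < r p" using triangle[OF pz(1) z(1) y(1)] z by linarith
      then show "y \<in> (\<Union>p\<in>F. mball p (r p))" using p(1) pz(1) y(1) by auto
    qed
    moreover have "mtotally_bounded (\<Union>p\<in>F. mball p (r p))"
    proof (rule mtotally_bounded_Union)
      show "finite ((\<lambda>p. mball p (r p)) ` F)" using F(2) by simp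
      show "mtotally_bounded S" if S: "S \<in> (\<lambda>p. mball p (r p)) ` F" for S
      proof -
        obtain p where p: "p \<in> F" "S = mball p (r p)" using S by blast
        then obtain K where "compactin mtopology K" "mball p (r p) \<subseteq> K" using r[OF FM] by blast
        then show ?thesis
          using compactin_imp_mtotally_bounded mtotally_bounded_subset p(2) by metis
      qed
    qed
    ultimately have "mtotally_bounded (mcball x (R\<^sub>0 + \<delta> / 2))" by (rule mtotally_bounded_subset[rotated])
    then have "R\<^sub>0 + \<delta> / 2 \<in> T" using R0 \<delta> by (simp add: T_def)
    from cSup_upper[OF this bdd] have "R\<^sub>0 + \<delta> / 2 \<le> R\<^sub>0" by (simp add: R\<^sub>0_def)
    then show False using \<delta> by simp
  qed
  then show ?thesis
  proof (cases "R \<ge> 0")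
    case False
    then have "mcball x R = {}" by (simp add: mcball_eq_empty)
    then show ?thesis by simp
  qed (use cpt in \<open>auto simp: T_def\<close>)
qed

end


section \<open>Smooth approximation of the distance\<close>

text \<open>The McShane formula \<open>h y = min\<^sub>j (h z\<^sub>j + N (y - z\<^sub>j))\<close> over a fine net, with the norm replaced by
  \<open>sqrt (N\<^sup>2 + s\<^sup>2)\<close> and the minimum by the logarithm of a sum of exponentials, is smooth and inherits the
  Lipschitz bound of its building blocks.\<close>

lemma smooth_Lipschitz_approximation:
  fixes N :: "'e::euclidean_space \<Rightarrow> real" and h :: "'e \<Rightarrow> real"
  assumes K: "compact K" "K \<noteq> {}"
    and sq: "smooth_on UNIV (\<lambda>y. (N y)\<^sup>2)"
    and tri: "\<And>u v. N (u + v) \<le> N u + N v"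
    and nn: "\<And>u. N u \<ge> 0" and N_minus: "\<And>u. N (- u) = N u"
    and up: "\<And>u. N u \<le> \<Lambda> * norm u"
    and h: "\<And>y z. y \<in> K \<Longrightarrow> z \<in> K \<Longrightarrow> h y \<le> h z + N (y - z)"
    and \<epsilon>: "\<epsilon> > 0"
  obtains F where "smooth_on UNIV F" "\<And>y. y \<in> K \<Longrightarrow> \<bar>F y - h y\<bar> \<le> \<epsilon>"
    "\<And>y z. F y \<le> F z + N (y - z)"
proof -
  \<comment> \<open>The net is so fine that \<open>N (y - z) \<le> \<epsilon> / 4\<close> for the
    nearest net point. The overestimate there is then at most \<open>\<epsilon> / 4\<close> from
    \<open>h\<close>, \<open>\<epsilon> / 4\<close> from \<open>N\<close> and
    \<open>s = \<epsilon> / 2\<close> from the smoothing. The added 1 excludes a zero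
    denominator.\<close>
  define \<delta> where "\<delta> = \<epsilon> / (4 * (\<bar>\<Lambda>\<bar> + 1))"
  have \<delta>: "\<delta> > 0" "\<bar>\<Lambda>\<bar> * \<delta> \<le> \<epsilon> / 4"
    using \<epsilon> by (auto simp: \<delta>_def field_simps)
  have "K \<subseteq> (\<Union>z\<in>K. ball z \<delta>)" using \<delta> by auto
  then obtain Z where Z: "Z \<subseteq> K" "finite Z" "K \<subseteq> (\<Union>z\<in>Z. ball z \<delta>)"
    by (rule compactE_image[OF K(1) open_ball])
  then have Zne: "Z \<noteq> {}" using K(2) by auto
  define s where "s = \<epsilon> / 2"
  define m where "m = real (card Z)"
  have m: "m \<ge> 1" using Z(2) Zne card_gt_0_iff[of Z] by (auto simp: m_def)
  \<comment> \<open>A soft minimum of \<open>m\<close> numbers lies below the minimum by at most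
    \<open>ln m / l\<close>, which this choice bounds by \<epsilon>; the added 1 keeps
    \<open>l\<close> positive when \<open>m = 1\<close>.\<close>
  define l where "l = (ln m + 1) / \<epsilon>"
  have "ln m \<ge> 0" using m by simp
  then have "l > 0" using \<epsilon> by (simp add: l_def)
  moreover have "\<epsilon> * l = ln m + 1" using \<epsilon> by (simp add: l_def)
  ultimately have l: "l > 0" "ln m / l \<le> \<epsilon>" by (simp_all add: pos_divide_le_eq)
  define n where "n u = sqrt ((N u)\<^sup>2 + s\<^sup>2)" for u
  have s: "s > 0" using \<epsilon> by (simp add: s_def)
  have n_ge: "N u \<le> n u" for u
    unfolding n_def by (rule real_le_rsqrt) simp
  have n_le: "n u \<le> N u + s" for u
    unfolding n_def by (rule real_le_lsqrt) (use nn[of u] s in \<open>auto simp: power2_sum\<close>)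
  have n_lip: "n (u + v) \<le> n u + N v" for u v
  proof -
    have "(N (u + v))\<^sup>2 \<le> (N u + N v)\<^sup>2" using tri nn by (intro power_mono) auto
    moreover have "N u * N v \<le> n u * N v" using n_ge nn by (intro mult_right_mono) auto
    moreover have "(n u)\<^sup>2 = (N u)\<^sup>2 + s\<^sup>2" by (simp add: n_def)
    ultimately have "(N (u + v))\<^sup>2 + s\<^sup>2 \<le> (n u + N v)\<^sup>2" by (simp add: power2_sum)
    moreover have "n u + N v \<ge> 0" using nn n_ge by (meson add_nonneg_nonneg order_trans)
    ultimately show ?thesis unfolding n_def[of "u + v"] by (intro real_le_lsqrt) auto
  qed
  have n_smooth: "smooth_on UNIV (\<lambda>y. n (y - z))" for z
  proof -
    have "smooth_on UNIV (\<lambda>y. y + - z)"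
      by (intro smooth_on_add smooth_on_const smooth_on_linear) auto
    then have "smooth_on UNIV (\<lambda>y. y - z)" by simp
    from smooth_on_compose[OF _ _ sq this] have "smooth_on UNIV (\<lambda>y. (N (y - z))\<^sup>2)" by simp
    then have *: "smooth_on UNIV (\<lambda>y. (N (y - z))\<^sup>2 + s\<^sup>2)"
      by (intro smooth_on_add smooth_on_const) auto
    have "(\<lambda>y. (N (y - z))\<^sup>2 + s\<^sup>2) ` UNIV \<subseteq> {0<..}"
      using s by (auto intro!: add_nonneg_pos)
    from smooth_on_compose[OF open_UNIV this smooth_on_sqrt *] show ?thesis by (simp add: n_def)
  qed
  define E where "E y = (\<Sum>z\<in>Z. exp (- l * (h z + n (y - z))))" for y
  have E_pos: "E y > 0" for y unfolding E_def using Z(2) Zne by (intro sum_pos) auto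
  define F where "F y = - 1 / l * ln (E y)" for y
  show ?thesis
  proof (rule that[of F])
    have "smooth_on UNIV (\<lambda>y. exp (- l * (h z + n (y - z))))" for z
    proof -
      have "smooth_on UNIV (\<lambda>y. - l * (h z + n (y - z)))"
        by (intro smooth_on_mult smooth_on_add smooth_on_const n_smooth open_UNIV)
      from smooth_on_compose[OF _ _ smooth_on_exp this] show ?thesis by simp
    qed
    then have "smooth_on UNIV E" unfolding E_def by (intro smooth_on_sum open_UNIV)
    from smooth_on_compose[OF open_UNIV _ smooth_on_ln this]
    have "smooth_on UNIV (\<lambda>y. ln (E y))" using E_pos by auto
    then show "smooth_on UNIV F" unfolding F_def by (intro smooth_on_mult smooth_on_const open_UNIV)
    show "F y \<le> F z + N (y - z)" for y z
    proof -
      \<comment> \<open>Moving from \<open>z\<close> to \<open>y\<close> changes each exponent by at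
        most \<open>l * N (y - z)\<close>, so every summand, and hence the sum, shrinks at most by
        the same factor; this is the Lipschitz bound.\<close>
      have "exp (- l * N (y - z)) * E z \<le> E y"
        unfolding E_def sum_distrib_left
      proof (rule sum_mono)
        fix w
        have "n (y - w) \<le> n (z - w) + N (y - z)" using n_lip[of "z - w" "y - z"] by simp
        then have "l * n (y - w) \<le> l * (n (z - w) + N (y - z))" using l by simp
        then show "exp (- l * N (y - z)) * exp (- l * (h w + n (z - w))) \<le> exp (- l * (h w + n (y - w)))"
          by (simp add: algebra_simps flip: exp_add)
      qed
      then have "ln (exp (- l * N (y - z)) * E z) \<le> ln (E y)"
        by (subst ln_le_cancel_iff) (use E_pos in auto)
      then have "- l * N (y - z) + ln (E z) \<le> ln (E y)" using E_pos[of z] by (simp add: ln_mult)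
      then show ?thesis using l(1) by (simp add: F_def field_simps)
    qed
    show "\<bar>F y - h y\<bar> \<le> \<epsilon>" if y: "y \<in> K" for y
    proof -
      \<comment> \<open>Every term of the McShane formula is at least \<open>h y\<close>, so only
        the soft minimum can make \<open>F y\<close> smaller.\<close>
      have "E y \<le> (\<Sum>z\<in>Z. exp (- l * h y))"
        unfolding E_def
      proof (rule sum_mono)
        fix z assume "z \<in> Z"
        then have "h y \<le> h z + n (y - z)" using h[OF y, of z] Z(1) n_ge[of "y - z"] by fastforce
        then show "exp (- l * (h z + n (y - z))) \<le> exp (- l * h y)" using l by simp
      qed
      also have "\<dots> = m * exp (- l * h y)" by (simp add: m_def)
      finally have "ln (E y) \<le> ln (m * exp (- l * h y))" using E_pos[of y] by simp
      also have "\<dots> = ln m - l * h y" using m by (simp add: ln_mult)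
      finally have 1: "h y - F y \<le> \<epsilon>" using l by (simp add: F_def field_simps)
      obtain z where z: "z \<in> Z" "y \<in> ball z \<delta>" using Z(3) y by blast
      have "N (y - z) \<le> \<bar>\<Lambda>\<bar> * norm (y - z)"
        by (rule order_trans[OF up]) (intro mult_right_mono; simp)
      also have "\<dots> \<le> \<bar>\<Lambda>\<bar> * \<delta>" using z by (intro mult_left_mono) (auto simp: dist_norm norm_minus_commute)
      finally have N4: "N (y - z) \<le> \<epsilon> / 4" using \<delta>(2) by simp
      have "h z \<le> h y + N (y - z)" using h[of z y] z(1) Z(1) y N_minus[of "y - z"] by auto
      then have "h z + n (y - z) \<le> h y + \<epsilon>" using N4 n_le[of "y - z"] s_def by simp
      then have "l * (h z + n (y - z)) \<le> l * (h y + \<epsilon>)" using l by simp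
      then have "exp (- l * (h y + \<epsilon>)) \<le> exp (- l * (h z + n (y - z)))" by simp
      also have "\<dots> \<le> E y" unfolding E_def using z(1) Z(2) by (intro member_le_sum) auto
      finally have "ln (exp (- l * (h y + \<epsilon>))) \<le> ln (E y)" using E_pos[of y] by (subst ln_le_cancel_iff) auto
      then have "F y - h y \<le> \<epsilon>" using l(1) by (simp add: F_def field_simps)
      with 1 show ?thesis by simp
    qed
  qed
qed

text \<open>Homogeneity cancels \<open>t\<close> in the difference quotient along
  \<open>t *\<^sub>R v\<close> for positive \<open>t\<close>; the direction \<open>- v\<close>
  supplies the other sign.\<close>

lemma Lipschitz_derivative_bound:
  fixes F :: "'e::real_normed_vector \<Rightarrow> real"
  assumes D: "(F has_derivative D) (at y)"
    and N: "\<And>z. F z \<le> F y + N (z - y)" and hom: "\<And>t u. N (t *\<^sub>R u) = \<bar>t\<bar> * N u"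
  shows "\<bar>D v\<bar> \<le> N v"
proof -
  have "D v \<le> N v" for v
  proof -
    have "((\<lambda>t. F (y + t *\<^sub>R v)) has_derivative (\<lambda>t. D (t *\<^sub>R v))) (at 0)"
      by (rule has_derivative_compose[of "\<lambda>t. y + t *\<^sub>R v" "\<lambda>t. t *\<^sub>R v" 0 UNIV F D])
        (auto intro!: derivative_eq_intros simp: D)
    then have "((\<lambda>t. F (y + t *\<^sub>R v)) has_real_derivative D v) (at 0)"
      by (simp add: has_field_derivative_def linear_cmul[OF has_derivative_linear[OF D]] mult_commute_abs)
    then have "((\<lambda>t. (F (y + t *\<^sub>R v) - F y) / t) \<longlongrightarrow> D v) (at 0)"
      by (simp add: has_field_derivative_iff)
    then have "((\<lambda>t. (F (y + t *\<^sub>R v) - F y) / t) \<longlongrightarrow> D v) (at_right 0)"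
      by (rule tendsto_within_subset) simp
    then show ?thesis
    proof (rule tendsto_upperbound)
      show "\<forall>\<^sub>F t in at_right 0. (F (y + t *\<^sub>R v) - F y) / t \<le> N v"
        unfolding eventually_at_filter
      proof (rule always_eventually, intro allI impI)
        fix t :: real assume "t \<noteq> 0" "t \<in> {0<..}"
        then show "(F (y + t *\<^sub>R v) - F y) / t \<le> N v"
          using N[of "y + t *\<^sub>R v"] hom[of t v] by (simp add: field_simps)
      qed
    qed simp
  qed
  from this[of v] this[of "- v"] show ?thesis
    using hom[of "-1" v] linear_neg[OF has_derivative_linear[OF D], of v] by simp
qed

section \<open>Local approximations and their glueing\<close>

context connected_riem_mfd
begin

lemma compact_dist_ball:
  assumes "complete_riemannian A g"
  shows "compact {y. d x y \<le> R}"
proof -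
  have "compactin MS.mtopology (MS.mcball x R)"
  proof (rule MS.compactin_mcball_length_space)
    show MS.mcomplete using assms by (simp add: complete_riemannian_def)
    show "\<exists>r>0. \<exists>K. compactin MS.mtopology K \<and> MS.mball p r \<subseteq> K" for p
    proof -
      obtain r K where "r > 0" "compact K" "\<And>y. d p y < r \<Longrightarrow> y \<in> K"
        using dist_ball_in_open[OF open_UNIV, of p] by (metis UNIV_I)
      then show ?thesis by (intro exI[of _ r] conjI exI[of _ K]) (auto simp: mtopology_eq)
    qed
    show "\<exists>z\<in>UNIV. d x z \<le> s \<and> d z y < e" if "d x y < s + e" "0 \<le> s" "e > 0" for y s e
      using intermediate_point[OF that] by blast
  qed simp
  moreover have "MS.mcball x R = {y. d x y \<le> R}" by auto
  ultimately show ?thesis by (simp add: mtopology_eq)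
qed

text \<open>The constant \<open>3 / 2\<close> is an upper bound of the squared distortion \<open>(6 / 5)\<^sup>2\<close> of the metric in a chart ball; the
  rest of the allowed bound \<open>2\<close> is used up by the differentials of the partition functions.\<close>

definition approximable :: "'a \<Rightarrow> 'a set \<Rightarrow> bool" where
  "approximable x0 K \<longleftrightarrow> (\<forall>\<epsilon>>0. \<exists>U f. open U \<and> K \<subseteq> U \<and> smooth_fun_on U f \<and>
     (\<forall>x\<in>K. \<bar>f x - d x x0\<bar> \<le> \<epsilon> \<and>
       (\<forall>v\<in>tangent_space A x. \<bar>differential A f x v\<bar> \<le> 3 / 2 * tangent_norm g x v)))"

text \<open>The bump and the approximability refer to the same compact chart ball. The bumps can
  thus be normalised and their differentials estimated first, and the error on each \<open>K\<close>
  chosen afterwards.\<close>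

lemma local_bump:
  assumes "open W" "p \<in> W"
  obtains \<phi> K where "smooth_fun_on UNIV \<phi>" "\<And>x. \<phi> x \<ge> 0" "\<phi> p > 0" "compact K" "K \<subseteq> W"
    "\<And>x. x \<notin> K \<Longrightarrow> \<phi> x = 0" "approximable x0 K"
proof -
  obtain c where c: "c \<in> A" "p \<in> chart_dom c" by (rule ex_chart)
  let ?q = "chart_map c p"
  obtain \<rho> where \<rho>: "\<rho> > 0" "ball ?q \<rho> \<subseteq> chart_im c"
    "\<And>y u. y \<in> ball ?q \<rho> \<Longrightarrow> coord_norm c (chart_inv c y) u \<le> 6 / 5 * coord_norm c p u"
    "\<And>y u. y \<in> ball ?q \<rho> \<Longrightarrow> coord_norm c p u \<le> 6 / 5 * coord_norm c (chart_inv c y) u"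
    using coord_norm_local[OF c, of "6 / 5"] by auto
  have "open (ball ?q \<rho> \<inter> chart_map c ` (W \<inter> chart_dom c))"
    using open_map_image[OF c(1) assms(1)] by blast
  moreover have "?q \<in> ball ?q \<rho> \<inter> chart_map c ` (W \<inter> chart_dom c)" using \<rho>(1) c assms by auto
  ultimately obtain s where s: "s > 0" "cball ?q s \<subseteq> ball ?q \<rho> \<inter> chart_map c ` (W \<inter> chart_dom c)"
    using open_contains_cball by blast
  let ?C = "cball ?q s"
  define K where "K = chart_inv c ` ?C"
  have Cim: "?C \<subseteq> chart_im c" using s(2) \<rho>(2) by blast
  have K: "compact K" unfolding K_def
    by (rule compact_continuous_image[OF continuous_on_subset[OF cont_inv[OF c(1)] Cim]]) simp
  have "?C \<subseteq> chart_inv c -` W" using s(2) unfolding map_image_eq[OF c(1)] by blast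
  then have KW: "K \<subseteq> W" by (auto simp: K_def)
  have Kdom: "K \<subseteq> chart_dom c" using Cim c(1) inv_in_dom by (auto simp: K_def)
  have Kmap: "chart_map c x \<in> ?C" if x: "x \<in> K" for x
  proof -
    obtain y where y: "y \<in> ?C" "x = chart_inv c y" using x unfolding K_def by blast
    then have "chart_map c x = y" using map_inv[OF c(1)] Cim by blast
    then show ?thesis using y(1) by simp
  qed
  have inK: "x \<in> K" if x: "x \<in> chart_dom c" "chart_map c x \<in> ?C" for x
    unfolding K_def by (rule image_eqI[OF _ x(2)]) (simp add: inv_map[OF c(1) x(1)])
  \<comment> \<open>Positive exactly on the open ball of radius \<open>s\<close>, so that its
    transplant to the manifold vanishes off \<open>K\<close>.\<close>
  define \<beta> where "\<beta> y = flat_exp (s\<^sup>2 - (y - ?q) \<bullet> (y - ?q))" for y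
  have \<beta>_pos: "\<beta> y > 0 \<longleftrightarrow> dist ?q y < s" for y
  proof -
    have "(y - ?q) \<bullet> (y - ?q) = (dist ?q y)\<^sup>2"
      by (simp add: dist_norm norm_minus_commute power2_norm_eq_inner)
    then have "\<beta> y > 0 \<longleftrightarrow> (dist ?q y)\<^sup>2 < s\<^sup>2" by (simp add: \<beta>_def flat_exp_pos)
    also have "\<dots> \<longleftrightarrow> dist ?q y < s"
      using s(1) by (auto intro: power2_less_imp_less power_strict_mono)
    finally show ?thesis .
  qed
  have \<beta>_smooth: "smooth_on UNIV \<beta>"
  proof -
    have shift: "smooth_on UNIV (\<lambda>y. (y - ?q) \<bullet> b)" for b
    proof -
      have "smooth_on UNIV (\<lambda>y. y \<bullet> b + (- ?q \<bullet> b))"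
        by (intro smooth_on_add smooth_on_const smooth_on_linear bounded_linear_inner_left open_UNIV)
      then show ?thesis by (simp add: inner_diff_left)
    qed
    have "smooth_on UNIV (\<lambda>y. s\<^sup>2 + (\<Sum>b\<in>Basis. (- 1) * (((y - ?q) \<bullet> b) * ((y - ?q) \<bullet> b))))"
      by (intro smooth_on_add smooth_on_sum smooth_on_mult smooth_on_const shift open_UNIV)
    moreover have "s\<^sup>2 + (\<Sum>b\<in>Basis. (- 1) * (((y - ?q) \<bullet> b) * ((y - ?q) \<bullet> b))) = s\<^sup>2 - (y - ?q) \<bullet> (y - ?q)" for y
      by (subst euclidean_inner[of "y - ?q" "y - ?q"]) (simp add: sum_negf)
    ultimately have "smooth_on UNIV (\<lambda>y. s\<^sup>2 - (y - ?q) \<bullet> (y - ?q))" by simp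
    from smooth_on_compose[OF _ _ smooth_on_flat_exp this] show ?thesis by (simp add: \<beta>_def[abs_def])
  qed
  define \<phi> where "\<phi> x = (if x \<in> chart_dom c then \<beta> (chart_map c x) else 0)" for x
  have \<phi>_out: "\<phi> x = 0" if "x \<notin> K" for x
  proof (cases "x \<in> chart_dom c")
    case True
    then have "\<not> dist ?q (chart_map c x) < s" using inK[OF True] that by auto
    then show ?thesis using \<beta>_pos[of "chart_map c x"] flat_exp_nonneg
      by (simp add: \<phi>_def \<beta>_def) (metis less_eq_real_def)
  qed (simp add: \<phi>_def)
  show ?thesis
  proof (rule that[OF _ _ _ K KW \<phi>_out])
    show "smooth_fun_on UNIV \<phi>"
    proof (rule smooth_fun_on_local)
      fix x :: 'a
      show "\<exists>V. open V \<and> x \<in> V \<and> smooth_fun_on V \<phi>"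
      proof (cases "x \<in> K")
        case True
        have "smooth_fun_on (chart_dom c) \<phi>"
          by (rule smooth_fun_on_cong[OF open_dom[OF c(1)] _ smooth_fun_on_chart[OF c(1) \<beta>_smooth]]) (simp add: \<phi>_def)
        then show ?thesis using True Kdom open_dom[OF c(1)] by blast
      next
        case False
        have o: "open (- K)" using compact_imp_closed[OF K] by blast
        have "smooth_fun_on (- K) \<phi>"
          by (rule smooth_fun_on_cong[OF o _ smooth_fun_on_const[of _ 0]]) (use \<phi>_out in auto)
        then show ?thesis using o False by blast
      qed
    qed
    show "\<phi> x \<ge> 0" for x by (simp add: \<phi>_def \<beta>_def flat_exp_nonneg)
    show "\<phi> p > 0" using c s \<beta>_pos[of ?q] by (simp add: \<phi>_def)
    show "approximable x0 K"
      unfolding approximable_def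
    proof (intro allI impI)
      fix \<epsilon> :: real assume \<epsilon>: "\<epsilon> > 0"
      \<comment> \<open>The norm at the centre \<open>p\<close>, enlarged to dominate the metric
        throughout the ball. By coordinate segments the distance to \<open>x0\<close> is then
        Lipschitz with constant one for \<open>N\<close>.\<close>
      define N where "N u = 6 / 5 * coord_norm c p u" for u
      obtain \<Lambda> where \<Lambda>: "\<And>u. coord_norm c p u \<le> \<Lambda> * norm u" using coord_norm_upper[OF c] by blast
      obtain F where F: "smooth_on UNIV F" "\<And>y. y \<in> ?C \<Longrightarrow> \<bar>F y - d (chart_inv c y) x0\<bar> \<le> \<epsilon>"
        "\<And>y z. F y \<le> F z + N (y - z)"
      proof (rule smooth_Lipschitz_approximation[of ?C N "6 / 5 * \<Lambda>" "\<lambda>y. d (chart_inv c y) x0" \<epsilon>])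
        have "smooth_on UNIV (\<lambda>y. 36 / 25 * (\<Sum>b\<in>Basis. \<Sum>b'\<in>Basis. (y \<bullet> b) * (y \<bullet> b') * coord_form c p b b'))"
          by (intro smooth_on_sum smooth_on_mult smooth_on_const smooth_on_linear bounded_linear_inner_left open_UNIV)
        moreover have "36 / 25 * (\<Sum>b\<in>Basis. \<Sum>b'\<in>Basis. (y \<bullet> b) * (y \<bullet> b') * coord_form c p b b') = (N y)\<^sup>2" for y
        proof -
          have "(N y)\<^sup>2 = 36 / 25 * coord_form c p y y"
            by (simp only: N_def power_mult_distrib coord_norm_sq[OF c]) (simp add: power_divide)
          then show ?thesis by (simp add: coord_form_expand[OF c, of y y])
        qed
        ultimately show "smooth_on UNIV (\<lambda>y. (N y)\<^sup>2)" by simp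
        show "N (u + v) \<le> N u + N v" for u v using coord_norm_triangle[OF c, of u v] by (simp add: N_def)
        show "N u \<ge> 0" "N (- u) = N u" for u by (simp_all add: N_def coord_norm_nonneg[OF c] coord_norm_minus[OF c])
        show "N u \<le> 6 / 5 * \<Lambda> * norm u" for u using \<Lambda>[of u] by (simp add: N_def)
        show "d (chart_inv c y) x0 \<le> d (chart_inv c z) x0 + N (y - z)" if "y \<in> ?C" "z \<in> ?C" for y z
        proof -
          have "d (chart_inv c z) (chart_inv c y) \<le> N (y - z)"
            by (rule dist_chart_segment[OF c(1) \<rho>(2)]) (use \<rho>(3) s(2) that in \<open>auto simp: N_def\<close>)
          then show ?thesis
            using dist_triangle[of "chart_inv c y" x0 "chart_inv c z"] dist_sym[of "chart_inv c y"] by simp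
        qed
      qed (use s \<epsilon> in auto)
      show "\<exists>U f. open U \<and> K \<subseteq> U \<and> smooth_fun_on U f \<and> (\<forall>x\<in>K. \<bar>f x - d x x0\<bar> \<le> \<epsilon> \<and>
        (\<forall>v\<in>tangent_space A x. \<bar>differential A f x v\<bar> \<le> 3 / 2 * tangent_norm g x v))"
      proof (rule exI[of _ "chart_dom c"], rule exI[of _ "\<lambda>x. F (chart_map c x)"], intro conjI ballI)
        show "open (chart_dom c)" "K \<subseteq> chart_dom c" "smooth_fun_on (chart_dom c) (\<lambda>x. F (chart_map c x))"
          using open_dom[OF c(1)] Kdom smooth_fun_on_chart[OF c(1) F(1)] by auto
        fix x assume x: "x \<in> K"
        then have xd: "x \<in> chart_dom c" using Kdom by blast
        show "\<bar>F (chart_map c x) - d x x0\<bar> \<le> \<epsilon>"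
          using F(2)[OF Kmap[OF x]] xd c(1) by (simp add: inv_map)
        fix v assume v: "v \<in> tangent_space A x"
        let ?y = "chart_map c x"
        define D where "D = frechet_derivative F (at ?y)"
        have D: "(F has_derivative D) (at ?y)"
          unfolding D_def by (rule smooth_on_has_derivative[OF F(1)]) simp
        have "(((\<lambda>x. F (chart_map c x)) \<circ> chart_inv c) has_derivative D) (at ?y)"
          by (rule has_derivative_transform_within_open[OF D open_im[OF c(1)]])
            (use xd c(1) in \<open>auto simp: map_in_im map_inv\<close>)
        then have "differential A (\<lambda>x. F (chart_map c x)) x v = D (v c)"
          by (rule differential_eq[OF c(1) xd v])
        moreover have "\<bar>D (v c)\<bar> \<le> N (v c)"
          by (rule Lipschitz_derivative_bound[OF D]) (use F(3) in \<open>auto simp: N_def coord_norm_scaleR[OF c]\<close>)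
        \<comment> \<open>Returning from the norm at \<open>p\<close> to that at \<open>x\<close>
          costs a second factor \<open>6 / 5\<close>; \<open>36 / 25\<close> is below
          \<open>3 / 2\<close>.\<close>
        moreover have "N (v c) \<le> 36 / 25 * coord_norm c x (v c)"
          using \<rho>(4)[of ?y "v c"] Kmap[OF x] s(2) inv_map[OF c(1) xd] by (auto simp: N_def)
        moreover have "coord_norm c x (v c) \<ge> 0" by (rule coord_norm_nonneg[OF c(1) xd])
        ultimately show "\<bar>differential A (\<lambda>x. F (chart_map c x)) x v\<bar> \<le> 3 / 2 * tangent_norm g x v"
          by (simp add: tangent_norm_eq_coord_norm[OF c(1) xd v])
      qed
    qed
  qed
qed

text \<open>The space is cut into compact shells of width 1 around \<open>x0\<close>; finitely many
  bumps cover each shell, with supports in a slightly larger open shell. A bounded region meets only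
  finitely many of the larger shells, which gives local finiteness. The index records the shell and
  the centre.\<close>

lemma bump_family:
  assumes "complete_riemannian A g"
  obtains I :: "(nat \<times> 'a) set" and \<phi> K where "countable I"
    "\<And>i. i \<in> I \<Longrightarrow> smooth_fun_on UNIV (\<phi> i)" "\<And>i x. i \<in> I \<Longrightarrow> \<phi> i x \<ge> 0"
    "\<And>i. i \<in> I \<Longrightarrow> compact (K i)" "\<And>i x. i \<in> I \<Longrightarrow> x \<notin> K i \<Longrightarrow> \<phi> i x = 0"
    "\<And>i. i \<in> I \<Longrightarrow> approximable x0 (K i)"
    "\<And>x. \<exists>i\<in>I. \<phi> i x > 0"
    "\<And>R. finite {i\<in>I. \<exists>x\<in>K i. d x x0 < R}"
proof -
  have rc: "continuous_on UNIV (\<lambda>x. d x x0)"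
    using dist_continuous[of x0] by (simp add: dist_sym[of x0])
  define An where "An n = {x. real n \<le> d x x0 \<and> d x x0 \<le> real n + 1}" for n
  define W where "W n = {x. real n - 1 < d x x0 \<and> d x x0 < real n + 2}" for n
  have W: "open (W n)" for n
    unfolding W_def by (intro open_Collect_conj open_Collect_less continuous_on_const rc)
  have An: "compact (An n)" for n
  proof -
    have "An n = {y. d x0 y \<le> real n + 1} \<inter> {x. real n \<le> d x x0}"
      by (auto simp: An_def dist_sym[of x0])
    moreover have "closed {x. real n \<le> d x x0}"
      by (intro closed_Collect_le continuous_on_const rc)
    ultimately show ?thesis using compact_Int_closed compact_dist_ball[OF assms] by metis
  qed
  define P where "P n p \<phi> K \<longleftrightarrow> smooth_fun_on UNIV \<phi> \<and> (\<forall>x. \<phi> x \<ge> 0) \<and> \<phi> p > 0 \<and> compact K \<and> K \<subseteq> W n \<and>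
    (\<forall>x. x \<notin> K \<longrightarrow> \<phi> x = 0) \<and> approximable x0 K" for n and p :: 'a and \<phi> K
  have "\<exists>\<phi> K. P n p \<phi> K" if "p \<in> An n" for n p
  proof -
    have "p \<in> W n" using that by (auto simp: An_def W_def)
    then obtain \<phi> K where "smooth_fun_on UNIV \<phi>" "\<And>x. \<phi> x \<ge> 0" "\<phi> p > 0" "compact K" "K \<subseteq> W n"
      "\<And>x. x \<notin> K \<Longrightarrow> \<phi> x = 0" "approximable x0 K"
      using local_bump[OF W, of p n x0] by metis
    then show ?thesis unfolding P_def by blast
  qed
  note ex = this
  define X where "X n p = (SOME z. P n p (fst z) (snd z))" for n p
  define \<phi> where "\<phi> n p = fst (X n p)" for n p
  define K where "K n p = snd (X n p)" for n p
  have P: "P n p (\<phi> n p) (K n p)" if p: "p \<in> An n" for n p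
  proof -
    obtain \<phi>' K' where "P n p \<phi>' K'" using ex[OF p] by blast
    then have "P n p (fst (\<phi>', K')) (snd (\<phi>', K'))" by simp
    then show ?thesis unfolding \<phi>_def K_def X_def by (rule someI)
  qed
  have "\<exists>F. finite F \<and> F \<subseteq> An n \<and> (\<forall>x\<in>An n. \<exists>p\<in>F. \<phi> n p x > 0)" for n
  proof -
    have o: "open {x. 0 < \<phi> n p x}" if "p \<in> An n" for p
      using P[OF that] smooth_fun_on_continuous_on[OF open_UNIV]
      by (intro open_Collect_less continuous_on_const) (auto simp: P_def)
    have cov: "An n \<subseteq> (\<Union>p\<in>An n. {x. 0 < \<phi> n p x})" using P by (auto simp: P_def)
    obtain F where "F \<subseteq> An n" "finite F" "An n \<subseteq> (\<Union>p\<in>F. {x. 0 < \<phi> n p x})"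
      using compactE_image[OF An[of n], of "An n" "\<lambda>p. {x. 0 < \<phi> n p x}"] o cov by blast
    then show ?thesis by (intro exI[of _ F]) blast
  qed
  then obtain F where F: "\<And>n. finite (F n)" "\<And>n. F n \<subseteq> An n" "\<And>n x. x \<in> An n \<Longrightarrow> \<exists>p\<in>F n. \<phi> n p x > 0"
    by metis
  define I where "I = Sigma UNIV F"
  have PI: "P (fst i) (snd i) (\<phi> (fst i) (snd i)) (K (fst i) (snd i))" if "i \<in> I" for i
    by (intro P subsetD[OF F(2)]) (use that in \<open>auto simp: I_def\<close>)
  show ?thesis
  proof (rule that[of I "\<lambda>i. \<phi> (fst i) (snd i)" "\<lambda>i. K (fst i) (snd i)"])
    show "countable I" unfolding I_def by (intro countable_SIGMA) (auto simp: F(1) countable_finite)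
    fix x
    have "x \<in> An (nat \<lfloor>d x x0\<rfloor>)" using dist_nonneg[of x x0] by (auto simp: An_def)
    then show "\<exists>i\<in>I. \<phi> (fst i) (snd i) x > 0" using F(3) by (force simp: I_def)
  next
    fix R
    \<comment> \<open>A support in the enlarged shell number \<open>n\<close> has distance more than
      \<open>n - 1\<close> from \<open>x0\<close>, so \<open>n < R + 1\<close>.\<close>
    have "{i\<in>I. \<exists>x\<in>K (fst i) (snd i). d x x0 < R} \<subseteq> Sigma {..nat \<lceil>R + 1\<rceil>} F"
    proof
      fix i assume "i \<in> {i\<in>I. \<exists>x\<in>K (fst i) (snd i). d x x0 < R}"
      then obtain x where i: "i \<in> I" "x \<in> K (fst i) (snd i)" "d x x0 < R" by auto
      then have "x \<in> W (fst i)" using PI[OF i(1)] by (auto simp: P_def)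
      then have "real (fst i) < R + 1" using i by (auto simp: W_def)
      then have "fst i \<le> nat \<lceil>R + 1\<rceil>" by linarith
      then show "i \<in> Sigma {..nat \<lceil>R + 1\<rceil>} F" using i(1) by (auto simp: I_def)
    qed
    then show "finite {i\<in>I. \<exists>x\<in>K (fst i) (snd i). d x x0 < R}"
      by (rule finite_subset) (intro finite_SigmaI F(1) finite_atMost)
  qed (use PI in \<open>auto simp: P_def\<close>)
qed


text \<open>With \<open>(\<Sum>i. d\<psi>\<^sub>i) = 0\<close> the differential of \<open>f\<close>
  is the average of the \<open>dF\<^sub>i\<close> with weights \<open>\<psi>\<^sub>i\<close>, at
  most \<open>3 / 2\<close>, plus the sum of the \<open>d\<psi>\<^sub>i\<close> times
  \<open>F\<^sub>i - r\<close>, which the choice of errors keeps below \<open>1 / 2\<close>.\<close>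

lemma smooth_distance_approximation:
  assumes complete: "complete_riemannian A g"
  obtains f where "smooth_fun_on UNIV f" "\<And>x. \<bar>f x - d x x0\<bar> \<le> 1 / 2"
    "\<And>x v. v \<in> tangent_space A x \<Longrightarrow> \<bar>differential A f x v\<bar> \<le> 2 * tangent_norm g x v"
proof (rule bump_family[OF complete, of x0])
  fix I :: "(nat \<times> 'a) set" and \<phi> K
  assume I: "countable I"
    and \<phi>: "\<And>i. i \<in> I \<Longrightarrow> smooth_fun_on UNIV (\<phi> i)" "\<And>i x. i \<in> I \<Longrightarrow> \<phi> i x \<ge> 0"
    and K1: "\<And>i. i \<in> I \<Longrightarrow> compact (K i)"
    and \<phi>3: "\<And>i x. i \<in> I \<Longrightarrow> x \<notin> K i \<Longrightarrow> \<phi> i x = 0"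
    and K2: "\<And>i. i \<in> I \<Longrightarrow> approximable x0 (K i)"
    and \<phi>4: "\<And>x. \<exists>i\<in>I. \<phi> i x > 0"
    and fin: "\<And>R. finite {i\<in>I. \<exists>x\<in>K i. d x x0 < R}"
  define V where "V R = {x. d x x0 < R}" for R
  define J where "J R = {i\<in>I. \<exists>x\<in>K i. d x x0 < R}" for R
  have J: "finite (J R)" "J R \<subseteq> I" for R using fin by (auto simp: J_def)
  have V: "open (V R)" for R
  proof -
    have "continuous_on UNIV (\<lambda>x. d x x0)"
      using dist_continuous[of x0] by (simp add: dist_sym[of x0])
    then show ?thesis unfolding V_def by (intro open_Collect_less continuous_on_const)
  qed
  have xV: "x \<in> V (d x x0 + 1)" for x by (simp add: V_def)
  \<comment> \<open>A locally finite sum with one global formula; on the ball \<open>V R\<close> it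
    may be computed over the fixed finite set \<open>J R\<close>, which is the form that can be
    differentiated.\<close>
  define L where "L u x = (\<Sum>i\<in>{i\<in>I. x \<in> K i}. u i x)" for u :: "nat \<times> 'a \<Rightarrow> 'a \<Rightarrow> real" and x
  have L_eq: "L u x = (\<Sum>i\<in>J R. u i x)"
    if "x \<in> V R" "\<And>i x. i \<in> I \<Longrightarrow> x \<notin> K i \<Longrightarrow> u i x = 0" for u x R
    unfolding L_def by (rule sum.mono_neutral_left) (use J that in \<open>auto simp: J_def V_def\<close>)
  have L_smooth: "smooth_fun_on UNIV (L u)"
    if "\<And>i. i \<in> I \<Longrightarrow> smooth_fun_on UNIV (u i)" "\<And>i x. i \<in> I \<Longrightarrow> x \<notin> K i \<Longrightarrow> u i x = 0" for u
  proof (rule smooth_fun_on_local)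
    fix x :: 'a
    let ?R = "d x x0 + 1"
    have "smooth_fun_on (V ?R) (\<lambda>x. \<Sum>i\<in>J ?R. u i x)"
    proof (rule smooth_fun_on_sum[OF V])
      show "smooth_fun_on (V ?R) (u i)" if "i \<in> J ?R" for i
        using smooth_fun_on_subset[OF \<open>\<And>i. i \<in> I \<Longrightarrow> smooth_fun_on UNIV (u i)\<close>] J(2) that by blast
    qed
    moreover have "(\<Sum>i\<in>J ?R. u i y) = L u y" if "y \<in> V ?R" for y
      using L_eq[OF that, of u] that(1) \<open>\<And>i x. i \<in> I \<Longrightarrow> x \<notin> K i \<Longrightarrow> u i x = 0\<close> by simp
    ultimately have "smooth_fun_on (V ?R) (L u)" by (rule smooth_fun_on_cong[OF V, rotated])
    then show "\<exists>W. open W \<and> x \<in> W \<and> smooth_fun_on W (L u)" using V xV by blast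
  qed
  define S where "S = L \<phi>"
  have S_pos: "S x > 0" for x
  proof -
    obtain i where i: "i \<in> I" "\<phi> i x > 0" using \<phi>4 by blast
    then have xK: "x \<in> K i" using \<phi>3[OF i(1), of x] by (cases "x \<in> K i") auto
    have "i \<in> J (d x x0 + 1)" using i(1) xK unfolding J_def by force
    then have "(\<Sum>i\<in>J (d x x0 + 1). \<phi> i x) > 0"
    proof (rule sum_pos2[rotated])
      show "0 \<le> \<phi> j x" if "j \<in> J (d x x0 + 1)" for j by (rule \<phi>(2)[OF subsetD[OF J(2) that]])
    qed (rule i(2), rule J(1))
    then show ?thesis using L_eq[OF xV \<phi>3] by (simp add: S_def)
  qed
  have S_smooth: "smooth_fun_on UNIV S" unfolding S_def by (rule L_smooth[OF \<phi>(1) \<phi>3])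
  define \<psi> where "\<psi> i x = \<phi> i x / S x" for i x
  have \<psi>: "smooth_fun_on UNIV (\<psi> i)" "\<psi> i x \<ge> 0" "x \<notin> K i \<Longrightarrow> \<psi> i x = 0" if "i \<in> I" for i x
  proof -
    show "smooth_fun_on UNIV (\<psi> i)"
      unfolding \<psi>_def using S_pos that by (intro smooth_fun_on_divide \<phi>(1) S_smooth) (auto simp: less_imp_neq[symmetric])
    show "\<psi> i x \<ge> 0" using \<phi>(2)[OF that, of x] S_pos[of x] by (simp add: \<psi>_def)
    show "\<psi> i x = 0" if "x \<notin> K i" using \<phi>3[OF \<open>i \<in> I\<close> that] by (simp add: \<psi>_def)
  qed
  have \<psi>_sum: "(\<Sum>i\<in>J R. \<psi> i x) = 1" if "x \<in> V R" for x R
    using L_eq[OF that \<phi>3] S_pos[of x] by (simp add: \<psi>_def S_def flip: sum_divide_distrib)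
  have "\<exists>B\<ge>0. \<forall>x. \<forall>v\<in>tangent_space A x. \<bar>differential A (\<psi> i) x v\<bar> \<le> B * tangent_norm g x v" if "i \<in> I" for i
    by (rule differential_bounded_compact[OF \<psi>(1)[OF that] K1[OF that] \<psi>(3)[OF that]]) blast+
  then obtain B where B: "\<And>i. i \<in> I \<Longrightarrow> B i \<ge> 0"
    "\<And>i x v. i \<in> I \<Longrightarrow> v \<in> tangent_space A x \<Longrightarrow> \<bar>differential A (\<psi> i) x v\<bar> \<le> B i * tangent_norm g x v"
    by metis
  \<comment> \<open>Weights indexed by an enumeration of \<open>I\<close>; the exponent starts at 2
    so that the total is at most \<open>1 / 2\<close>.\<close>
  define w where "w i = (1 / 2 :: real) ^ (to_nat_on I i + 2)" for i
  have w_pos: "w i > 0" for i by (simp add: w_def)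
  have w_sum: "(\<Sum>i\<in>J R. w i) \<le> 1 / 2" for R
  proof -
    have inj: "inj_on (to_nat_on I) (J R)"
      using inj_on_to_nat_on[OF I] J(2) inj_on_subset by blast
    have sums: "(\<lambda>k. (1 / 2 :: real) ^ (k + 2)) sums (1 / 2)"
      using sums_mult[OF geometric_sums[of "1 / 2 :: real"], of "1 / 4"]
      by (simp add: power_add mult.commute power2_eq_square)
    have "(\<Sum>i\<in>J R. w i) = (\<Sum>k\<in>to_nat_on I ` J R. (1 / 2 :: real) ^ (k + 2))"
      by (simp add: sum.reindex[OF inj] w_def)
    also have "\<dots> \<le> (\<Sum>k. (1 / 2 :: real) ^ (k + 2))"
      by (rule sum_le_suminf) (use J(1) sums in \<open>auto simp: sums_iff\<close>)
    finally show ?thesis using sums by (simp add: sums_iff)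
  qed
  \<comment> \<open>The first bound gives \<open>f\<close> within \<open>1 / 2\<close> of the
    distance, the second makes the error times the bound \<open>B i\<close> on the differential of
    \<open>\<psi> i\<close> at most \<open>w i\<close>.\<close>
  define \<epsilon> where "\<epsilon> i = min (1 / 2) (w i / (B i + 1))" for i
  have \<epsilon>: "\<epsilon> i > 0" "\<epsilon> i \<le> 1 / 2" "\<epsilon> i * B i \<le> w i" if "i \<in> I" for i
  proof -
    have b: "B i + 1 > 0" using B(1)[OF that] by simp
    show "\<epsilon> i > 0" using w_pos[of i] b by (simp add: \<epsilon>_def)
    show "\<epsilon> i \<le> 1 / 2" unfolding \<epsilon>_def by (rule min.cobounded1)
    have "\<epsilon> i * B i \<le> w i / (B i + 1) * (B i + 1)"
      using b B(1)[OF that] w_pos[of i] by (intro mult_mono) (auto simp: \<epsilon>_def)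
    then show "\<epsilon> i * B i \<le> w i" using b by simp
  qed
  define P where "P i U f \<longleftrightarrow> open U \<and> K i \<subseteq> U \<and> smooth_fun_on U f \<and> (\<forall>x\<in>K i. \<bar>f x - d x x0\<bar> \<le> \<epsilon> i \<and>
       (\<forall>v\<in>tangent_space A x. \<bar>differential A f x v\<bar> \<le> 3 / 2 * tangent_norm g x v))" for i U f
  have "\<exists>z. P i (fst z) (snd z)" if "i \<in> I" for i
    using K2[OF that] \<epsilon>(1)[OF that] unfolding approximable_def P_def by auto
  then obtain Z where Z: "\<And>i. i \<in> I \<Longrightarrow> P i (fst (Z i)) (snd (Z i))" by metis
  define U where "U i = fst (Z i)" for i
  define F where "F i = snd (Z i)" for i
  have P: "P i (U i) (F i)" if "i \<in> I" for i using Z[OF that] by (simp add: U_def F_def)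
  have F: "open (U i)" "K i \<subseteq> U i" "smooth_fun_on (U i) (F i)"
    "x \<in> K i \<Longrightarrow> \<bar>F i x - d x x0\<bar> \<le> \<epsilon> i"
    "x \<in> K i \<Longrightarrow> v \<in> tangent_space A x \<Longrightarrow> \<bar>differential A (F i) x v\<bar> \<le> 3 / 2 * tangent_norm g x v"
    if "i \<in> I" for i x v
    using P[OF that] unfolding P_def by blast+
  define u where "u i x = \<psi> i x * F i x" for i x
  have o: "open (- K i)" if "i \<in> I" for i using compact_imp_closed[OF K1[OF that]] by blast
  have u_out: "u i x = 0" if "i \<in> I" "x \<notin> K i" for i x
    using \<psi>(3)[OF that] by (simp add: u_def)
  have uU: "smooth_fun_on (U i) (u i)" if "i \<in> I" for i
    unfolding u_def
    by (intro smooth_fun_on_mult F that smooth_fun_on_subset[OF \<psi>(1)]) auto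
  \<comment> \<open>\<open>F i\<close> is controlled only on the neighbourhood \<open>U i\<close> of
    \<open>K i\<close>; since \<open>\<psi> i\<close> vanishes off \<open>K i\<close>, the product
    is smooth on \<open>U i\<close> and zero on the open complement of \<open>K i\<close>, and these
    two sets cover everything.\<close>
  have u_smooth: "smooth_fun_on UNIV (u i)" if i: "i \<in> I" for i
  proof (rule smooth_fun_on_local)
    fix x :: 'a
    have "smooth_fun_on (- K i) (u i)"
      by (rule smooth_fun_on_cong[OF o[OF i] _ smooth_fun_on_const[of _ 0]]) (use u_out i in auto)
    then show "\<exists>V. open V \<and> x \<in> V \<and> smooth_fun_on V (u i)"
      using uU[OF i] F(1,2)[OF i] o[OF i] by blast
  qed
  define f where "f = L u"
  have f_eq: "f x = (\<Sum>i\<in>J R. u i x)" if "x \<in> V R" for x R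
    unfolding f_def by (rule L_eq[OF that u_out])
  show ?thesis
  proof (rule that[of f])
    show "smooth_fun_on UNIV f" unfolding f_def by (rule L_smooth[OF u_smooth u_out])
    fix x
    let ?R = "d x x0 + 1"
    have val: "\<bar>u i x - d x x0 * \<psi> i x\<bar> \<le> 1 / 2 * \<psi> i x" if i: "i \<in> J ?R" for i
    proof (cases "x \<in> K i")
      case True
      have iI: "i \<in> I" using i J(2) by blast
      have "u i x - d x x0 * \<psi> i x = \<psi> i x * (F i x - d x x0)" by (simp add: u_def algebra_simps)
      also have "\<bar>\<dots>\<bar> \<le> \<psi> i x * (1 / 2)"
        using F(4)[OF iI True] \<epsilon>(2)[OF iI] \<psi>(2)[OF iI, of x]
        by (simp only: abs_mult abs_of_nonneg) (intro mult_left_mono; linarith)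
      finally show ?thesis by simp
    next
      case False
      have iI: "i \<in> I" using i J(2) by blast
      show ?thesis using \<psi>(3)[OF iI False] u_out[OF iI False] by simp
    qed
    have "f x - d x x0 = (\<Sum>i\<in>J ?R. u i x - d x x0 * \<psi> i x)"
      using \<psi>_sum[OF xV[of x]] by (simp add: f_eq[OF xV[of x]] sum_subtractf flip: sum_distrib_left)
    also have "\<bar>\<dots>\<bar> \<le> (\<Sum>i\<in>J ?R. 1 / 2 * \<psi> i x)"
      by (intro order_trans[OF sum_abs] sum_mono val)
    also have "\<dots> = 1 / 2" using \<psi>_sum[OF xV[of x]] by (simp flip: sum_distrib_left sum_divide_distrib)
    finally show "\<bar>f x - d x x0\<bar> \<le> 1 / 2" .
    fix v assume v: "v \<in> tangent_space A x"
    let ?n = "tangent_norm g x v"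
    have n: "?n \<ge> 0" by (rule tangent_norm_nonneg[OF v])
    \<comment> \<open>Subtracting \<open>d x x0\<close> times the differential of
      \<open>\<psi> i\<close>, with \<open>x\<close> fixed, leaves the product rule with the small
      factor \<open>F i x - d x x0\<close>.\<close>
    have der: "\<bar>differential A (u i) x v - d x x0 * differential A (\<psi> i) x v\<bar> \<le> 3 / 2 * ?n * \<psi> i x + w i * ?n"
      if i: "i \<in> J ?R" for i
    proof (cases "x \<in> K i")
      case True
      have iI: "i \<in> I" using i J(2) by blast
      have xU: "x \<in> U i" using F(2)[OF iI] True by blast
      have "differential A (u i) x v = \<psi> i x * differential A (F i) x v + differential A (\<psi> i) x v * F i x"
        unfolding u_def
        by (rule differential_mult[OF smooth_fun_on_subset[OF \<psi>(1)[OF iI]] F(3)[OF iI] xU v]) simp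
      then have "differential A (u i) x v - d x x0 * differential A (\<psi> i) x v
        = \<psi> i x * differential A (F i) x v + differential A (\<psi> i) x v * (F i x - d x x0)"
        by (simp add: algebra_simps)
      also have "\<bar>\<dots>\<bar> \<le> \<psi> i x * (3 / 2 * ?n) + (B i * ?n) * \<epsilon> i"
      proof (rule order_trans[OF abs_triangle_ineq add_mono])
        show "\<bar>\<psi> i x * differential A (F i) x v\<bar> \<le> \<psi> i x * (3 / 2 * ?n)"
          using F(5)[OF iI True v] \<psi>(2)[OF iI, of x] by (simp only: abs_mult abs_of_nonneg mult_left_mono)
        show "\<bar>differential A (\<psi> i) x v * (F i x - d x x0)\<bar> \<le> (B i * ?n) * \<epsilon> i"
          unfolding abs_mult
          by (intro mult_mono B(2)[OF iI v] F(4)[OF iI True] mult_nonneg_nonneg n B(1)[OF iI]) auto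
      qed
      also have "\<dots> \<le> 3 / 2 * ?n * \<psi> i x + w i * ?n"
        using mult_right_mono[OF \<epsilon>(3)[OF iI] n] by (simp add: algebra_simps)
      finally show ?thesis .
    next
      case False
      have iI: "i \<in> I" using i J(2) by blast
      have "differential A h x v = 0" if "\<And>y. y \<notin> K i \<Longrightarrow> h y = 0" for h
        using differential_cong[OF o[OF iI] _ _ smooth_fun_on_const[of _ 0] v, of h] False that differential_const[OF v]
        by simp
      from this[of "u i"] this[of "\<psi> i"] show ?thesis
        using u_out[OF iI] \<psi>(2,3)[OF iI] n w_pos[of i] by simp
    qed
    \<comment> \<open>The partition functions sum to 1 on a whole neighbourhood of \<open>x\<close>,
      so their differentials at \<open>x\<close> sum to 0 and the terms subtracted in
      \<open>der\<close> cancel.\<close>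
    have "differential A (\<lambda>y. \<Sum>i\<in>J ?R. \<psi> i y) x v = (\<Sum>i\<in>J ?R. differential A (\<psi> i) x v)"
      by (rule differential_sum[OF open_UNIV _ _ v]) (use \<psi>(1) J(2) in auto)
    moreover have "differential A (\<lambda>y. \<Sum>i\<in>J ?R. \<psi> i y) x v = differential A (\<lambda>y. 1) x v"
      by (rule differential_cong[OF V xV _ smooth_fun_on_const v]) (simp add: \<psi>_sum)
    ultimately have \<psi>0: "(\<Sum>i\<in>J ?R. differential A (\<psi> i) x v) = 0" by (simp add: differential_const[OF v])
    have uJ: "smooth_fun_on UNIV (u i)" if "i \<in> J ?R" for i using u_smooth J(2) that by blast
    have "differential A f x v = differential A (\<lambda>y. \<Sum>i\<in>J ?R. u i y) x v"
      by (rule differential_cong[OF V xV _ _ v])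
        (auto simp: f_eq intro!: smooth_fun_on_subset[OF smooth_fun_on_sum[OF open_UNIV uJ]])
    also have "\<dots> = (\<Sum>i\<in>J ?R. differential A (u i) x v)"
      by (rule differential_sum[OF open_UNIV uJ _ v]) auto
    also have "\<dots> = (\<Sum>i\<in>J ?R. differential A (u i) x v - d x x0 * differential A (\<psi> i) x v)"
      using \<psi>0 by (simp add: sum_subtractf flip: sum_distrib_left)
    also have "\<bar>\<dots>\<bar> \<le> (\<Sum>i\<in>J ?R. 3 / 2 * ?n * \<psi> i x + w i * ?n)"
      by (intro order_trans[OF sum_abs] sum_mono der)
    also have "\<dots> = 3 / 2 * ?n * (\<Sum>i\<in>J ?R. \<psi> i x) + (\<Sum>i\<in>J ?R. w i) * ?n"
      by (simp only: sum.distrib sum_distrib_left sum_distrib_right)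
    also have "\<dots> \<le> 3 / 2 * ?n * 1 + 1 / 2 * ?n"
      by (intro add_mono mult_right_mono w_sum n) (simp add: \<psi>_sum[OF xV])
    finally show "\<bar>differential A f x v\<bar> \<le> 2 * ?n" by simp
  qed
qed

end


section \<open>The containment function\<close>

lemma hamiltonian_le:
  assumes "N \<ge> 1" and "\<And>z. z \<in> {1..N} \<Longrightarrow> internal_hamiltonian A g b x p z \<le> B"
  shows "hamiltonian A g N b q x p \<le> ereal B"
  unfolding hamiltonian_def
proof (rule SUP_least)
  fix \<pi> assume "\<pi> \<in> prob_on {1..N}"
  then have \<pi>: "set_pmf \<pi> \<subseteq> {1..N}" by (simp add: prob_on_def)
  have fin: "finite (set_pmf \<pi>)" using \<pi> finite_subset by blast
  have "measure_pmf.expectation \<pi> (internal_hamiltonian A g b x p) \<le> measure_pmf.expectation \<pi> (\<lambda>_. B)"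
    by (rule integral_mono_AE)
      (use fin \<pi> assms(2) in \<open>auto simp: AE_measure_pmf_iff intro!: integrable_measure_pmf_finite\<close>)
  then have E: "ereal (measure_pmf.expectation \<pi> (internal_hamiltonian A g b x p)) \<le> ereal B" by simp
  \<comment> \<open>The constant function 1 is annihilated by the generator, so the infimum is at
    most 0 and the functional nonnegative, possibly infinite.\<close>
  have "(INF h\<in>{h. \<forall>i\<in>{1..N}. h i > 0}.
      ereal (measure_pmf.expectation \<pi> (\<lambda>z. rate_generator {1..N} (q x) h z / h z))) \<le> 0"
    by (rule INF_lower2[of "\<lambda>_. 1"]) (auto simp: rate_generator_def)
  then have "0 \<le> donsker_varadhan {1..N} (q x) \<pi>"
    unfolding donsker_varadhan_def by (simp add: ereal_0_le_uminus_iff)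
  with E show "ereal (measure_pmf.expectation \<pi> (internal_hamiltonian A g b x p))
      - donsker_varadhan {1..N} (q x) \<pi> \<le> ereal B"
    by (meson ereal_diff_le_self order_trans)
qed

context riem_mfd
begin

text \<open>The supremum is a real one, so it needs a nonempty bounded set: the zero vector and
  \<open>B\<close> provide this. The lower bound 0 is what later permits squaring the upper
  one.\<close>

lemma cotangent_norm_bounds:
  assumes "\<And>v. v \<in> tangent_space A x \<Longrightarrow> \<bar>p v\<bar> \<le> B * tangent_norm g x v" "B \<ge> 0"
  shows "cotangent_norm A g x p \<le> B" "0 \<le> cotangent_norm A g x p"
proof -
  let ?S = "{v \<in> tangent_space A x. tangent_norm g x v \<le> 1}"
  obtain c where c: "c \<in> A" "x \<in> chart_dom c" by (rule ex_chart)
  have "tangent_norm g x (\<lambda>c. 0) = 0"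
    using tangent_norm_eq_coord_norm[OF c zero_tangent] by (simp add: coord_norm_def coord_form_simps[OF c])
  then have 0: "(\<lambda>c. 0) \<in> ?S" using zero_tangent by simp
  have le: "\<bar>p v\<bar> \<le> B" if "v \<in> ?S" for v
  proof -
    have "\<bar>p v\<bar> \<le> B * tangent_norm g x v" using assms(1) that by blast
    also have "\<dots> \<le> B * 1" using that assms(2) by (intro mult_left_mono) auto
    finally show ?thesis by simp
  qed
  show "cotangent_norm A g x p \<le> B"
    unfolding cotangent_norm_def by (rule cSUP_least) (use 0 le in blast)+
  have "bdd_above ((\<lambda>v. \<bar>p v\<bar>) ` ?S)" using le by (intro bdd_aboveI2)
  from cSUP_upper2[OF this 0, of 0] show "0 \<le> cotangent_norm A g x p"
    unfolding cotangent_norm_def by simp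
qed

lemma log_containment_derivative:
  assumes f: "smooth_fun_on UNIV f" "\<And>x. f x \<ge> 0"
    and df: "\<And>v. v \<in> tangent_space A x \<Longrightarrow> \<bar>differential A f x v\<bar> \<le> 2 * tangent_norm g x v"
    and v: "v \<in> tangent_space A x"
  shows "\<bar>differential A (\<lambda>x. 1/2 * ln (1 + (f x)\<^sup>2)) x v\<bar> \<le> 2 * f x / (1 + (f x)\<^sup>2) * tangent_norm g x v"
proof -
  have p: "1 + t\<^sup>2 > 0" for t :: real by (simp add: add_pos_nonneg)
  have "((\<lambda>t. 1/2 * ln (1 + t\<^sup>2)) has_real_derivative f x / (1 + (f x)\<^sup>2)) (at (f x))"
    using p[of "f x"] by (auto intro!: derivative_eq_intros simp: field_simps)
  from differential_compose[OF f(1) _ v this]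
  have "\<bar>differential A (\<lambda>x. 1/2 * ln (1 + (f x)\<^sup>2)) x v\<bar> = f x / (1 + (f x)\<^sup>2) * \<bar>differential A f x v\<bar>"
    using p[of "f x"] f(2)[of x] by (simp add: abs_mult)
  also have "\<dots> \<le> f x / (1 + (f x)\<^sup>2) * (2 * tangent_norm g x v)"
    using f(2)[of x] p[of "f x"] by (intro mult_left_mono df[OF v]) auto
  also have "\<dots> = 2 * f x / (1 + (f x)\<^sup>2) * tangent_norm g x v" by simp
  finally show ?thesis .
qed

end

context connected_riem_mfd
begin

text \<open>Subtracting the minimum costs at most its absolute value, for which the approximation to
  within \<open>1 / 2\<close> leaves exactly enough room.\<close>

lemma normalized_distance_approximation:
  assumes "complete_riemannian A g"
  obtains f where "smooth_fun_on UNIV f" "\<And>x. f x \<ge> 0" "\<exists>x. f x = 0" "\<And>x. \<bar>f x - d x x0\<bar> \<le> 1"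
    "\<And>x v. v \<in> tangent_space A x \<Longrightarrow> \<bar>differential A f x v\<bar> \<le> 2 * tangent_norm g x v"
proof -
  obtain h where h: "smooth_fun_on UNIV h" "\<And>x. \<bar>h x - d x x0\<bar> \<le> 1 / 2"
    "\<And>x v. v \<in> tangent_space A x \<Longrightarrow> \<bar>differential A h x v\<bar> \<le> 2 * tangent_norm g x v"
    using smooth_distance_approximation[OF assms, of x0] by blast
  \<comment> \<open>Outside this ball \<open>h\<close> is at least \<open>3 / 2\<close>, while
    \<open>h x0\<close> is at most \<open>1 / 2\<close>; so the minimum over the compact ball is
    global.\<close>
  let ?K = "{y. d x0 y \<le> 2}"
  have hc: "continuous_on ?K h"
    using smooth_fun_on_continuous_on[OF open_UNIV h(1)] continuous_on_subset by blast
  have x0: "x0 \<in> ?K" by simp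
  obtain z where z: "z \<in> ?K" "\<And>y. y \<in> ?K \<Longrightarrow> h z \<le> h y"
    using continuous_attains_inf[OF compact_dist_ball[OF assms] _ hc] x0 by blast
  have min: "h z \<le> h y" for y
  proof (cases "y \<in> ?K")
    case False
    then have "d y x0 > 2" using dist_sym[of y x0] by simp
    then have "h y \<ge> 3 / 2" using h(2)[of y] by linarith
    moreover have "h x0 \<le> 1 / 2" using h(2)[of x0] by simp
    ultimately show ?thesis using z(2)[OF x0] by linarith
  qed (rule z(2))
  \<comment> \<open>From above by the value at \<open>x0\<close>, where the distance is 0; from
    below because the distance at \<open>z\<close> is nonnegative.\<close>
  have hz: "\<bar>h z\<bar> \<le> 1 / 2"
  proof -
    have "\<bar>h x0\<bar> \<le> 1 / 2" using h(2)[of x0] by simp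
    then show ?thesis using h(2)[of z] min[of x0] dist_nonneg[of z x0] by linarith
  qed
  show ?thesis
  proof (rule that[of "\<lambda>x. h x + - h z"])
    show "smooth_fun_on UNIV (\<lambda>x. h x + - h z)" by (intro smooth_fun_on_add h(1) smooth_fun_on_const open_UNIV)
    show "h x + - h z \<ge> 0" for x using min[of x] by simp
    show "\<exists>x. h x + - h z = 0" by (rule exI[of _ z]) simp
    show "\<bar>h x + - h z - d x x0\<bar> \<le> 1" for x using h(2)[of x] hz by linarith
    show "\<bar>differential A (\<lambda>x. h x + - h z) x v\<bar> \<le> 2 * tangent_norm g x v"
      if "v \<in> tangent_space A x" for x v
      using differential_add[OF h(1) smooth_fun_on_const[of _ "- h z"] UNIV_I that] h(3)[OF that]
        differential_const[OF that, of "- h z"] by linarith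
  qed
qed

end

theorem lemma5p4:
  fixes A :: "('m::{t2_space,second_countable_topology}, 'e::euclidean_space) chart set"
    and g :: "('m, 'e) metric"
    and N :: nat
    and b :: "'m \<Rightarrow> nat \<Rightarrow> ('m, 'e) tangent"
    and q :: "'m \<Rightarrow> nat \<Rightarrow> nat \<Rightarrow> real"
    and x0 :: 'm
    and C :: real
  assumes "riemannian_manifold A g"
    and "connected (UNIV :: 'm set)"
    and "complete_riemannian A g"
    and "N \<ge> 1"
    and "\<And>i. i \<in> {1..N} \<Longrightarrow> C1_vector_field A (\<lambda>x. b x i)"
    and "\<And>x. conservative_rate_matrix {1..N} (q x)"
    and "\<And>x. irreducible_rate_matrix {1..N} (q x)"
    and "C > 0"
    and "\<And>x i. i \<in> {1..N} \<Longrightarrow>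
           tangent_norm g x (b x i) \<le> C * (1 + riemannian_dist A g x x0)"
  shows "\<exists>f :: 'm \<Rightarrow> real.
           (\<forall>x. f x \<ge> 0) \<and>
           smooth_fun A f \<and>
           (\<forall>x. \<bar>f x - riemannian_dist A g x x0\<bar> \<le> 1) \<and>
           (\<forall>x. cotangent_norm A g x (differential A f x) \<le> 2) \<and>
           good_containment_function A (hamiltonian A g N b q)
             (\<lambda>x. 1/2 * ln (1 + (f x)\<^sup>2))"
proof -
  interpret connected_riem_mfd A g
    by unfold_locales (use assms in auto)
  obtain f where f: "smooth_fun_on UNIV f" "\<And>x. f x \<ge> 0" "\<exists>x. f x = 0" "\<And>x. \<bar>f x - d x x0\<bar> \<le> 1"
    "\<And>x v. v \<in> tangent_space A x \<Longrightarrow> \<bar>differential A f x v\<bar> \<le> 2 * tangent_norm g x v"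
    using normalized_distance_approximation[OF assms(3), of x0] by blast
  let ?Y = "\<lambda>x. 1/2 * ln (1 + (f x)\<^sup>2)"
  have pos: "1 + t\<^sup>2 > 0" for t :: real by (simp add: add_pos_nonneg)
  have "good_containment_function A (hamiltonian A g N b q) ?Y"
    unfolding good_containment_function_def
  proof (intro conjI allI impI)
    show "?Y x \<ge> 0" for x by simp
    obtain z where "f z = 0" using f(3) by blast
    then show "\<exists>x. ?Y x = 0" by (intro exI[of _ z]) simp
    have "smooth_fun_on UNIV (\<lambda>x. 1 + f x * f x)"
      by (intro smooth_fun_on_add smooth_fun_on_mult smooth_fun_on_const f(1) open_UNIV)
    then have "smooth_fun_on UNIV (\<lambda>x. 1 + (f x)\<^sup>2)" by (simp only: power2_eq_square)
    from smooth_fun_on_compose[OF open_UNIV smooth_on_ln _ this]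
    have "smooth_fun_on UNIV (\<lambda>x. ln (1 + (f x)\<^sup>2))" using pos by auto
    from smooth_fun_on_mult[OF open_UNIV smooth_fun_on_const this, of "1/2"]
    have Y: "smooth_fun_on UNIV ?Y" .
    then show "Ck_fun A 2 ?Y" by (simp add: smooth_fun_on_UNIV smooth_fun_def Ck_fun_def smooth_on_def)
    fix c :: real assume "c \<ge> 0"
    \<comment> \<open>A sublevel set forces \<open>f x \<le> exp c\<close>, hence lies in a compact
      distance ball; intersecting with that ball exhibits it as a closed subset of a compact
      set.\<close>
    have "{x. ?Y x \<le> c} = {y. d x0 y \<le> exp c + 1} \<inter> {x. ?Y x \<le> c}"
    proof -
      have "d x0 x \<le> exp c + 1" if "?Y x \<le> c" for x
      proof -
        have "exp (ln (1 + (f x)\<^sup>2)) \<le> exp (2 * c)" using that by simp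
        then have "1 + (f x)\<^sup>2 \<le> exp (2 * c)" using pos[of "f x"] by simp
        then have "(f x)\<^sup>2 \<le> (exp c)\<^sup>2" by (simp add: exp_double)
        then have "f x \<le> exp c" by (rule power2_le_imp_le) simp
        then show ?thesis using f(4)[of x] dist_sym[of x x0] by simp
      qed
      then show ?thesis by auto
    qed
    moreover have "closed {x. ?Y x \<le> c}"
      by (intro closed_Collect_le continuous_on_const smooth_fun_on_continuous_on[OF open_UNIV] Y)
    ultimately show "compact {x. ?Y x \<le> c}"
      using compact_Int_closed[OF compact_dist_ball[OF assms(3)]] by metis
  next
    \<comment> \<open>\<open>1 / 2\<close> comes from the quadratic term, as the covector has norm
      at most \<open>k \<le> 1\<close>. The drift term is at most \<open>k * C * (2 + f x)\<close>,
      and \<open>2 * k + k * f x \<le> 4\<close>.\<close>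
    have "hamiltonian A g N b q x (differential A ?Y x) \<le> ereal (4 * C + 1 / 2)" for x
    proof (rule hamiltonian_le[OF assms(4)])
      fix z assume z: "z \<in> {1..N}"
      define k where "k = 2 * f x / (1 + (f x)\<^sup>2)"
      have dY: "\<bar>differential A ?Y x v\<bar> \<le> k * tangent_norm g x v" if "v \<in> tangent_space A x" for v
        unfolding k_def by (rule log_containment_derivative[OF f(1,2) f(5) that])
      have k: "0 \<le> k" "k \<le> 1" "k * f x \<le> 2"
      proof -
        show "0 \<le> k" using f(2)[of x] pos[of "f x"] by (simp add: k_def)
        have "0 \<le> (f x - 1)\<^sup>2" by simp
        then have "2 * f x \<le> 1 + (f x)\<^sup>2" by (simp add: power2_diff)
        then show "k \<le> 1" using pos[of "f x"] by (simp add: k_def)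
        show "k * f x \<le> 2" using pos[of "f x"] by (simp add: k_def field_simps power2_eq_square)
      qed
      have cn: "(cotangent_norm A g x (differential A ?Y x))\<^sup>2 \<le> 1\<^sup>2"
        using cotangent_norm_bounds[OF dY k(1)] k(2) by (intro power_mono) auto
      have bz: "b x z \<in> tangent_space A x" using assms(5)[OF z] by (simp add: C1_vector_field_def)
      have "differential A ?Y x (b x z) \<le> k * tangent_norm g x (b x z)" using dY[OF bz] by simp
      also have "\<dots> \<le> k * (C * (1 + d x x0))" by (intro mult_left_mono assms(9)[OF z] k(1))
      \<comment> \<open>The growth of \<open>b\<close> is stated in the distance, the decay of
        \<open>k\<close> in \<open>f\<close>; they are exchanged at the cost of 1.\<close>
      also have "\<dots> \<le> k * (C * (2 + f x))"
        using f(4)[of x] assms(8) k(1) by (intro mult_left_mono) auto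
      also have "\<dots> = C * (2 * k + k * f x)" by (simp add: algebra_simps)
      also have "\<dots> \<le> C * 4" using k assms(8) by (intro mult_left_mono) auto
      finally show "internal_hamiltonian A g b x (differential A ?Y x) z \<le> 4 * C + 1 / 2"
        using cn by (simp add: internal_hamiltonian_def)
    qed
    then have "(SUP x. hamiltonian A g N b q x (differential A ?Y x)) \<le> ereal (4 * C + 1 / 2)"
      by (rule SUP_least)
    then show "(SUP x. hamiltonian A g N b q x (differential A ?Y x)) < \<infinity>"
      by (rule order_le_less_trans) simp
  qed
  moreover have "cotangent_norm A g x (differential A f x) \<le> 2" for x
    by (rule cotangent_norm_bounds(1)[OF f(5)]) simp_all
  ultimately show ?thesis using f by (intro exI[of _ f]) (simp add: smooth_fun_on_UNIV)
qed

end
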